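(* Let $f:\mathbf{N}(\mathbb{R}^{[2d]}\times[0,1])\to\mathbb{R}$ be measurable and let $x\in\mathbb{R}^d$. Assume that $f$ is determined by a compact set $W\subset\mathbb{R}^d$ with $\{0,x\}\subset W$. For $r\ge 0$ put $F_r:=f(\chi^{0,x}_r)$. Let $s\ge 0$ and $t\ge -s$ be such that $\mathbb{E}|F_{s+|t|}|<\infty$. Then $$\mathbb{E}F_{s+t}=\mathbb{E}F_s+\sum_{n=1}^\infty\frac{t^n}{n!}\int_{W^n}\mathbb{E}\,\Delta^n_{\mathbf{x}}F_s\,d\mathbf{x}.$$
   Context: $\mathbb{R}^{[2d]}$ is the space of all two-element subsets $e$ of $\mathbb{R}^d$, with the Hausdorff metric. $\mathbf{N}(\mathbb{R}^{[2d]}\times[0,1])$ is the space of integer-valued locally finite measures on $\mathbb{R}^{[2d]}\times[0,1]$ with the smallest $\sigma$-field making all evaluations $\mu\mapsto\mu(B)$, $B$ Borel, measurable; such measures are identified with the (multi)sets of their atoms. $<$ denotes the strict lexicographic order on $\mathbb{R}^d$, and $[n]:=\{1,\dots,n\}$. For $r\ge0$, $\eta_r$ is a stationary Poisson process on $\mathbb{R}^d$ with intensity $r$; for $r>0$ write $\eta_r=\{X_i:i\in\mathbb{N}\}$ with almost surely distinct $X_i$, and $\eta_0=\emptyset$. For points $y_1,\dots,y_k\in\mathbb{R}^d$, let $(Z_i)_{i\in I}$ be the family consisting of $y_1,\dots,y_k$ together with (if $r>0$) the points $X_j$, $j\in\mathbb{N}$, and define the point process on $\mathbb{R}^{[2d]}\times[0,1]$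 $$\chi_r^{y_1,\dots,y_k}:=\{(\{Z_i,Z_j\},U_{i,j}): i,j\in I,\ Z_i<Z_j\},$$ where the $U_{i,j}$ are independent, uniformly distributed on $[0,1]$, and independent of $\eta_r$. When the added points vary over subfamilies of one fixed finite family, the same marks are used for the same pairs of indices. For $\mathbf{x}=(x_1,\dots,x_n)$ and $J\subset[n]$ let $\mathbf{x}_J:=(x_i)_{i\in J}$, so that $\chi_r^{0,\mathbf{x}_J,x}$ has added points $0$, $x_i$ ($i\in J$) and $x$; for $J=\emptyset$ it is $\chi_r^{0,x}$. For $F_r=f(\chi_r^{0,x})$, $$\Delta^n_{\mathbf{x}}F_r:=\sum_{J\subset[n]}(-1)^{n-|J|}f\big(\chi_r^{0,\mathbf{x}_J,x}\big),\quad \mathbf{x}\in(\mathbb{R}^d)^n .$$ $f$ is determined by a compact set $W\subset\mathbb{R}^d$ if $f(\mu)=f(\mu_W)$ for all $\mu$, where $\mu_W:=\{(e,u)\in\mu: e\subset W\}$. *)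

theory Defs
  imports "HOL-Probability.Probability"
begin

definition lex_less :: "real ^ 'd::{finite,linorder} \<Rightarrow> real ^ 'd::{finite,linorder} \<Rightarrow> bool"
  where "lex_less a b \<longleftrightarrow> (\<exists>i. a $ i < b $ i \<and> (\<forall>j<i. a $ j = b $ j))"

definition edges :: "'a set set"
  where "edges = {e. card e = 2}"

definition hausdorff_dist :: "'a::metric_space set \<Rightarrow> 'a set \<Rightarrow> real"
  where "hausdorff_dist A B = max (SUP a\<in>A. infdist a B) (SUP b\<in>B. infdist b A)"

text \<open>Metrics have to be total functions that are nonnegative everywhere, and suprema of unbounded
  sets are unspecified; hence the value \<open>0\<close> outside the carrier.\<close>

definition edge_metric :: "'a::metric_space set metric"
  where "edge_metric = metric (edges, \<lambda>A B. if A \<in> edges \<and> B \<in> edges then hausdorff_dist A B else 0)"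

definition marked_edge_metric :: "('a::metric_space set \<times> real) metric"
  where "marked_edge_metric = prod_metric edge_metric (submetric euclidean_metric {0..1})"

text \<open>The type of metrics is abstract, so that \<^const>\<open>edge_metric\<close> only means what it should
  once the metric axioms are known.\<close>

lemma hausdorff_dist_le_iff:
  fixes A B :: "'a::metric_space set"
  assumes "finite A" "A \<noteq> {}" "finite B" "B \<noteq> {}"
  shows "hausdorff_dist A B \<le> c \<longleftrightarrow>
    (\<forall>a\<in>A. \<exists>b\<in>B. dist a b \<le> c) \<and> (\<forall>b\<in>B. \<exists>a\<in>A. dist a b \<le> c)"
proof -
  have *: "infdist a C \<le> c \<longleftrightarrow> (\<exists>b\<in>C. dist a b \<le> c)" if "finite C" "C \<noteq> {}" for a :: 'a and C
    using that by (simp add: infdist_def cInf_eq_Min Min_le_iff)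
  have **: "(SUP a\<in>A'. infdist a C) \<le> c \<longleftrightarrow> (\<forall>a\<in>A'. infdist a C \<le> c)"
    if "finite A'" "A' \<noteq> {}" for A' C :: "'a set"
    using that by (intro cSUP_le_iff) auto
  show ?thesis
    using assms by (simp add: hausdorff_dist_def * ** dist_commute)
qed

lemma Metric_space_edges:
  "Metric_space edges (\<lambda>A B :: 'a::metric_space set. if A \<in> edges \<and> B \<in> edges then hausdorff_dist A B else 0)"
proof -
  have fin: "finite A \<and> A \<noteq> {}" if "A \<in> edges" for A :: "'a set"
    using that by (auto simp: edges_def intro: card_ge_0_finite)
  have le: "hausdorff_dist A B \<le> c \<longleftrightarrow>
    (\<forall>a\<in>A. \<exists>b\<in>B. dist a b \<le> c) \<and> (\<forall>b\<in>B. \<exists>a\<in>A. dist a b \<le> c)"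
    if "A \<in> edges" "B \<in> edges" for A B :: "'a set" and c
    using hausdorff_dist_le_iff fin that by metis
  have nonneg: "0 \<le> hausdorff_dist A B" if E: "A \<in> edges" "B \<in> edges" for A B :: "'a set"
  proof -
    obtain a where "a \<in> A"
      using fin[OF E(1)] by blast
    then obtain b where "dist a b \<le> hausdorff_dist A B"
      using le[OF E, of "hausdorff_dist A B"] by blast
    then show ?thesis using zero_le_dist[of a b] by linarith
  qed
  have zero: "hausdorff_dist A B = 0 \<longleftrightarrow> A = B" if E: "A \<in> edges" "B \<in> edges" for A B :: "'a set"
  proof -
    have "hausdorff_dist A B = 0 \<longleftrightarrow> hausdorff_dist A B \<le> 0"
      using nonneg[OF E] by linarith
    also have "\<dots> \<longleftrightarrow> A = B"
      unfolding le[OF E] by auto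
    finally show ?thesis .
  qed
  have triangle: "hausdorff_dist A C \<le> hausdorff_dist A B + hausdorff_dist B C"
    if E: "A \<in> edges" "B \<in> edges" "C \<in> edges" for A B C :: "'a set"
  proof -
    have 1: "(\<forall>a\<in>A. \<exists>b\<in>B. dist a b \<le> hausdorff_dist A B) \<and> (\<forall>b\<in>B. \<exists>a\<in>A. dist a b \<le> hausdorff_dist A B)"
      using le[OF E(1,2)] by blast
    have 2: "(\<forall>a\<in>B. \<exists>b\<in>C. dist a b \<le> hausdorff_dist B C) \<and> (\<forall>b\<in>C. \<exists>a\<in>B. dist a b \<le> hausdorff_dist B C)"
      using le[OF E(2,3)] by blast
    have tri: "dist a c \<le> x + y" if "dist a b \<le> x" "dist b c \<le> y" for a b c :: 'a and x y
      using dist_triangle[of a c b] that by linarith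
    show ?thesis
      unfolding le[OF E(1,3)] using 1 2 tri by meson
  qed
  have sym: "hausdorff_dist A B = hausdorff_dist B A" for A B :: "'a set"
    by (simp add: hausdorff_dist_def max.commute)
  show ?thesis
    by unfold_locales (auto simp: nonneg zero triangle sym)
qed

lemma mspace_edge_metric [simp]: "mspace edge_metric = edges"
  by (simp add: edge_metric_def Metric_space.mspace_metric Metric_space_edges)

lemma mdist_edge_metric:
  "A \<in> edges \<Longrightarrow> B \<in> edges \<Longrightarrow> mdist edge_metric A B = hausdorff_dist A B"
  by (simp add: edge_metric_def Metric_space.mdist_metric Metric_space_edges)

definition metric_borel :: "'b metric \<Rightarrow> 'b measure"
  where "metric_borel m = sigma (mspace m) {G. openin (mtopology_of m) G}"

text \<open>Locally finite means finite on metrically bounded Borel sets.\<close>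

definition point_measures :: "'b metric \<Rightarrow> 'b measure set"
  where "point_measures m = {\<mu>. sets \<mu> = sets (metric_borel m) \<and>
    (\<forall>B\<in>sets (metric_borel m). emeasure \<mu> B \<in> range of_nat \<union> {\<infinity>}) \<and>
    (\<forall>B\<in>sets (metric_borel m). Metric_space.mbounded (mspace m) (mdist m) B \<longrightarrow> emeasure \<mu> B < \<infinity>)}"

definition point_measure_space :: "'b metric \<Rightarrow> 'b measure measure"
  where "point_measure_space m = sigma (point_measures m)
    {{\<mu>\<in>point_measures m. emeasure \<mu> B \<in> A} | B A. B \<in> sets (metric_borel m) \<and> A \<in> sets borel}"

definition restrict_edges ::
  "'a::metric_space set \<Rightarrow> ('a set \<times> real) measure \<Rightarrow> ('a set \<times> real) measure"
  where "restrict_edges W \<mu> = density \<mu> (indicator {(e, u). e \<subseteq> W})"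

definition determined_by ::
  "(('a::metric_space set \<times> real) measure \<Rightarrow> real) \<Rightarrow> 'a set \<Rightarrow> bool"
  where "determined_by f W \<longleftrightarrow>
    (\<forall>\<mu>\<in>point_measures marked_edge_metric. f \<mu> = f (restrict_edges W \<mu>))"

definition point_count :: "(nat \<Rightarrow> 'w \<Rightarrow> 'a) \<Rightarrow> 'a set \<Rightarrow> 'w \<Rightarrow> ennreal"
  where "point_count X B \<omega> = emeasure (count_space UNIV) {j. X j \<omega> \<in> B}"

text \<open>The points of the process are \<open>X 0, X 1, \<dots>\<close>; local finiteness is required for every
  outcome, since a point process is a random element of the space of locally finite measures.
  The last two clauses are the defining properties of a Poisson process with intensity measure
  \<open>r\<close> times Lebesgue measure, where a Poisson variable with infinite mean is infinite almost
  surely.\<close>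

definition poisson_points :: "'w measure \<Rightarrow> real \<Rightarrow> (nat \<Rightarrow> 'w \<Rightarrow> 'a::euclidean_space) \<Rightarrow> bool"
  where "poisson_points M r X \<longleftrightarrow>
    (\<forall>j. X j \<in> borel_measurable M) \<and>
    (\<forall>\<omega>\<in>space M. \<forall>B. bounded B \<longrightarrow> finite {j. X j \<omega> \<in> B}) \<and>
    (AE \<omega> in M. inj (\<lambda>j. X j \<omega>)) \<and>
    (\<forall>B\<in>sets borel. \<forall>k. measure M {\<omega>\<in>space M. point_count X B \<omega> = of_nat k} =
      (if emeasure lborel B = \<infinity> then 0
       else (r * measure lborel B) ^ k / fact k * exp (- (r * measure lborel B)))) \<and>
    (\<forall>K B. finite (K :: nat set) \<and> disjoint_family_on B K \<and> (\<forall>k\<in>K. B k \<in> sets borel) \<longrightarrow>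
      prob_space.indep_vars M (\<lambda>_. borel) (\<lambda>k. point_count X (B k)) K)"

text \<open>\<open>Inl k\<close> indexes the \<open>k\<close>-th added point and \<open>Inr j\<close> the \<open>j\<close>-th point of the Poisson process.\<close>

type_synonym point_index = "nat + nat"

text \<open>Marks are provided for all ordered pairs of indices; only those of pairs \<open>(i, j)\<close> with
  \<open>Z\<^sub>i < Z\<^sub>j\<close> are used. The points \<open>X\<close> play no role for \<open>r = 0\<close>.\<close>

definition marked_poisson ::
  "'w measure \<Rightarrow> real \<Rightarrow> (nat \<Rightarrow> 'w \<Rightarrow> 'a::euclidean_space) \<Rightarrow>
   (point_index \<times> point_index \<Rightarrow> 'w \<Rightarrow> real) \<Rightarrow> bool"
  where "marked_poisson M r X U \<longleftrightarrow>
    (\<forall>p. U p \<in> borel_measurable M \<and> (\<forall>\<omega>\<in>space M. U p \<omega> \<in> {0..1}) \<and>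
       distr M borel (U p) = uniform_measure lborel {0..1}) \<and>
    prob_space.indep_vars M (\<lambda>_. borel) U UNIV \<and>
    (r > 0 \<longrightarrow> poisson_points M r X \<and>
       prob_space.indep_set M
         {(\<lambda>\<omega> j. X j \<omega>) -` A \<inter> space M | A. A \<in> sets (\<Pi>\<^sub>M j\<in>UNIV. borel)}
         {(\<lambda>\<omega> p. U p \<omega>) -` A \<inter> space M | A. A \<in> sets (\<Pi>\<^sub>M p\<in>UNIV. borel)})"

text \<open>A finite partial map \<open>y\<close> lists the added points. The multiset of marked edges is turned into
  a measure as the image of the counting measure on the pairs \<open>(i, j)\<close> with \<open>Z\<^sub>i < Z\<^sub>j\<close>.\<close>

definition edge_process ::
  "real \<Rightarrow> (nat \<Rightarrow> 'w \<Rightarrow> real ^ 'd::{finite,linorder}) \<Rightarrow> (point_index \<times> point_index \<Rightarrow> 'w \<Rightarrow> real) \<Rightarrow>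
   (nat \<rightharpoonup> real ^ 'd::{finite,linorder}) \<Rightarrow> 'w \<Rightarrow> ((real ^ 'd::{finite,linorder}) set \<times> real) measure"
  where "edge_process r X U y \<omega> =
    (let I = Inl ` dom y \<union> (if r > 0 then range Inr else {});
         Z = case_sum (\<lambda>k. the (y k)) (\<lambda>j. X j \<omega>)
     in distr (count_space {(i, j). i \<in> I \<and> j \<in> I \<and> lex_less (Z i) (Z j)})
          (metric_borel marked_edge_metric) (\<lambda>(i, j). ({Z i, Z j}, U (i, j) \<omega>)))"

text \<open>The added points \<open>0\<close>, \<open>x\<close> and \<open>x\<^sub>i\<close> get the indices \<open>0\<close>, \<open>1\<close> and \<open>i + 1\<close>, so that the marks do
  not depend on which of the \<open>x\<^sub>i\<close> are present.\<close>

definition added_points ::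
  "real ^ 'd::{finite,linorder} \<Rightarrow> (nat \<Rightarrow> real ^ 'd::{finite,linorder}) \<Rightarrow> nat set \<Rightarrow> nat \<rightharpoonup> real ^ 'd::{finite,linorder}"
  where "added_points x xs J =
    [0 \<mapsto> 0, 1 \<mapsto> x] ++ (\<lambda>k. if k \<in> Suc ` J then Some (xs (k - 1)) else None)"

definition rooted_functional ::
  "(((real ^ 'd::{finite,linorder}) set \<times> real) measure \<Rightarrow> real) \<Rightarrow> real ^ 'd::{finite,linorder} \<Rightarrow> real \<Rightarrow>
   (nat \<Rightarrow> 'w \<Rightarrow> real ^ 'd::{finite,linorder}) \<Rightarrow> (point_index \<times> point_index \<Rightarrow> 'w \<Rightarrow> real) \<Rightarrow> 'w \<Rightarrow> real"
  where "rooted_functional f x r X U \<omega> = f (edge_process r X U [0 \<mapsto> 0, 1 \<mapsto> x] \<omega>)"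

definition difference ::
  "(((real ^ 'd::{finite,linorder}) set \<times> real) measure \<Rightarrow> real) \<Rightarrow> real ^ 'd::{finite,linorder} \<Rightarrow> real \<Rightarrow>
   (nat \<Rightarrow> 'w \<Rightarrow> real ^ 'd::{finite,linorder}) \<Rightarrow> (point_index \<times> point_index \<Rightarrow> 'w \<Rightarrow> real) \<Rightarrow>
   nat \<Rightarrow> (nat \<Rightarrow> real ^ 'd::{finite,linorder}) \<Rightarrow> 'w \<Rightarrow> real"
  where "difference f x r X U n xs \<omega> =
    (\<Sum>J\<in>Pow {1..n}. (- 1) ^ (n - card J) * f (edge_process r X U (added_points x xs J) \<omega>))"

end

theory Submission
  imports Defs
begin

text \<open>
  Let \<open>w\<close> be the volume of the window \<open>W\<close>. Since \<open>f\<close> only sees the edges inside \<open>W\<close>, the functional at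
  intensity \<open>r\<close> depends on the Poisson process only through its points in \<open>W\<close>. There are \<open>k\<close> of them
  with probability \<open>exp (- r * w) * (r * w) ^ k / fact k\<close>, and then they are distributed like \<open>k\<close>
  independent uniform points of \<open>W\<close>. Let \<open>\<alpha> k\<close> be the integral, over \<open>k\<close> points in \<open>W\<close>, of the mean of
  \<open>f\<close> for the marked edges between these points and the roots \<open>0\<close> and \<open>x\<close>. Then the expectation at
  intensity \<open>r\<close> is \<open>exp (- r * w) * A r\<close>, where \<open>A r = (\<Sum>k. r ^ k / fact k * \<alpha> k)\<close>. If \<open>card J\<close> points
  are added and integrated over \<open>W\<close>, they act as further points of the process, and \<open>\<alpha> k\<close> is
  replaced by \<open>\<alpha> (card J + k)\<close>; that is, \<open>A\<close> is replaced by its derivative of order \<open>card J\<close>. The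
  alternating sum over \<open>J \<subseteq> {1..n}\<close> is therefore the Leibniz rule for the \<open>n\<close>-th derivative of
  \<open>exp (- r * w) * A r\<close> at \<open>r = s\<close>, and the theorem is the Taylor expansion of this function around \<open>s\<close>.
  Integrability at intensity \<open>s + \<bar>t\<bar>\<close> means that the power series converges absolutely there, which
  gives convergence and permits all rearrangements.

  Most of the work is in the first step, as the Poisson process is given as a sequence of points
  through the laws of its numbers of points in disjoint sets, and the marks are attached to pairs of
  indices. On the event that \<open>W\<close> contains exactly \<open>k\<close> points, the tuples that enumerate these points have
  intensity \<open>exp (- r * w) * r ^ k\<close> times Lebesgue measure (\<open>poisson_tuples_intensity\<close>). For boxes with
  disjoint sides this says that each side contains one point and the rest of \<open>W\<close> none, and such boxes
  suffice because both measures vanish on tuples with repeated entries. Each of the \<open>fact k\<close>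
  enumerations renames the random points into added points; for a fixed tuple of indices the renamed
  marks are again independent and uniform, and independent of the points, so they can be averaged out
  (\<open>nn_integral_given_number_of_points\<close>). Integration over the added points yields
  \<open>integral_added_points_edge_process\<close>, and \<open>alternating_expansion\<close> is the Taylor expansion.
\<close>

section \<open>The space of marked edges\<close>

lemma mspace_marked_edge_metric [simp]: "mspace marked_edge_metric = edges \<times> {0..1}"
  by (simp add: marked_edge_metric_def)

lemma mdist_marked_edge_metric:
  assumes "A \<in> edges" "B \<in> edges"
  shows "mdist marked_edge_metric (A, u) (B, v) = sqrt ((hausdorff_dist A B)\<^sup>2 + (dist u v)\<^sup>2)"
  by (simp add: marked_edge_metric_def prod_dist_def mdist_edge_metric[OF assms])

lemma hausdorff_dist_edges_le_iff:
  assumes "A \<in> edges" "B \<in> edges"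
  shows "hausdorff_dist A B \<le> c \<longleftrightarrow>
    (\<forall>a\<in>A. \<exists>b\<in>B. dist a b \<le> c) \<and> (\<forall>b\<in>B. \<exists>a\<in>A. dist a b \<le> c)"
proof -
  have "finite e \<and> e \<noteq> {}" if "e \<in> edges" for e :: "'a set"
    using that by (auto simp: edges_def intro: card_ge_0_finite)
  then show ?thesis
    using assms by (intro hausdorff_dist_le_iff) auto
qed

lemma hausdorff_dist_edges_nonneg:
  assumes "A \<in> edges" "B \<in> edges"
  shows "0 \<le> hausdorff_dist A B"
proof -
  have "mdist edge_metric A B \<ge> 0" by simp
  then show ?thesis by (simp add: mdist_edge_metric[OF assms])
qed

lemma hausdorff_dist_le_mdist_marked:
  assumes "A \<in> edges" "B \<in> edges"
  shows "hausdorff_dist A B \<le> mdist marked_edge_metric (A, u) (B, v)"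
  using hausdorff_dist_edges_nonneg[OF assms]
  by (simp add: mdist_marked_edge_metric[OF assms] real_le_rsqrt)

lemma openin_mtopology_of:
  "openin (mtopology_of m) G \<longleftrightarrow>
    G \<subseteq> mspace m \<and> (\<forall>p\<in>G. \<exists>r>0. \<forall>q\<in>mspace m. mdist m p q < r \<longrightarrow> q \<in> G)"
proof -
  have "{q. p \<in> mspace m \<and> q \<in> mspace m \<and> mdist m p q < r} \<subseteq> G \<longleftrightarrow>
      (\<forall>q\<in>mspace m. mdist m p q < r \<longrightarrow> q \<in> G)" if "p \<in> mspace m" for p r
    using that by blast
  then show ?thesis
    unfolding mtopology_of_def Metric_space.openin_mtopology[OF Metric_space_mspace_mdist]
      Metric_space.mball_def[OF Metric_space_mspace_mdist] by (meson subsetD)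
qed

lemma space_metric_borel: "space (metric_borel m) = mspace m"
  unfolding metric_borel_def
  by (intro space_measure_of) (auto simp: openin_mtopology_of subset_iff)

lemma sets_metric_borel: "sets (metric_borel m) = sigma_sets (mspace m) {G. openin (mtopology_of m) G}"
  unfolding metric_borel_def
  by (intro sets_measure_of) (auto simp: openin_mtopology_of subset_iff)

lemma pair_mem_edges [simp]: "{a, b} \<in> edges \<longleftrightarrow> a \<noteq> b"
  by (cases "a = b") (auto simp: edges_def)

text \<open>The unordered pair depends continuously on its two ends as long as these differ: moving the
  ends by less than \<open>\<delta>\<close> moves the pair by less than \<open>\<delta>\<close> in the Hausdorff metric.\<close>

lemma marked_edge_measurable:
  "(\<lambda>(a, b, u). ({a, b}, u)) \<in>
     restrict_space borel {(a :: 'a::euclidean_space, b :: 'a, u :: real). a \<noteq> b \<and> u \<in> {0..1}} \<rightarrow>\<^sub>M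
     metric_borel marked_edge_metric" (is "?g \<in> restrict_space borel ?D \<rightarrow>\<^sub>M _")
  unfolding metric_borel_def
proof (rule measurable_measure_of)
  show "{G. openin (mtopology_of marked_edge_metric) G}
      \<subseteq> Pow (mspace (marked_edge_metric :: ('a set \<times> real) metric))"
    by (auto simp: openin_mtopology_of)
  show "?g \<in> space (restrict_space borel ?D) \<rightarrow> mspace marked_edge_metric"
    by (auto simp: space_restrict_space)
  fix G :: "('a set \<times> real) set"
  assume "G \<in> {G. openin (mtopology_of marked_edge_metric) G}"
  then have G: "G \<subseteq> edges \<times> {0..1}"
      "\<And>p. p \<in> G \<Longrightarrow> \<exists>r>0. \<forall>q\<in>edges \<times> {0..1}. mdist marked_edge_metric p q < r \<longrightarrow> q \<in> G"
    by (auto simp: openin_mtopology_of)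
  have "openin (top_of_set ?D) (?g -` G \<inter> ?D)"
    unfolding openin_euclidean_subtopology_iff
  proof (intro conjI ballI)
    fix p assume p: "p \<in> ?g -` G \<inter> ?D"
    obtain a b u where p_eq: "p = (a, b, u)" by (cases p)
    have ab: "a \<noteq> b" and gG: "({a, b}, u) \<in> G" using p p_eq by auto
    obtain r where r: "r > 0" "\<And>q. q \<in> edges \<times> {0..1} \<Longrightarrow>
        mdist marked_edge_metric ({a, b}, u) q < r \<Longrightarrow> q \<in> G"
      using G(2)[OF gG] by blast
    have "p' \<in> ?g -` G \<inter> ?D" if p': "p' \<in> ?D" and d: "dist p' p < r / 2" for p'
    proof -
      obtain a' b' u' where p'_eq: "p' = (a', b', u')" by (cases p')
      have ab': "a' \<noteq> b'" and u': "u' \<in> {0..1}" using p' p'_eq by auto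
      have d1: "dist a a' < r / 2"
        using d dist_fst_le[of p p'] by (simp add: p_eq p'_eq dist_commute)
      have "dist b b' \<le> dist (b, u) (b', u')" "dist u u' \<le> dist (b, u) (b', u')"
        using dist_fst_le[of "(b, u)" "(b', u')"] dist_snd_le[of "(b, u)" "(b', u')"] by simp_all
      moreover have "dist (b, u) (b', u') < r / 2"
        using d dist_snd_le[of p p'] by (simp add: p_eq p'_eq dist_commute)
      ultimately have d2: "dist b b' < r / 2" and d3: "dist u u' < r / 2" by simp_all
      let ?m = "max (dist a a') (dist b b')"
      have h: "hausdorff_dist {a, b} {a', b'} \<le> ?m"
        using ab ab' by (subst hausdorff_dist_edges_le_iff) (auto simp: dist_commute)
      have "mdist marked_edge_metric ({a, b}, u) ({a', b'}, u')
          = sqrt ((hausdorff_dist {a, b} {a', b'})\<^sup>2 + (dist u u')\<^sup>2)"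
        using ab ab' by (intro mdist_marked_edge_metric) auto
      also have "\<dots> \<le> \<bar>hausdorff_dist {a, b} {a', b'}\<bar> + \<bar>dist u u'\<bar>"
        by (rule sqrt_sum_squares_le_sum_abs)
      also have "\<dots> < r"
        using h d1 d2 d3 hausdorff_dist_edges_nonneg[of "{a, b}" "{a', b'}"] ab ab' by simp
      finally have "({a', b'}, u') \<in> G"
        using r(2)[of "({a', b'}, u')"] ab' u' by auto
      then show ?thesis using p' p'_eq by auto
    qed
    then show "\<exists>e>0. \<forall>x'\<in>?D. dist x' p < e \<longrightarrow> x' \<in> ?g -` G \<inter> ?D"
      using r(1) by (intro exI[of _ "r / 2"]) auto
  qed auto
  then obtain T where T: "open T" "?g -` G \<inter> ?D = ?D \<inter> T"
    by (auto simp: openin_open)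
  then show "?g -` G \<inter> space (restrict_space borel ?D) \<in> sets (restrict_space borel ?D)"
    by (auto simp: space_restrict_space sets_restrict_space)
qed

text \<open>An edge that leaves a closed set \<open>W\<close> has an end at positive distance from \<open>W\<close>, and this
  persists under small changes in the Hausdorff metric; hence the edges inside \<open>W\<close> form a closed
  set.\<close>

lemma edges_inside_closed_measurable:
  assumes "closed W"
  shows "{(e, u). e \<in> edges \<and> u \<in> {0..1} \<and> e \<subseteq> W} \<in> sets (metric_borel marked_edge_metric)"
    (is "?C \<in> _")
proof -
  let ?S = "mspace (marked_edge_metric :: ('a set \<times> real) metric)"
  have "openin (mtopology_of marked_edge_metric) (?S - ?C)"
    unfolding openin_mtopology_of
  proof (intro conjI ballI)
    fix p assume "p \<in> ?S - ?C"
    moreover obtain e u where "p = (e, u)" by (cases p)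
    ultimately have p: "p = (e, u)" "e \<in> edges" "u \<in> {0..1}" "\<not> e \<subseteq> W" by auto
    then obtain a where a: "a \<in> e" "a \<notin> W" by auto
    obtain r where r: "r > 0" "\<And>b. dist b a < r \<Longrightarrow> b \<notin> W"
      using assms a(2) by (auto simp: closed_def open_dist)
    show "\<exists>r>0. \<forall>q\<in>?S. mdist marked_edge_metric p q < r \<longrightarrow> q \<in> ?S - ?C"
    proof (intro exI[of _ r] conjI ballI impI r)
      fix q assume q: "q \<in> ?S" "mdist marked_edge_metric p q < r"
      obtain e' u' where q': "q = (e', u')" "e' \<in> edges" using q by auto
      have "hausdorff_dist e e' \<le> mdist marked_edge_metric p q"
        using p q' by (simp add: hausdorff_dist_le_mdist_marked)
      then obtain b where "b \<in> e'" "dist a b < r"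
        using hausdorff_dist_edges_le_iff[OF p(2) q'(2), of "mdist marked_edge_metric p q"] a(1) q(2)
        by (meson le_less_trans)
      then show "q \<in> ?S - ?C" using q q' r(2) by (auto simp: dist_commute)
    qed
  qed auto
  then have "?S - ?C \<in> sets (metric_borel marked_edge_metric)"
    by (simp add: sets_metric_borel sigma_sets.Basic)
  then have "?S - (?S - ?C) \<in> sets (metric_borel marked_edge_metric)"
    using sets.compl_sets by (fastforce simp: space_metric_borel)
  moreover have "?S - (?S - ?C) = ?C" by auto
  ultimately show ?thesis by simp
qed

text \<open>The ends of all edges within Hausdorff distance \<open>R\<close> of a fixed edge lie in the union of the two
  balls of radius \<open>R\<close> around its ends.\<close>

lemma bounded_edges_in_bounded_set:
  assumes "Metric_space.mbounded (mspace marked_edge_metric) (mdist marked_edge_metric)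
    (B :: ('a::metric_space set \<times> real) set)"
  shows "\<exists>C. bounded C \<and> (\<forall>(e, u)\<in>B. e \<subseteq> C)"
proof (cases "B = {}")
  case True
  then show ?thesis by (intro exI[of _ "{}"]) simp
next
  case False
  let ?m = "marked_edge_metric :: ('a set \<times> real) metric"
  have "Metric_space.mbounded (mspace ?m) (mdist ?m) B \<longleftrightarrow>
      B = {} \<or> (\<forall>q\<in>B. q \<in> mspace ?m) \<and> (\<exists>y R. y \<in> mspace ?m \<and> (\<forall>q\<in>B. mdist ?m y q \<le> R))"
    by (rule Metric_space.mbounded[OF Metric_space_mspace_mdist])
  then have "(\<forall>q\<in>B. q \<in> mspace ?m) \<and> (\<exists>y R. y \<in> mspace ?m \<and> (\<forall>q\<in>B. mdist ?m y q \<le> R))"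
    using assms False by (elim iffE impE disjE) simp_all
  then obtain y R where y: "y \<in> edges \<times> {0..1}"
      and sub: "\<forall>q\<in>B. q \<in> edges \<times> {0..1}"
      and R: "\<forall>q\<in>B. mdist marked_edge_metric y q \<le> R"
    unfolding mspace_marked_edge_metric by (elim conjE exE) (rule that)
  obtain e0 u0 where y_eq: "y = (e0, u0)" by (cases y)
  have 0: "e0 \<in> edges" using y y_eq by simp
  have fin: "finite e0" using 0 by (auto simp: edges_def intro: card_ge_0_finite)
  define C where "C = (\<Union>b\<in>e0. cball b R)"
  have sub: "e \<subseteq> C" if "(e, u) \<in> B" for e u
  proof
    fix a assume a: "a \<in> e"
    have e: "e \<in> edges" using bspec[OF sub that] by simp
    have "hausdorff_dist e0 e \<le> R"
      using hausdorff_dist_le_mdist_marked[OF 0 e, of u0 u] R[rule_format, OF that]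
      by (simp add: y_eq)
    then show "a \<in> C"
      using hausdorff_dist_edges_le_iff[OF 0 e, of R] a by (auto simp: C_def)
  qed
  have "bounded C" unfolding C_def using fin by (intro bounded_UN) simp_all
  then show ?thesis using sub by (intro exI[of _ C] conjI ballI) auto
qed

section \<open>The marked edges between indexed points\<close>

text \<open>The edge process of a family of points, with an arbitrary type of indices: the argument below
  renames the random points of the process into added points, which requires a common description
  of both.\<close>

definition marked_edges ::
  "('i \<Rightarrow> real ^ 'd::{finite,linorder}) \<Rightarrow> 'i set \<Rightarrow> ('i \<times> 'i \<Rightarrow> real) \<Rightarrow>
   ((real ^ 'd::{finite,linorder}) set \<times> real) measure"
  where "marked_edges z I u =
    distr (count_space {(i, j). i \<in> I \<and> j \<in> I \<and> lex_less (z i) (z j)})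
      (metric_borel marked_edge_metric) (\<lambda>(i, j). ({z i, z j}, u (i, j)))"

lemma lex_less_irrefl [simp]: "\<not> lex_less a a"
  by (simp add: lex_less_def)

lemma sets_marked_edges [simp]: "sets (marked_edges z I u) = sets (metric_borel marked_edge_metric)"
  by (simp add: marked_edges_def)

lemma emeasure_marked_edges:
  assumes B: "B \<in> sets (metric_borel marked_edge_metric)" and u: "\<And>p. u p \<in> {0..1}"
  shows "emeasure (marked_edges z I u) B =
    emeasure (count_space UNIV)
      {(i, j). i \<in> I \<and> j \<in> I \<and> lex_less (z i) (z j) \<and> ({z i, z j}, u (i, j)) \<in> B}"
proof -
  let ?S = "{(i, j). i \<in> I \<and> j \<in> I \<and> lex_less (z i) (z j)}" and ?g = "\<lambda>(i, j). ({z i, z j}, u (i, j))"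
  have "?g \<in> count_space ?S \<rightarrow>\<^sub>M metric_borel marked_edge_metric"
    using u by (auto simp: space_metric_borel)
  then have "emeasure (marked_edges z I u) B = emeasure (count_space ?S) (?g -` B \<inter> ?S)"
    unfolding marked_edges_def using B by (subst emeasure_distr) auto
  also have "\<dots> = emeasure (count_space UNIV) (?g -` B \<inter> ?S)"
    by (cases "finite (?g -` B \<inter> ?S)") (simp_all)
  also have "?g -` B \<inter> ?S =
      {(i, j). i \<in> I \<and> j \<in> I \<and> lex_less (z i) (z j) \<and> ({z i, z j}, u (i, j)) \<in> B}"
    by auto
  finally show ?thesis .
qed

text \<open>The ends of the edges from a bounded set of edges lie in one bounded set, so that the edges
  inherit local finiteness from the points.\<close>

lemma marked_edges_in_point_measures:
  fixes z :: "'i \<Rightarrow> real ^ 'd::{finite,linorder}"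
  assumes u: "\<And>p. u p \<in> {0..1}" and fin: "\<And>C. bounded C \<Longrightarrow> finite {i \<in> I. z i \<in> C}"
  shows "marked_edges z I u \<in> point_measures marked_edge_metric"
  unfolding point_measures_def
proof (intro CollectI conjI ballI impI)
  fix B :: "((real ^ 'd::{finite,linorder}) set \<times> real) set"
  assume B: "B \<in> sets (metric_borel marked_edge_metric)"
  let ?S = "{(i, j). i \<in> I \<and> j \<in> I \<and> lex_less (z i) (z j) \<and> ({z i, z j}, u (i, j)) \<in> B}"
  show "emeasure (marked_edges z I u) B \<in> range of_nat \<union> {\<infinity>}"
    unfolding emeasure_marked_edges[OF B u] by (cases "finite ?S") auto
  assume "Metric_space.mbounded (mspace marked_edge_metric) (mdist marked_edge_metric) B"
  then obtain C where C: "bounded C" "\<forall>(e, u)\<in>B. e \<subseteq> C"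
    using bounded_edges_in_bounded_set by blast
  have "?S \<subseteq> {i \<in> I. z i \<in> C} \<times> {i \<in> I. z i \<in> C}"
    using C(2) by fastforce
  then have "finite ?S"
    using fin[OF C(1)] by (meson finite_SigmaI finite_subset)
  then show "emeasure (marked_edges z I u) B < \<infinity>"
    unfolding emeasure_marked_edges[OF B u] by (simp add: of_nat_less_top)
qed simp

lemma marked_edges_cong:
  assumes "\<And>i. i \<in> I \<Longrightarrow> z i = z' i" "\<And>i j. i \<in> I \<Longrightarrow> j \<in> I \<Longrightarrow> u (i, j) = u' (i, j)"
  shows "marked_edges z I u = marked_edges z' I u'"
  unfolding marked_edges_def using assms
  by (intro distr_cong) (auto intro!: arg_cong[where f = count_space])

lemma marked_edges_reindex:
  assumes g: "inj_on g I" and u: "\<And>p. u p \<in> {0..1}"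
  shows "marked_edges z (g ` I) u = marked_edges (z \<circ> g) I (u \<circ> map_prod g g)"
proof (rule measure_eqI)
  fix B assume "B \<in> sets (marked_edges z (g ` I) u)"
  then have B: "B \<in> sets (metric_borel marked_edge_metric)" by simp
  let ?S = "{(i, j). i \<in> I \<and> j \<in> I \<and> lex_less ((z \<circ> g) i) ((z \<circ> g) j) \<and>
     ({(z \<circ> g) i, (z \<circ> g) j}, (u \<circ> map_prod g g) (i, j)) \<in> B}"
  have inj: "inj_on (map_prod g g) ?S"
    using g by (auto simp: inj_on_def)
  have "{(i, j). i \<in> g ` I \<and> j \<in> g ` I \<and> lex_less (z i) (z j) \<and> ({z i, z j}, u (i, j)) \<in> B} =
      map_prod g g ` ?S"
    by (auto simp: image_iff)
  then show "emeasure (marked_edges z (g ` I) u) B =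
      emeasure (marked_edges (z \<circ> g) I (u \<circ> map_prod g g)) B"
    using inj u finite_image_iff[OF inj] card_image[OF inj]
    by (simp add: emeasure_marked_edges[OF B] emeasure_count_space)
qed simp

text \<open>An edge lies inside \<open>W\<close> iff both of its ends do, so restricting the edges amounts to dropping the
  points outside of \<open>W\<close>.\<close>

lemma restrict_edges_marked_edges:
  fixes z :: "'i \<Rightarrow> real ^ 'd::{finite,linorder}"
  assumes W: "closed W" and u: "\<And>p. u p \<in> {0..1}"
  shows "restrict_edges W (marked_edges z I u) = marked_edges z {i \<in> I. z i \<in> W} u"
proof (rule measure_eqI)
  let ?M = "marked_edges z I u"
  let ?C = "{(e, u). e \<in> edges \<and> u \<in> {0..1} \<and> e \<subseteq> W} :: ((real ^ 'd::{finite,linorder}) set \<times> real) set"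
  have C: "?C \<in> sets (metric_borel marked_edge_metric)"
    by (rule edges_inside_closed_measurable[OF W])
  fix B assume "B \<in> sets (restrict_edges W ?M)"
  then have B: "B \<in> sets (metric_borel marked_edge_metric)"
    by (simp add: restrict_edges_def)
  have space: "space ?M = edges \<times> {0..1}"
    using sets_eq_imp_space_eq[OF sets_marked_edges] by (simp add: space_metric_borel)
  have "(indicator {(e, u). e \<subseteq> W} :: _ \<Rightarrow> ennreal) \<in> borel_measurable ?M \<longleftrightarrow>
      (indicator ?C :: _ \<Rightarrow> ennreal) \<in> borel_measurable ?M"
    by (rule measurable_cong) (auto simp: indicator_def space)
  then have ind: "(indicator {(e, u). e \<subseteq> W} :: _ \<Rightarrow> ennreal) \<in> borel_measurable ?M"
    using C by (simp add: borel_measurable_indicator)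
  have "emeasure (restrict_edges W ?M) B = (\<integral>\<^sup>+p. indicator {(e, u). e \<subseteq> W} p * indicator B p \<partial>?M)"
    unfolding restrict_edges_def using B ind by (intro emeasure_density) auto
  also have "\<dots> = (\<integral>\<^sup>+p. indicator (?C \<inter> B) p \<partial>?M)"
    by (intro nn_integral_cong) (auto simp: indicator_def space)
  also have "\<dots> = emeasure ?M (?C \<inter> B)"
    using C B by (intro nn_integral_indicator) auto
  also have "\<dots> = emeasure (marked_edges z {i \<in> I. z i \<in> W} u) B"
  proof -
    have "{(i, j). i \<in> I \<and> j \<in> I \<and> lex_less (z i) (z j) \<and> ({z i, z j}, u (i, j)) \<in> ?C \<inter> B} =
       {(i, j). i \<in> {i \<in> I. z i \<in> W} \<and> j \<in> {i \<in> I. z i \<in> W} \<and> lex_less (z i) (z j) \<and> ({z i, z j}, u (i, j)) \<in> B}"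
      using u by auto
    then show ?thesis
      by (simp only: emeasure_marked_edges[OF B u] emeasure_marked_edges[OF sets.Int[OF C B] u])
  qed
  finally show "emeasure (restrict_edges W ?M) B = emeasure (marked_edges z {i \<in> I. z i \<in> W} u) B" .
qed (simp add: restrict_edges_def)

lemma borel_measurable_countable_sum:
  fixes f :: "'i \<Rightarrow> 'a \<Rightarrow> ennreal"
  assumes I: "countable I" and f: "\<And>i. i \<in> I \<Longrightarrow> f i \<in> borel_measurable N"
  shows "(\<lambda>x. \<integral>\<^sup>+i. f i x \<partial>count_space I) \<in> borel_measurable N"
proof -
  interpret sigma_finite_measure "count_space I"
    by (rule sigma_finite_measure_count_space_countable[OF I])
  have "(\<lambda>p. f (fst p) (snd p)) \<in> borel_measurable (count_space I \<Otimes>\<^sub>M N)"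
    using f by (intro measurable_pair_measure_countable1[OF I]) auto
  from measurable_pair_swap[OF this]
  show ?thesis by (intro borel_measurable_nn_integral) (simp add: case_prod_unfold)
qed

lemma lex_less_measurable:
  "{p :: (real ^ 'd::{finite,linorder}) \<times> (real ^ 'd::{finite,linorder}). lex_less (fst p) (snd p)} \<in> sets borel"
proof -
  have [measurable]: "(\<lambda>p :: (real ^ 'd::{finite,linorder}) \<times> (real ^ 'd::{finite,linorder}). fst p $ i) \<in> borel_measurable borel"
      "(\<lambda>p :: (real ^ 'd::{finite,linorder}) \<times> (real ^ 'd::{finite,linorder}). snd p $ i) \<in> borel_measurable borel" for i
    by (intro borel_measurable_continuous_onI continuous_intros)+
  have "{p :: (real ^ 'd::{finite,linorder}) \<times> (real ^ 'd::{finite,linorder}). lex_less (fst p) (snd p)} =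
      {p \<in> space borel. \<exists>i\<in>UNIV. fst p $ i < snd p $ i \<and> (\<forall>j\<in>{..<i}. fst p $ j = snd p $ j)}"
    by (auto simp: lex_less_def)
  also have "\<dots> \<in> sets borel" by measurable
  finally show ?thesis .
qed

text \<open>The \<open>\<sigma>\<close>-algebra on the point measures is generated by the numbers of atoms in Borel sets, and such
  a number is a countable sum of indicators, one for each pair of indices.\<close>

lemma marked_edges_measurable:
  fixes Z :: "'i::countable \<Rightarrow> 'b \<Rightarrow> real ^ 'd::{finite,linorder}"
  assumes Z: "\<And>i. i \<in> I \<Longrightarrow> Z i \<in> borel_measurable N"
    and u: "\<And>p. u p \<in> borel_measurable N" "\<And>p \<omega>. \<omega> \<in> space N \<Longrightarrow> u p \<omega> \<in> {0..1}"
    and fin: "\<And>C \<omega>. bounded C \<Longrightarrow> \<omega> \<in> space N \<Longrightarrow> finite {i \<in> I. Z i \<omega> \<in> C}"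
  shows "(\<lambda>\<omega>. marked_edges (\<lambda>i. Z i \<omega>) I (\<lambda>p. u p \<omega>)) \<in> N \<rightarrow>\<^sub>M point_measure_space marked_edge_metric"
proof -
  let ?E = "\<lambda>\<omega>. marked_edges (\<lambda>i. Z i \<omega>) I (\<lambda>p. u p \<omega>)"
  have pm: "?E \<omega> \<in> point_measures marked_edge_metric" if "\<omega> \<in> space N" for \<omega>
    using u(2) fin that by (intro marked_edges_in_point_measures) auto
  have count: "(\<lambda>\<omega>. emeasure (?E \<omega>) B) \<in> borel_measurable N"
    if B: "B \<in> sets (metric_borel marked_edge_metric)" for B
  proof -
    let ?Q = "\<lambda>p \<omega>. lex_less (Z (fst p) \<omega>) (Z (snd p) \<omega>) \<and> ({Z (fst p) \<omega>, Z (snd p) \<omega>}, u p \<omega>) \<in> B"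
    have "emeasure (?E \<omega>) B = (\<integral>\<^sup>+p. indicator {\<omega> \<in> space N. ?Q p \<omega>} \<omega> \<partial>count_space (I \<times> I))"
      if \<omega>: "\<omega> \<in> space N" for \<omega>
    proof -
      have "emeasure (?E \<omega>) B = emeasure (count_space UNIV) {p \<in> I \<times> I. ?Q p \<omega>}"
        using u(2)[OF \<omega>] by (subst emeasure_marked_edges[OF B]) (auto intro!: arg_cong2[where f = emeasure])
      also have "\<dots> = emeasure (count_space (I \<times> I)) {p \<in> I \<times> I. ?Q p \<omega>}"
        by (cases "finite {p \<in> I \<times> I. ?Q p \<omega>}") simp_all
      also have "\<dots> = (\<integral>\<^sup>+p. indicator {p \<in> I \<times> I. ?Q p \<omega>} p \<partial>count_space (I \<times> I))"
        by (intro nn_integral_indicator[symmetric]) auto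
      also have "\<dots> = (\<integral>\<^sup>+p. indicator {\<omega> \<in> space N. ?Q p \<omega>} \<omega> \<partial>count_space (I \<times> I))"
        using \<omega> by (intro nn_integral_cong) (auto simp: indicator_def)
      finally show ?thesis .
    qed
    moreover have "{\<omega> \<in> space N. ?Q p \<omega>} \<in> sets N" if p: "p \<in> I \<times> I" for p
    proof -
      let ?D = "{(a :: real ^ 'd::{finite,linorder}, b :: real ^ 'd::{finite,linorder}, v :: real). a \<noteq> b \<and> v \<in> {0..1}}"
      let ?L = "{\<omega> \<in> space N. lex_less (Z (fst p) \<omega>) (Z (snd p) \<omega>)}"
      let ?t = "\<lambda>\<omega>. (Z (fst p) \<omega>, Z (snd p) \<omega>, u p \<omega>)"
      have [measurable]: "Z (fst p) \<in> borel_measurable N" "Z (snd p) \<in> borel_measurable N" "u p \<in> borel_measurable N"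
        using p Z u by auto
      have "(\<lambda>\<omega>. (Z (fst p) \<omega>, Z (snd p) \<omega>)) -` {q. lex_less (fst q) (snd q)} \<inter> space N \<in> sets N"
        by (rule measurable_sets[OF _ lex_less_measurable]) simp
      then have L: "?L \<in> sets N"
        by (simp add: vimage_def Int_def conj_commute)
      have "?t \<in> restrict_space N ?L \<rightarrow>\<^sub>M restrict_space borel ?D"
      proof (rule measurable_restrict_space2)
        show "?t \<in> space (restrict_space N ?L) \<rightarrow> ?D"
          using u(2)[of _ p] by (auto simp: space_restrict_space) 
        show "?t \<in> borel_measurable (restrict_space N ?L)"
          by (intro measurable_restrict_space1) measurable
      qed
      from measurable_compose[OF this marked_edge_measurable]
      have "(\<lambda>\<omega>. ({Z (fst p) \<omega>, Z (snd p) \<omega>}, u p \<omega>)) \<in> restrict_space N ?L \<rightarrow>\<^sub>M metric_borel marked_edge_metric"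
        by simp
      from measurable_sets[OF this B]
      have "(\<lambda>\<omega>. ({Z (fst p) \<omega>, Z (snd p) \<omega>}, u p \<omega>)) -` B \<inter> ?L \<in> sets (restrict_space N ?L)"
        by (simp add: space_restrict_space Int_absorb2 Collect_restrict)
      then have "(\<lambda>\<omega>. ({Z (fst p) \<omega>, Z (snd p) \<omega>}, u p \<omega>)) -` B \<inter> ?L \<in> sets N"
        using L by (subst (asm) sets_restrict_space_iff) auto
      then show ?thesis
        by (rule back_subst[of "\<lambda>S. S \<in> sets N"]) auto
    qed
    then have "(\<lambda>\<omega>. \<integral>\<^sup>+p. indicator {\<omega> \<in> space N. ?Q p \<omega>} \<omega> \<partial>count_space (I \<times> I)) \<in> borel_measurable N"
      by (intro borel_measurable_countable_sum) auto
    ultimately show ?thesis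
      by (subst measurable_cong) auto
  qed
  show ?thesis
    unfolding point_measure_space_def
  proof (rule measurable_measure_of)
    show "?E \<in> space N \<rightarrow> point_measures marked_edge_metric" using pm by auto
    fix Y assume "Y \<in> {{\<mu> \<in> point_measures marked_edge_metric. emeasure \<mu> B \<in> A} | (B :: ((real ^ 'd::{finite,linorder}) set \<times> real) set) A.
        B \<in> sets (metric_borel marked_edge_metric) \<and> A \<in> sets borel}"
    then obtain B A where Y: "Y = {\<mu> \<in> point_measures marked_edge_metric. emeasure \<mu> B \<in> A}"
        and BA: "B \<in> sets (metric_borel marked_edge_metric)" "A \<in> sets borel"
      by auto
    have "?E -` Y \<inter> space N = (\<lambda>\<omega>. emeasure (?E \<omega>) B) -` A \<inter> space N"
      using pm by (auto simp: Y)
    then show "?E -` Y \<inter> space N \<in> sets N"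
      using measurable_sets[OF count[OF BA(1)] BA(2)] by simp
  qed auto
qed

lemma edge_process_eq_marked_edges:
  "edge_process r X U y \<omega> =
    marked_edges (case_sum (\<lambda>k. the (y k)) (\<lambda>j. X j \<omega>))
      (Inl ` dom y \<union> (if r > 0 then range Inr else {})) (\<lambda>p. U p \<omega>)"
  by (simp add: edge_process_def marked_edges_def Let_def)

section \<open>Averaging over the marks\<close>

text \<open>The law of the marks is supported by functions all of whose values lie in the unit interval, as
  is required of the marks of a point measure for every outcome.\<close>

definition marks_law :: "('i \<times> 'i \<Rightarrow> real) measure"
  where "marks_law = (\<Pi>\<^sub>M p\<in>UNIV. restrict_space lborel {0..1})"

lemma prob_space_uniform_unit: "prob_space (restrict_space lborel {0..1::real})"
  by (rule prob_spaceI) (simp add: emeasure_restrict_space)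

lemma space_marks_law: "u \<in> space marks_law \<longleftrightarrow> (\<forall>p. u p \<in> {0..1})"
  by (auto simp: marks_law_def space_PiM PiE_iff)

lemma prob_space_marks_law: "prob_space marks_law"
  unfolding marks_law_def by (intro prob_space_PiM prob_space_uniform_unit)

lemma marks_law_component [measurable]: "(\<lambda>u. u p) \<in> borel_measurable marks_law"
proof -
  have "(\<lambda>u. u p) \<in> marks_law \<rightarrow>\<^sub>M restrict_space lborel {0..1::real}"
    unfolding marks_law_def by measurable
  then show ?thesis by (simp add: measurable_restrict_space2_iff)
qed

definition mean_over_marks ::
  "(((real ^ 'd::{finite,linorder}) set \<times> real) measure \<Rightarrow> ennreal) \<Rightarrow> ('i \<Rightarrow> real ^ 'd::{finite,linorder}) \<Rightarrow> 'i set \<Rightarrow> ennreal"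
  where "mean_over_marks \<phi> z I = (\<integral>\<^sup>+u. \<phi> (marked_edges z I u) \<partial>marks_law)"

lemma functional_of_marked_edges_measurable:
  fixes Z :: "'i::countable \<Rightarrow> 'b \<Rightarrow> real ^ 'd::{finite,linorder}"
  assumes \<phi>: "\<phi> \<in> point_measure_space marked_edge_metric \<rightarrow>\<^sub>M K"
    and Z: "\<And>i. i \<in> I \<Longrightarrow> Z i \<in> borel_measurable N"
    and fin: "\<And>C \<omega>. bounded C \<Longrightarrow> \<omega> \<in> space N \<Longrightarrow> finite {i \<in> I. Z i \<omega> \<in> C}"
  shows "(\<lambda>(\<omega>, u). \<phi> (marked_edges (\<lambda>i. Z i \<omega>) I u)) \<in> N \<Otimes>\<^sub>M marks_law \<rightarrow>\<^sub>M K"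
proof -
  have "(\<lambda>q. marked_edges (\<lambda>i. Z i (fst q)) I (\<lambda>p. snd q p))
      \<in> N \<Otimes>\<^sub>M marks_law \<rightarrow>\<^sub>M point_measure_space marked_edge_metric"
  proof (rule marked_edges_measurable)
    show "(\<lambda>q. Z i (fst q)) \<in> borel_measurable (N \<Otimes>\<^sub>M marks_law)" if "i \<in> I" for i
      using Z[OF that] by measurable
    show "(\<lambda>q. snd q p) \<in> borel_measurable (N \<Otimes>\<^sub>M marks_law)" for p
      by measurable
    show "snd q p \<in> {0..1}" if "q \<in> space (N \<Otimes>\<^sub>M marks_law)" for q p
      using that space_marks_law[of "snd q"] by (simp only: space_pair_measure mem_Times_iff)
    show "finite {i \<in> I. Z i (fst q) \<in> C}" if "bounded C" "q \<in> space (N \<Otimes>\<^sub>M marks_law)" for C q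
      using that fin by (simp add: space_pair_measure mem_Times_iff)
  qed
  from measurable_compose[OF this \<phi>] show ?thesis
    by (simp add: case_prod_unfold)
qed

lemma mean_over_marks_measurable:
  fixes Z :: "'i::countable \<Rightarrow> 'b \<Rightarrow> real ^ 'd::{finite,linorder}"
  assumes \<phi>: "\<phi> \<in> borel_measurable (point_measure_space marked_edge_metric)"
    and Z: "\<And>i. i \<in> I \<Longrightarrow> Z i \<in> borel_measurable N" and I: "finite I"
  shows "(\<lambda>\<omega>. mean_over_marks \<phi> (\<lambda>i. Z i \<omega>) I) \<in> borel_measurable N"
proof -
  interpret marks: prob_space "marks_law :: ('i \<times> 'i \<Rightarrow> real) measure"
    by (rule prob_space_marks_law)
  show ?thesis
    unfolding mean_over_marks_def
    using functional_of_marked_edges_measurable[OF \<phi>, of I Z N] Z I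
    by (intro marks.borel_measurable_nn_integral) simp
qed

text \<open>If \<open>h\<close> only looks at the marks of the pairs from \<open>I\<close>, its integral is determined by the law of
  the marks of these pairs, which are independent and uniform. Pulling all marks back along an
  injection yields such marks again.\<close>

lemma nn_integral_marks_law_reindex:
  fixes I :: "'i set" and g :: "'i \<Rightarrow> 'j"
  assumes g: "inj_on g I"
    and h: "(\<lambda>u. h u) \<in> borel_measurable (marks_law :: ('i \<times> 'i \<Rightarrow> real) measure)"
    and dep: "\<And>u v. (\<And>i j. i \<in> I \<Longrightarrow> j \<in> I \<Longrightarrow> u (i, j) = v (i, j)) \<Longrightarrow> h u = h v"
  shows "(\<integral>\<^sup>+u. h (u \<circ> map_prod g g) \<partial>(marks_law :: ('j \<times> 'j \<Rightarrow> real) measure)) =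
    (\<integral>\<^sup>+u. h u \<partial>marks_law)"
proof -
  let ?U = "\<lambda>_. restrict_space lborel {0..1::real}"
  define h' where "h' v = h (\<lambda>p. if p \<in> I \<times> I then v p else 0)" for v
  have "(\<lambda>v p. if p \<in> I \<times> I then v p else 0) \<in> (\<Pi>\<^sub>M p\<in>I \<times> I. ?U p) \<rightarrow>\<^sub>M (marks_law :: ('i \<times> 'i \<Rightarrow> real) measure)"
    unfolding marks_law_def
  proof (rule measurable_PiM_single')
    fix p :: "'i \<times> 'i"
    show "(\<lambda>v. if p \<in> I \<times> I then v p else 0) \<in> (\<Pi>\<^sub>M p\<in>I \<times> I. ?U p) \<rightarrow>\<^sub>M restrict_space lborel {0..1::real}"
      by (cases "p \<in> I \<times> I") (auto intro!: measurable_component_singleton simp: space_restrict_space)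
  qed (auto simp: space_PiM space_restrict_space PiE_iff split: if_splits)
  then have h'_meas: "h' \<in> borel_measurable (\<Pi>\<^sub>M p\<in>I \<times> I. ?U p)"
    unfolding h'_def using h by (rule measurable_compose)
  have *: "(\<integral>\<^sup>+u. h (u \<circ> map_prod f f) \<partial>(marks_law :: ('k \<times> 'k \<Rightarrow> real) measure)) =
      (\<integral>\<^sup>+v. h' v \<partial>(\<Pi>\<^sub>M p\<in>I \<times> I. ?U p))"
    if f: "inj_on f I" for f :: "'i \<Rightarrow> 'k"
  proof -
    let ?M = "marks_law :: ('k \<times> 'k \<Rightarrow> real) measure"
    let ?r = "\<lambda>(u :: 'k \<times> 'k \<Rightarrow> real). \<lambda>p\<in>I \<times> I. u (map_prod f f p)"
    have "(\<Pi>\<^sub>M p\<in>I \<times> I. ?U p) = distr ?M (\<Pi>\<^sub>M p\<in>I \<times> I. ?U p) ?r"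
      unfolding marks_law_def using f
      by (intro distr_PiM_reindex[symmetric] prob_space_uniform_unit map_prod_inj_on) auto
    then have "(\<integral>\<^sup>+v. h' v \<partial>(\<Pi>\<^sub>M p\<in>I \<times> I. ?U p)) = (\<integral>\<^sup>+v. h' v \<partial>distr ?M (\<Pi>\<^sub>M p\<in>I \<times> I. ?U p) ?r)"
      by simp
    also have "\<dots> = (\<integral>\<^sup>+u. h' (?r u) \<partial>?M)"
    proof (rule nn_integral_distr)
      show "?r \<in> ?M \<rightarrow>\<^sub>M (\<Pi>\<^sub>M p\<in>I \<times> I. ?U p)"
        unfolding marks_law_def by (intro measurable_restrict measurable_component_singleton) auto
    qed (use h'_meas in simp)
    also have "\<dots> = (\<integral>\<^sup>+u. h (u \<circ> map_prod f f) \<partial>?M)"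
      unfolding h'_def by (intro nn_integral_cong dep) simp
    finally show ?thesis by simp
  qed
  have "(\<integral>\<^sup>+u. h (u \<circ> map_prod id id) \<partial>(marks_law :: ('i \<times> 'i \<Rightarrow> real) measure)) =
      (\<integral>\<^sup>+v. h' v \<partial>(\<Pi>\<^sub>M p\<in>I \<times> I. ?U p))"
    by (rule *) simp
  then show ?thesis
    using *[OF g] by (simp add: prod.map_id0)
qed

text \<open>Since the marks are identically distributed and independent, only the points matter for the
  mean, not the names of their indices.\<close>

lemma mean_over_marks_reindex:
  fixes g :: "'i::countable \<Rightarrow> 'j::countable"
  assumes g: "inj_on g I" and I: "finite I"
    and \<phi>: "\<phi> \<in> borel_measurable (point_measure_space marked_edge_metric)"
  shows "mean_over_marks \<phi> z (g ` I) = mean_over_marks \<phi> (z \<circ> g) I"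
proof -
  have "(\<lambda>(\<omega>, u). \<phi> (marked_edges (\<lambda>i. (z \<circ> g) i) I u)) \<in> borel_measurable (count_space {()} \<Otimes>\<^sub>M marks_law)"
    using I by (intro functional_of_marked_edges_measurable[OF \<phi>]) auto
  from measurable_Pair2[OF this, of "()"]
  have "(\<lambda>u. \<phi> (marked_edges (z \<circ> g) I u)) \<in> borel_measurable marks_law"
    by (simp add: comp_def)
  then have "(\<integral>\<^sup>+u. \<phi> (marked_edges (z \<circ> g) I (u \<circ> map_prod g g)) \<partial>marks_law) = mean_over_marks \<phi> (z \<circ> g) I"
    unfolding mean_over_marks_def
    by (intro nn_integral_marks_law_reindex[OF g] arg_cong[where f = \<phi>] marked_edges_cong) auto
  moreover have "mean_over_marks \<phi> z (g ` I) = (\<integral>\<^sup>+u. \<phi> (marked_edges (z \<circ> g) I (u \<circ> map_prod g g)) \<partial>marks_law)"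
    unfolding mean_over_marks_def
    using marked_edges_reindex[OF g] space_marks_law
    by (intro nn_integral_cong arg_cong[where f = \<phi>]) blast
  ultimately show ?thesis by simp
qed

lemma mean_over_marks_cong:
  assumes "\<And>i. i \<in> I \<Longrightarrow> z i = z' i"
  shows "mean_over_marks \<phi> z I = mean_over_marks \<phi> z' I"
  unfolding mean_over_marks_def using assms
  by (intro nn_integral_cong arg_cong[where f = \<phi>] marked_edges_cong) auto

text \<open>Clipping leaves marks from the unit interval unchanged. It converts the independence of the marks
  as real random variables into statements about random elements of the unit interval.\<close>

lemma clip_measurable: "(\<lambda>v. max 0 (min 1 v)) \<in> borel \<rightarrow>\<^sub>M restrict_space lborel {0..1::real}"
  by (rule measurable_restrict_space2) auto

lemma clip_marks_measurable:
  "(\<lambda>u p. max 0 (min 1 (u p))) \<in> (\<Pi>\<^sub>M p\<in>UNIV. borel) \<rightarrow>\<^sub>M marks_law"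
  unfolding marks_law_def
  by (rule measurable_PiM_single')
     (auto intro!: measurable_compose[OF _ clip_measurable] measurable_component_singleton simp: space_restrict_space)

lemma distr_marks:
  assumes M: "prob_space M" and U: "marked_poisson M r X U"
  shows "(\<lambda>\<omega> p. U p \<omega>) \<in> M \<rightarrow>\<^sub>M marks_law" "distr M marks_law (\<lambda>\<omega> p. U p \<omega>) = marks_law"
proof -
  interpret prob_space M by (rule M)
  let ?u = "restrict_space lborel {0..1::real}" and ?c = "\<lambda>v::real. max 0 (min 1 v)"
  have Um: "U p \<in> borel_measurable M" "distr M borel (U p) = uniform_measure lborel {0..1}"
      and U01: "\<omega> \<in> space M \<Longrightarrow> U p \<omega> \<in> {0..1}" for p \<omega>
    using U unfolding marked_poisson_def by blast+
  have indep: "indep_vars (\<lambda>_. borel) U UNIV"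
    using U by (simp add: marked_poisson_def)
  have c: "?c (U p \<omega>) = U p \<omega>" if "\<omega> \<in> space M" for p \<omega>
    using U01[OF that, of p] by simp
  have rv: "U p \<in> M \<rightarrow>\<^sub>M ?u" for p
    using U01 Um by (intro measurable_restrict_space2) auto
  have law: "distr M ?u (U p) = ?u" for p
  proof (rule measure_eqI)
    fix A assume "A \<in> sets (distr M ?u (U p))"
    then have A: "A \<in> sets ?u" by simp
    then have A': "A \<in> sets borel" "A \<subseteq> {0..1}"
      by (auto simp: sets_restrict_space_iff)
    have "emeasure (distr M ?u (U p)) A = emeasure (distr M borel (U p)) A"
      using A A' emeasure_distr[OF rv A] emeasure_distr[OF Um(1) A'(1)] by simp
    also have "\<dots> = emeasure ?u A"
      using A' by (simp add: Um emeasure_restrict_space Int_absorb1 divide_ennreal_def)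
    finally show "emeasure (distr M ?u (U p)) A = emeasure ?u A" .
  qed simp
  have "indep_vars (\<lambda>_. ?u) (\<lambda>p \<omega>. ?c (U p \<omega>)) UNIV"
    by (rule indep_vars_compose2[OF indep clip_measurable])
  then have "distr M (\<Pi>\<^sub>M p\<in>UNIV. ?u) (\<lambda>\<omega>. \<lambda>p\<in>UNIV. ?c (U p \<omega>)) = (\<Pi>\<^sub>M p\<in>UNIV. distr M ?u (\<lambda>\<omega>. ?c (U p \<omega>)))"
    by (rule iffD1[OF indep_vars_iff_distr_eq_PiM', rotated -1])
       (auto intro!: measurable_compose[OF Um(1) clip_measurable])
  also have "(\<lambda>p. distr M ?u (\<lambda>\<omega>. ?c (U p \<omega>))) = (\<lambda>p. distr M ?u (U p))"
    using c by (intro ext distr_cong) auto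
  also have "distr M (\<Pi>\<^sub>M p\<in>UNIV. ?u) (\<lambda>\<omega>. \<lambda>p\<in>UNIV. ?c (U p \<omega>)) = distr M (\<Pi>\<^sub>M p\<in>UNIV. ?u) (\<lambda>\<omega> p. U p \<omega>)"
    using c by (intro distr_cong) auto
  finally show "distr M marks_law (\<lambda>\<omega> p. U p \<omega>) = marks_law"
    by (simp only: marks_law_def law)
  show "(\<lambda>\<omega> p. U p \<omega>) \<in> M \<rightarrow>\<^sub>M marks_law"
    unfolding marks_law_def using rv by (intro measurable_PiM_single') (auto simp: space_restrict_space PiE_iff dest: U01)
qed

text \<open>The points and the marks are independent, so their joint law is a product measure and the marks
  can be integrated out with the points held fixed.\<close>

lemma nn_integral_points_marks:
  fixes X :: "nat \<Rightarrow> 'w \<Rightarrow> 'a::euclidean_space"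
  assumes M: "prob_space M" and XU: "marked_poisson M r X U" and r: "r > 0"
    and h: "h \<in> borel_measurable ((\<Pi>\<^sub>M j\<in>UNIV. borel) \<Otimes>\<^sub>M marks_law)"
  shows "(\<integral>\<^sup>+\<omega>. h (\<lambda>j. X j \<omega>, \<lambda>p. U p \<omega>) \<partial>M) = (\<integral>\<^sup>+\<omega>. \<integral>\<^sup>+u. h (\<lambda>j. X j \<omega>, u) \<partial>marks_law \<partial>M)"
proof -
  interpret prob_space M by (rule M)
  interpret marks: prob_space "marks_law :: (point_index \<times> point_index \<Rightarrow> real) measure"
    by (rule prob_space_marks_law)
  let ?PX = "\<Pi>\<^sub>M j\<in>(UNIV :: nat set). (borel :: 'a measure)"
    and ?PU = "\<Pi>\<^sub>M p\<in>(UNIV :: (point_index \<times> point_index) set). (borel :: real measure)"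
  let ?X = "\<lambda>\<omega> j. X j \<omega>" and ?U = "\<lambda>\<omega> p. U p \<omega>" and ?c = "\<lambda>u p. max 0 (min 1 (u p :: real))"
  have Xm: "?X \<in> M \<rightarrow>\<^sub>M ?PX"
    using XU r by (intro measurable_PiM_single') (auto simp: marked_poisson_def poisson_points_def)
  note Um = distr_marks(1)[OF M XU]
  interpret PX: prob_space "distr M ?PX ?X" by (rule prob_space_distr[OF Xm])
  have U01: "\<forall>p. U p \<omega> \<in> {0..1}" if "\<omega> \<in> space M" for \<omega>
    using XU that unfolding marked_poisson_def by blast
  have cU: "?c (?U \<omega>) = ?U \<omega>" if "\<omega> \<in> space M" for \<omega>
  proof
    fix p
    show "?c (?U \<omega>) p = ?U \<omega> p" using spec[OF U01[OF that], of p] by simp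
  qed
  have indep: "indep_set {?X -` A \<inter> space M | A. A \<in> sets ?PX} {?U -` A \<inter> space M | A. A \<in> sets ?PU}"
    using XU r by (simp add: marked_poisson_def)
  have joint: "distr M ?PX ?X \<Otimes>\<^sub>M marks_law = distr M (?PX \<Otimes>\<^sub>M marks_law) (\<lambda>\<omega>. (?X \<omega>, ?U \<omega>))"
  proof (rule pair_measure_eqI)
    fix A B assume "A \<in> sets (distr M ?PX ?X)"
      and B: "B \<in> sets (marks_law :: (point_index \<times> point_index \<Rightarrow> real) measure)"
    then have A: "A \<in> sets ?PX" by simp
    have "?U -` B \<inter> space M = ?U -` (?c -` B \<inter> space ?PU) \<inter> space M"
      using cU by (auto simp: space_PiM)
    moreover have "?c -` B \<inter> space ?PU \<in> sets ?PU"
      by (rule measurable_sets[OF clip_marks_measurable B])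
    ultimately have "?U -` B \<inter> space M \<in> {?U -` A \<inter> space M | A. A \<in> sets ?PU}" by blast
    then have "prob ((?X -` A \<inter> space M) \<inter> (?U -` B \<inter> space M)) = prob (?X -` A \<inter> space M) * prob (?U -` B \<inter> space M)"
      using A by (intro indep_setD[OF indep]) auto
    then have "emeasure M ((?X -` A \<inter> space M) \<inter> (?U -` B \<inter> space M)) =
        emeasure M (?X -` A \<inter> space M) * emeasure M (?U -` B \<inter> space M)"
      by (simp add: emeasure_eq_measure ennreal_mult)
    moreover have "emeasure M (?U -` B \<inter> space M) = emeasure marks_law B"
      using emeasure_distr[OF Um B] distr_marks(2)[OF M XU] by simp
    moreover have "emeasure (distr M (?PX \<Otimes>\<^sub>M marks_law) (\<lambda>\<omega>. (?X \<omega>, ?U \<omega>))) (A \<times> B)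
        = emeasure M ((?X -` A \<inter> space M) \<inter> (?U -` B \<inter> space M))"
      using A B Xm Um by (subst emeasure_distr) (auto intro!: arg_cong2[where f = emeasure])
    ultimately show "emeasure (distr M ?PX ?X) A * emeasure marks_law B
        = emeasure (distr M (?PX \<Otimes>\<^sub>M marks_law) (\<lambda>\<omega>. (?X \<omega>, ?U \<omega>))) (A \<times> B)"
      using emeasure_distr[OF Xm A] by simp
  qed (auto simp: PX.sigma_finite_measure_axioms marks.sigma_finite_measure_axioms intro!: sets_pair_measure_cong)
  have "(\<integral>\<^sup>+\<omega>. h (?X \<omega>, ?U \<omega>) \<partial>M) = (\<integral>\<^sup>+q. h q \<partial>distr M (?PX \<Otimes>\<^sub>M marks_law) (\<lambda>\<omega>. (?X \<omega>, ?U \<omega>)))"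
    using h Xm Um by (subst nn_integral_distr) auto
  also have "\<dots> = (\<integral>\<^sup>+q. h q \<partial>(distr M ?PX ?X \<Otimes>\<^sub>M marks_law))"
    by (simp only: joint)
  also have "\<dots> = (\<integral>\<^sup>+\<xi>. \<integral>\<^sup>+u. h (\<xi>, u) \<partial>marks_law \<partial>distr M ?PX ?X)"
    using h by (intro marks.nn_integral_fst[symmetric]) (simp cong: measurable_cong_sets)
  also have "\<dots> = (\<integral>\<^sup>+\<omega>. \<integral>\<^sup>+u. h (?X \<omega>, u) \<partial>marks_law \<partial>M)"
    using h Xm by (intro nn_integral_distr) (auto intro!: marks.borel_measurable_nn_integral)
  finally show ?thesis .
qed

section \<open>Measures on tuples of points in a window\<close>

definition window_measure :: "'a::euclidean_space set \<Rightarrow> 'a measure"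
  where "window_measure W = density lborel (indicator W)"

lemma sets_window_measure [simp, measurable_cong]: "sets (window_measure W) = sets borel"
  and space_window_measure [simp]: "space (window_measure W) = UNIV"
  by (simp_all add: window_measure_def)

lemma emeasure_window_measure:
  assumes "W \<in> sets borel" "A \<in> sets borel"
  shows "emeasure (window_measure W) A = emeasure lborel (W \<inter> A)"
proof -
  have "emeasure (window_measure W) A = (\<integral>\<^sup>+x. indicator W x * indicator A x \<partial>lborel)"
    unfolding window_measure_def using assms by (intro emeasure_density) auto
  also have "\<dots> = (\<integral>\<^sup>+x. indicator (W \<inter> A) x \<partial>lborel)"
    by (intro nn_integral_cong) (auto simp: indicator_def)
  finally show ?thesis using assms by simp
qed

lemma emeasure_lborel_bounded_finite:
  fixes W :: "'a::euclidean_space set"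
  assumes "bounded W"
  shows "emeasure lborel W < \<infinity>"
proof -
  obtain a b where ab: "W \<subseteq> cbox a b"
    using bounded_subset_cbox_symmetric[OF assms] by blast
  have "emeasure lborel W \<le> emeasure lborel (cbox a b)"
    by (rule emeasure_mono[OF ab]) simp
  also have "\<dots> < \<infinity>"
    using emeasure_lborel_cbox_finite[of a b] by simp
  finally show ?thesis .
qed

lemma finite_measure_window_measure:
  fixes W :: "'a::euclidean_space set"
  assumes "bounded W" "W \<in> sets borel"
  shows "finite_measure (window_measure W)"
  using emeasure_lborel_bounded_finite[OF assms(1)] assms(2)
  by (intro finite_measureI) (simp add: emeasure_window_measure)

lemma product_sigma_finite_window_measure:
  fixes W :: "'a::euclidean_space set"
  assumes "bounded W" "W \<in> sets borel"
  shows "product_sigma_finite (\<lambda>_. window_measure W)"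
proof -
  interpret finite_measure "window_measure W" by (rule finite_measure_window_measure[OF assms])
  show ?thesis by (simp add: product_sigma_finite_def sigma_finite_measure_axioms)
qed

lemma sets_PiM_window_measure:
  "sets (\<Pi>\<^sub>M i\<in>K. window_measure W) = sets (\<Pi>\<^sub>M i\<in>K. (borel :: 'a::euclidean_space measure))"
  by (intro sets_PiM_cong) simp_all

lemma inj_on_sets_PiM:
  assumes K: "finite K"
  shows "{x \<in> space (\<Pi>\<^sub>M i\<in>K. (borel :: 'a::euclidean_space measure)). inj_on x K} \<in> sets (\<Pi>\<^sub>M i\<in>K. borel)"
proof -
  let ?P = "\<Pi>\<^sub>M i\<in>K. (borel :: 'a measure)"
  have "{x \<in> space ?P. inj_on x K} = space ?P - (\<Union>(i, j)\<in>{(i, j). i \<in> K \<and> j \<in> K \<and> i \<noteq> j}. {x \<in> space ?P. x i = x j})"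
    by (auto simp: inj_on_def)
  also have "\<dots> \<in> sets ?P"
  proof (intro sets.Diff sets.top sets.finite_UN)
    show "finite {(i, j). i \<in> K \<and> j \<in> K \<and> i \<noteq> j}"
      by (rule finite_subset[of _ "K \<times> K"]) (use K in auto)
  qed (auto intro!: measurable_equality_set)
  finally show ?thesis .
qed

text \<open>Coinciding coordinates form a null set because a single point has Lebesgue measure \<open>0\<close>.\<close>

lemma AE_inj_on_PiM_window_measure:
  fixes W :: "'a::euclidean_space set"
  assumes W: "bounded W" "W \<in> sets borel" and K: "finite K"
  shows "AE x in (\<Pi>\<^sub>M i\<in>K. window_measure W). inj_on x K"
proof -
  interpret product_sigma_finite "\<lambda>_. window_measure W"
    by (rule product_sigma_finite_window_measure[OF W])
  let ?P = "\<lambda>K. \<Pi>\<^sub>M i\<in>K. window_measure W"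
  have "AE x in ?P K. x i \<noteq> x j" if ij: "i \<in> K" "j \<in> K" "i \<noteq> j" for i j
  proof -
    have K_eq: "insert i (K - {i}) = K" using ij by auto
    let ?f = "\<lambda>x. indicator {x. x i = x j} x :: ennreal"
    have [measurable]: "{x \<in> space (?P K). x i = x j} \<in> sets (?P K)"
    proof (intro measurable_equality_set)
      have "?P K \<rightarrow>\<^sub>M window_measure W = borel_measurable (?P K)"
        by (intro measurable_cong_sets) simp_all
      then show "(\<lambda>x. x i) \<in> borel_measurable (?P K)" "(\<lambda>x. x j) \<in> borel_measurable (?P K)"
        using measurable_component_singleton[of i K "\<lambda>_. window_measure W"]
          measurable_component_singleton[of j K "\<lambda>_. window_measure W"] ij by auto
    qed
    have f: "?f \<in> borel_measurable (?P K)"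
      by (rule iffD1[OF measurable_cong, of _ "indicator {x \<in> space (?P K). x i = x j}"])
         (auto simp: indicator_def)
    have "(\<integral>\<^sup>+x. ?f x \<partial>?P K) = (\<integral>\<^sup>+x. (\<integral>\<^sup>+y. ?f (x(i := y)) \<partial>window_measure W) \<partial>?P (K - {i}))"
      using product_nn_integral_insert[of "K - {i}" i ?f, unfolded K_eq] K f by simp
    also have "\<dots> = (\<integral>\<^sup>+x. (\<integral>\<^sup>+y. indicator {x j} y \<partial>window_measure W) \<partial>?P (K - {i}))"
      using ij by (intro nn_integral_cong) (auto simp: indicator_def)
    also have "\<dots> = 0"
    proof -
      have "emeasure (window_measure W) {y} = 0" for y
        using emeasure_mono[of "W \<inter> {y}" "{y}" lborel] W by (simp add: emeasure_window_measure)
      then show ?thesis by simp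
    qed
    finally have "AE x in ?P K. ?f x = 0"
      using f by (simp add: nn_integral_0_iff_AE)
    then show ?thesis by (rule AE_mp) (auto simp: indicator_def)
  qed
  then have "AE x in ?P K. \<forall>i\<in>K. \<forall>j\<in>K. i \<noteq> j \<longrightarrow> x i \<noteq> x j"
    using K by (intro AE_finite_allI) auto
  then show ?thesis by (rule AE_mp) (auto simp: inj_on_def)
qed

text \<open>Two balls are disjoint when each radius is at most half the distance of the centres, and every
  ball contains a basic neighbourhood of its centre.\<close>

lemma disjoint_basis_neighbourhoods:
  fixes x :: "'k \<Rightarrow> 'a::metric_space"
  assumes K: "finite K" and x: "inj_on x K" and B: "topological_basis B"
  shows "\<exists>b \<in> K \<rightarrow>\<^sub>E B. disjoint_family_on b K \<and> (\<forall>i\<in>K. x i \<in> b i)"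
proof -
  have "\<exists>d>0. \<forall>y\<in>x ` K. y \<noteq> x i \<longrightarrow> d \<le> dist (x i) y" for i
    using K by (intro finite_set_avoid) simp
  then obtain d where d: "\<And>i. d i > 0" "\<And>i j. j \<in> K \<Longrightarrow> x j \<noteq> x i \<Longrightarrow> d i \<le> dist (x i) (x j)"
    by (metis imageI)
  have "\<exists>b'\<in>B. x i \<in> b' \<and> b' \<subseteq> ball (x i) (d i / 2)" for i
    using topological_basisE[OF B, of "ball (x i) (d i / 2)" "x i"] d(1)[of i]
    by (metis centre_in_ball half_gt_zero open_ball)
  then obtain b where b: "\<And>i. b i \<in> B" "\<And>i. x i \<in> b i" "\<And>i. b i \<subseteq> ball (x i) (d i / 2)"
    by metis
  have "b i \<inter> b j = {}" if ij: "i \<in> K" "j \<in> K" "i \<noteq> j" for i j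
  proof (rule ccontr)
    assume "b i \<inter> b j \<noteq> {}"
    then obtain y where "y \<in> b i" "y \<in> b j" by blast
    then have "dist (x i) y < d i / 2" "dist (x j) y < d j / 2"
      using b(3)[of i] b(3)[of j] by auto
    then have "dist (x i) (x j) < d i / 2 + d j / 2"
      using dist_triangle2[of "x i" "x j" y] by linarith
    moreover have "x i \<noteq> x j" using x ij by (auto simp: inj_on_def)
    ultimately show False
      using d(2)[of j i] d(2)[of i j] ij by (auto simp: dist_commute)
  qed
  then show ?thesis
    using b by (intro bexI[of _ "restrict b K"]) (auto simp: disjoint_family_on_def)
qed

text \<open>Measures that do not charge tuples with repeated entries are determined by the boxes with pairwise
  disjoint sides: countably many such boxes cover the remaining tuples, and intersecting one of them
  with an arbitrary box yields a box of this kind again. Restricting to these boxes matters for a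
  Poisson process, because it is the numbers of points in disjoint sets that are independent.\<close>

lemma measure_eqI_disjoint_boxes:
  fixes \<mu> \<nu> :: "('k \<Rightarrow> 'a::euclidean_space) measure"
  assumes K: "finite K"
    and sets [simp]: "sets \<mu> = sets (\<Pi>\<^sub>M i\<in>K. borel)" "sets \<nu> = sets (\<Pi>\<^sub>M i\<in>K. borel)"
    and inj: "AE x in \<mu>. inj_on x K" "AE x in \<nu>. inj_on x K"
    and eq: "\<And>B. (\<And>i. i \<in> K \<Longrightarrow> B i \<in> sets borel) \<Longrightarrow> disjoint_family_on B K \<Longrightarrow>
        emeasure \<mu> (Pi\<^sub>E K B) = emeasure \<nu> (Pi\<^sub>E K B)"
    and fin: "\<And>B. (\<And>i. i \<in> K \<Longrightarrow> B i \<in> sets borel) \<Longrightarrow> disjoint_family_on B K \<Longrightarrow>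
        emeasure \<mu> (Pi\<^sub>E K B) < \<infinity>"
  shows "\<mu> = \<nu>"
proof (rule measure_eqI)
  let ?P = "\<Pi>\<^sub>M i\<in>K. (borel :: 'a measure)"
  have space: "space \<mu> = extensional K" "space \<nu> = extensional K"
    using sets_eq_imp_space_eq[OF sets(1)] sets_eq_imp_space_eq[OF sets(2)] by (simp_all add: space_PiM PiE_UNIV_domain)
       (auto simp: PiE_def)
  obtain \<B> :: "'a set set" where \<B>: "countable \<B>" "topological_basis \<B>"
    using ex_countable_basis by blast
  define C where "C = insert {} ((\<lambda>b. Pi\<^sub>E K b) ` {b \<in> K \<rightarrow>\<^sub>E \<B>. disjoint_family_on b K})"
  have "countable (K \<rightarrow>\<^sub>E \<B>)" using K \<B> by (intro countable_PiE) auto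
  then have "countable {b \<in> K \<rightarrow>\<^sub>E \<B>. disjoint_family_on b K}"
    by (rule countable_subset[rotated]) auto
  then have C: "countable C" "C \<noteq> {}" by (auto simp: C_def)
  have \<B>_borel: "b i \<in> sets borel" if "b \<in> K \<rightarrow>\<^sub>E \<B>" "i \<in> K" for b i
    using that topological_basis_open[OF \<B>(2)] by (auto intro!: borel_open)
  have box: "Pi\<^sub>E K B \<in> sets ?P" if "\<And>i. i \<in> K \<Longrightarrow> B i \<in> sets borel" for B
    using K that by (intro sets_PiM_I_finite) auto
  have C_sets: "c \<in> sets ?P" if "c \<in> C" for c
    using that box \<B>_borel by (auto simp: C_def)
  \<comment> \<open>Inside a box with disjoint sides all boxes are available, and these determine a measure.\<close>
  have on_box: "emeasure \<mu> (E \<inter> c) = emeasure \<nu> (E \<inter> c)" if c: "c \<in> C" and E: "E \<in> sets ?P" for c E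
  proof (cases "c = {}")
    case False
    then obtain b where b: "b \<in> K \<rightarrow>\<^sub>E \<B>" "disjoint_family_on b K" "c = Pi\<^sub>E K b"
      using c by (auto simp: C_def)
    have bs: "\<And>i. i \<in> K \<Longrightarrow> b i \<in> sets borel" using \<B>_borel b by blast
    have cs: "c \<in> sets ?P" by (rule C_sets[OF c])
    have restr: "emeasure (density m (indicator c)) A = emeasure m (A \<inter> c)"
      if "sets m = sets ?P" "A \<in> sets ?P" for m :: "('k \<Rightarrow> 'a) measure" and A
    proof -
      have "emeasure (density m (indicator c)) A = (\<integral>\<^sup>+x. indicator c x * indicator A x \<partial>m)"
        using that cs by (intro emeasure_density) auto
      also have "\<dots> = (\<integral>\<^sup>+x. indicator (A \<inter> c) x \<partial>m)"
        by (intro nn_integral_cong) (auto simp: indicator_def)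
      finally show ?thesis using that cs by simp
    qed
    have "density \<mu> (indicator c) = density \<nu> (indicator c)"
    proof (rule measure_eqI_PiM_finite[where A = "\<lambda>_. Pi\<^sub>E K (\<lambda>_. UNIV)"])
      fix A :: "'k \<Rightarrow> 'a set" assume A: "\<And>i. i \<in> K \<Longrightarrow> A i \<in> sets borel"
      have "Pi\<^sub>E K A \<inter> c = Pi\<^sub>E K (\<lambda>i. A i \<inter> b i)"
        by (auto simp: b(3) PiE_Int)
      moreover have "disjoint_family_on (\<lambda>i. A i \<inter> b i) K"
        using b(2) by (auto simp: disjoint_family_on_def)
      ultimately have "emeasure \<mu> (Pi\<^sub>E K A \<inter> c) = emeasure \<nu> (Pi\<^sub>E K A \<inter> c)"
        using eq[of "\<lambda>i. A i \<inter> b i"] A bs by simp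
      then show "emeasure (density \<mu> (indicator c)) (Pi\<^sub>E K A) = emeasure (density \<nu> (indicator c)) (Pi\<^sub>E K A)"
        using A by (simp add: restr box)
    next
      show "emeasure (density \<mu> (indicator c)) (Pi\<^sub>E K (\<lambda>_. UNIV)) \<noteq> \<infinity>" for i :: nat
      proof -
        have "emeasure (density \<mu> (indicator c)) (Pi\<^sub>E K (\<lambda>_. UNIV)) = emeasure \<mu> c"
          using box[of "\<lambda>_. UNIV"] by (subst restr) (auto simp: b(3) intro!: arg_cong2[where f = emeasure])
        then show ?thesis using fin[OF bs b(2)] by (simp add: b(3))
      qed
    qed (use K in \<open>auto simp: space_PiM intro!: prod_algebraI_finite\<close>)
    then show ?thesis using restr[of \<mu> E] restr[of \<nu> E] E by simp
  qed simp
  define c where "c = from_nat_into C"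
  have cC: "c n \<in> C" for n using C(2) by (simp add: c_def from_nat_into)
  have cover: "\<exists>n. x \<in> c n" if x: "x \<in> extensional K" "inj_on x K" for x
  proof -
    obtain b where "b \<in> K \<rightarrow>\<^sub>E \<B>" "disjoint_family_on b K" "\<forall>i\<in>K. x i \<in> b i"
      using disjoint_basis_neighbourhoods[OF K x(2) \<B>(2)] by blast
    then have "Pi\<^sub>E K b \<in> C" "x \<in> Pi\<^sub>E K b"
      using x(1) by (auto simp: C_def PiE_def)
    then show ?thesis using from_nat_into_surj[OF C(1)] by (metis c_def)
  qed
  have dsets: "disjointed c n \<in> sets ?P" for n
    using C_sets[OF cC] by (auto simp: disjointed_def)
  \<comment> \<open>The covering boxes overlap, so they are made disjoint before summing over them.\<close>
  have split: "emeasure m E = (\<Sum>n. emeasure m (E \<inter> disjointed c n))"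
    if m: "sets m = sets ?P" "AE x in m. inj_on x K" and E: "E \<in> sets ?P" for m E
  proof -
    have space_m: "space m = extensional K"
      using sets_eq_imp_space_eq[OF m(1)] by (auto simp: space_PiM PiE_def)
    have "AE x in m. x \<in> E \<longleftrightarrow> x \<in> (\<Union>n. E \<inter> disjointed c n)"
      using m(2)
    proof (rule AE_mp, intro AE_I2 impI)
      fix x assume "x \<in> space m" "inj_on x K"
      then have "x \<in> extensional K" "inj_on x K" by (simp_all add: space_m)
      then obtain n where "x \<in> c n" using cover by blast
      then have "x \<in> (\<Union>n. disjointed c n)" by (subst UN_disjointed_eq) blast
      then show "x \<in> E \<longleftrightarrow> x \<in> (\<Union>n. E \<inter> disjointed c n)" by blast
    qed
    then have "emeasure m E = emeasure m (\<Union>n. E \<inter> disjointed c n)"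
      using m E dsets by (intro emeasure_eq_AE) auto
    also have "\<dots> = (\<Sum>n. emeasure m (E \<inter> disjointed c n))"
      using m E dsets
      by (intro suminf_emeasure[symmetric] disjoint_family_on_bisimulation[OF disjoint_family_disjointed[of c]]) auto
    finally show ?thesis .
  qed
  fix E assume "E \<in> sets \<mu>"
  then have E: "E \<in> sets ?P" by simp
  have "emeasure \<mu> (E \<inter> disjointed c n) = emeasure \<nu> (E \<inter> disjointed c n)" for n
    using on_box[OF cC[of n], of "E \<inter> disjointed c n"] E dsets disjointed_subset[of c n]
    by (simp add: Int_absorb2 Int_assoc)
  then show "emeasure \<mu> E = emeasure \<nu> E"
    using split[OF sets(1) inj(1) E] split[OF sets(2) inj(2) E] by simp
qed simp

section \<open>Tuples of Poisson points in a window\<close>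

text \<open>Tuples of distinct points of the process are described by injective tuples of their indices.\<close>

definition inj_tuples :: "nat set \<Rightarrow> (nat \<Rightarrow> nat) set"
  where "inj_tuples K = {\<tau> \<in> K \<rightarrow>\<^sub>E UNIV. inj_on \<tau> K}"

lemma countable_inj_tuples: "finite K \<Longrightarrow> countable (inj_tuples K)"
  unfolding inj_tuples_def
  by (rule countable_subset[of _ "K \<rightarrow>\<^sub>E UNIV"]) (auto intro: countable_PiE)

text \<open>A tuple of distinct points, one in each of \<open>card K\<close> disjoint subsets of \<open>W\<close>, exhausts the points
  in \<open>W\<close> if there are only \<open>card K\<close> of them. Then every subset contains exactly one point, none is
  left over, and the tuple is the only one.\<close>

lemma count_tuples_in_disjoint_sets:
  fixes \<xi> :: "nat \<Rightarrow> 'a"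
  assumes K: "finite K" and fin: "finite {j. \<xi> j \<in> W}"
    and C: "\<And>i. i \<in> K \<Longrightarrow> C i \<subseteq> W" "disjoint_family_on C K"
  shows "emeasure (count_space (inj_tuples K))
      {\<tau> \<in> inj_tuples K. card {j. \<xi> j \<in> W} = card K \<and> (\<forall>i\<in>K. \<xi> (\<tau> i) \<in> C i)} =
    (if (\<forall>i\<in>K. card {j. \<xi> j \<in> C i} = 1) \<and> card {j. \<xi> j \<in> W - \<Union>(C ` K)} = 0 then 1 else 0)"
    (is "emeasure _ ?S = (if ?R then 1 else 0)")
proof (cases ?R)
  case True
  have "\<exists>j. {j. \<xi> j \<in> C i} = {j}" if "i \<in> K" for i
    using True that by (auto simp: card_1_singleton_iff)
  then obtain t where t: "\<And>i. i \<in> K \<Longrightarrow> {j. \<xi> j \<in> C i} = {t i}" by metis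
  have inj: "inj_on t K"
  proof (rule inj_onI)
    fix i i' assume i: "i \<in> K" "i' \<in> K" "t i = t i'"
    then have "\<xi> (t i) \<in> C i" "\<xi> (t i) \<in> C i'" using t by blast+
    then show "i = i'" using C(2) i unfolding disjoint_family_on_def by blast
  qed
  have "finite {j. \<xi> j \<in> W - \<Union>(C ` K)}"
    using fin by (rule finite_subset[rotated]) auto
  then have "{j. \<xi> j \<in> W - \<Union>(C ` K)} = {}" using True by simp
  then have "{j. \<xi> j \<in> W} = (\<Union>i\<in>K. {j. \<xi> j \<in> C i})"
    using C(1) by fastforce
  then have "{j. \<xi> j \<in> W} = t ` K" using t by auto
  then have "card {j. \<xi> j \<in> W} = card K" using inj by (simp add: card_image)
  moreover have "\<tau> = restrict t K" if "\<tau> \<in> K \<rightarrow>\<^sub>E UNIV" "\<forall>i\<in>K. \<xi> (\<tau> i) \<in> C i" for \<tau>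
    using that t by (auto simp: fun_eq_iff PiE_def extensional_def)
  moreover have "\<xi> (t i) \<in> C i" if "i \<in> K" for i using t[OF that] by blast
  ultimately have "?S = {restrict t K}"
    using inj by (auto simp: inj_tuples_def cong: inj_on_cong)
  then show ?thesis
    using True inj by (simp add: inj_tuples_def cong: inj_on_cong)
next
  case False
  have "?R" if \<tau>: "\<tau> \<in> ?S" for \<tau>
  proof -
    have inj: "inj_on \<tau> K" and W: "card {j. \<xi> j \<in> W} = card K" and in_C: "\<And>i. i \<in> K \<Longrightarrow> \<xi> (\<tau> i) \<in> C i"
      using \<tau> by (auto simp: inj_tuples_def)
    have "\<tau> ` K = {j. \<xi> j \<in> W}"
      using in_C C(1) W inj fin by (intro card_subset_eq) (auto simp: card_image)
    then have *: "\<exists>i\<in>K. j = \<tau> i" if "\<xi> j \<in> W" for j using that by blast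
    have "{j. \<xi> j \<in> C i} = {\<tau> i}" if i: "i \<in> K" for i
    proof -
      have "j = \<tau> i" if j: "\<xi> j \<in> C i" for j
      proof -
        obtain i' where i': "i' \<in> K" "j = \<tau> i'" using * j C(1)[OF i] by blast
        then have "i' = i" using in_C[OF i'(1)] j i C(2) unfolding disjoint_family_on_def by blast
        then show ?thesis using i' by simp
      qed
      then show ?thesis using in_C[OF i] by blast
    qed
    moreover have "{j. \<xi> j \<in> W - \<Union>(C ` K)} = {}" using * in_C by blast
    ultimately show ?thesis by (metis card.empty card_1_singleton_iff One_nat_def)
  qed
  with False have S: "?S = {}" by blast
  show ?thesis unfolding S using False by (simp only: emeasure_empty if_False)
qed

lemma point_count_eq_card:
  assumes "finite {j. X j \<omega> \<in> B}"
  shows "point_count X B \<omega> = of_nat (card {j. X j \<omega> \<in> B})"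
  using assms by (simp add: point_count_def)

text \<open>The numbers of points in the sets \<open>C i\<close> and in the remainder of the window are independent Poisson
  variables. Their probabilities contribute the factors \<open>r * measure lborel (C i)\<close> and, as the sets
  partition the window, one common exponential.\<close>

lemma emeasure_one_point_per_set:
  fixes X :: "nat \<Rightarrow> 'w \<Rightarrow> 'a::euclidean_space" and K :: "nat set"
  assumes M: "prob_space M" and X: "poisson_points M r X" and r: "r \<ge> 0"
    and W: "bounded W" "W \<in> sets borel" and K: "finite K"
    and C: "\<And>i. i \<in> K \<Longrightarrow> C i \<in> sets borel" "\<And>i. i \<in> K \<Longrightarrow> C i \<subseteq> W" "disjoint_family_on C K"
  shows "emeasure M {\<omega> \<in> space M. (\<forall>i\<in>K. card {j. X j \<omega> \<in> C i} = 1) \<and> card {j. X j \<omega> \<in> W - \<Union>(C ` K)} = 0}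
    = ennreal (exp (- (r * measure lborel W)) * r ^ card K) * (\<Prod>i\<in>K. emeasure lborel (C i))"
    (is "emeasure M ?E = _")
proof -
  interpret prob_space M by (rule M)
  \<comment> \<open>The spare index \<open>e\<close> stands for the remainder of the window.\<close>
  obtain e where e: "e \<notin> K" using ex_new_if_finite[OF infinite_UNIV_nat K] by blast
  define B where "B = C(e := W - \<Union>(C ` K))"
  define n :: "nat \<Rightarrow> nat" where "n i = (if i = e then 0 else 1)" for i
  let ?I = "insert e K"
  have B_sets: "B i \<in> sets borel" and B_W: "B i \<subseteq> W" if "i \<in> ?I" for i
    using that C W(2) K e by (auto simp: B_def)
  have disj: "disjoint_family_on B ?I"
    using C(3) e unfolding disjoint_family_on_def B_def by auto
  have fin: "finite {j. X j \<omega> \<in> A}" if "\<omega> \<in> space M" "A \<subseteq> W" for \<omega> A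
    using X that bounded_subset[OF W(1)] by (auto simp: poisson_points_def)
  have finite_measure: "emeasure lborel A \<noteq> \<infinity>" if "A \<subseteq> W" for A
    using emeasure_lborel_bounded_finite[OF bounded_subset[OF W(1) that]] by simp
  have sum: "(\<Sum>i\<in>?I. measure lborel (B i)) = measure lborel W"
  proof -
    have "(\<Sum>i\<in>?I. measure lborel (B i)) = measure lborel (\<Union>i\<in>?I. B i)"
      using K B_sets B_W disj finite_measure
      by (intro measure_finite_Union[symmetric]) (auto simp: sets_lborel)
    also have "(\<Union>i\<in>?I. B i) = (W - \<Union>(C ` K)) \<union> (\<Union>i\<in>K. C i)"
      using e by (auto simp: B_def split: if_splits)
    also have "\<dots> = W" using C(2) by blast
    finally show ?thesis .
  qed
  have indep: "indep_vars (\<lambda>_. borel) (\<lambda>i. point_count X (B i)) ?I"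
    using X K B_sets disj unfolding poisson_points_def by blast
  have single: "prob (point_count X (B i) -` {of_nat (n i)} \<inter> space M)
      = (r * measure lborel (B i)) ^ n i * exp (- (r * measure lborel (B i)))" if "i \<in> ?I" for i
  proof -
    have "prob {\<omega> \<in> space M. point_count X (B i) \<omega> = of_nat (n i)}
        = (r * measure lborel (B i)) ^ n i / fact (n i) * exp (- (r * measure lborel (B i)))"
      using X B_sets[OF that] finite_measure[OF B_W[OF that]] unfolding poisson_points_def by simp
    then show ?thesis
      by (simp add: n_def vimage_def Int_def conj_commute)
  qed
  have "?E = (\<Inter>i\<in>?I. point_count X (B i) -` {of_nat (n i)} \<inter> space M)"
  proof -
    have "point_count X (B i) \<omega> = of_nat (n i) \<longleftrightarrow> card {j. X j \<omega> \<in> B i} = n i"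
      if "i \<in> ?I" "\<omega> \<in> space M" for i \<omega>
      using fin[OF that(2) B_W[OF that(1)]] by (simp add: point_count_eq_card)
    then have "(\<Inter>i\<in>?I. point_count X (B i) -` {of_nat (n i)} \<inter> space M)
        = {\<omega> \<in> space M. \<forall>i\<in>?I. card {j. X j \<omega> \<in> B i} = n i}"
      by auto
    also have "\<dots> = ?E"
    proof -
      have "(\<forall>i\<in>?I. card {j. X j \<omega> \<in> B i} = n i) \<longleftrightarrow>
          (\<forall>i\<in>K. card {j. X j \<omega> \<in> C i} = 1) \<and> card {j. X j \<omega> \<in> W - \<Union>(C ` K)} = 0" for \<omega>
      proof -
        have "card {j. X j \<omega> \<in> B i} = n i \<longleftrightarrow> card {j. X j \<omega> \<in> C i} = 1" if "i \<in> K" for i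
          using that e by (auto simp: B_def n_def)
        moreover have "card {j. X j \<omega> \<in> B e} = n e \<longleftrightarrow> card {j. X j \<omega> \<in> W - \<Union>(C ` K)} = 0"
          by (simp add: B_def n_def)
        ultimately show ?thesis by blast
      qed
      then show ?thesis by (intro Collect_cong conj_cong refl)
    qed
    finally show ?thesis by (rule sym)
  qed
  then have "prob ?E = (\<Prod>i\<in>?I. prob (point_count X (B i) -` {of_nat (n i)} \<inter> space M))"
    using indep_varsD_finite[OF indep, of "\<lambda>i. {of_nat (n i)}"] K by simp
  also have "\<dots> = (\<Prod>i\<in>?I. (r * measure lborel (B i)) ^ n i * exp (- (r * measure lborel (B i))))"
    using single by (intro prod.cong refl)
  also have "\<dots> = (\<Prod>i\<in>?I. (r * measure lborel (B i)) ^ n i) * exp (\<Sum>i\<in>?I. - (r * measure lborel (B i)))"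
    using K by (simp add: prod.distrib exp_sum)
  also have "(\<Sum>i\<in>?I. - (r * measure lborel (B i))) = - (r * measure lborel W)"
    using sum by (simp only: sum_negf flip: sum_distrib_left)
  also have "(\<Prod>i\<in>?I. (r * measure lborel (B i)) ^ n i) = (\<Prod>i\<in>K. r * measure lborel (C i))"
  proof -
    have "(\<Prod>i\<in>?I. (r * measure lborel (B i)) ^ n i) = (\<Prod>i\<in>K. (r * measure lborel (B i)) ^ n i)"
      using K e by (simp add: n_def)
    also have "\<dots> = (\<Prod>i\<in>K. r * measure lborel (C i))"
      using e by (intro prod.cong) (auto simp: n_def B_def)
    finally show ?thesis .
  qed
  also have "(\<Prod>i\<in>K. r * measure lborel (C i)) = r ^ card K * (\<Prod>i\<in>K. measure lborel (C i))"
    by (simp add: prod.distrib)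
  finally have "prob ?E = (exp (- (r * measure lborel W)) * r ^ card K) * (\<Prod>i\<in>K. measure lborel (C i))"
    by (simp add: mult_ac)
  moreover have "(\<Prod>i\<in>K. emeasure lborel (C i)) = ennreal (\<Prod>i\<in>K. measure lborel (C i))"
    using finite_measure C(2) by (subst prod_ennreal[symmetric]) (auto simp: emeasure_eq_ennreal_measure intro!: prod.cong)
  ultimately show ?thesis
    using r by (simp add: emeasure_eq_measure ennreal_mult prod_nonneg)
qed

text \<open>On the event that the window contains exactly \<open>card K\<close> points, the tuples of distinct points
  in the window have \<open>r ^ card K\<close> times Lebesgue measure as intensity, up to the factor
  \<open>exp (- r * measure lborel W)\<close>. It suffices to see this on boxes with disjoint sides, where the
  claim is that every side contains exactly one point and the remainder of the window none.\<close>

lemma poisson_tuples_intensity: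
  fixes X :: "nat \<Rightarrow> 'w \<Rightarrow> 'a::euclidean_space"
  assumes M: "prob_space M" and X: "poisson_points M r X" and r: "r \<ge> 0"
    and W: "bounded W" "W \<in> sets borel" and K: "finite K"
    and h: "h \<in> borel_measurable (\<Pi>\<^sub>M i\<in>K. borel)"
  shows "(\<integral>\<^sup>+\<tau>. \<integral>\<^sup>+\<omega>. indicator {\<omega>. card {j. X j \<omega> \<in> W} = card K \<and> (\<forall>i\<in>K. X (\<tau> i) \<omega> \<in> W)} \<omega>
        * h (\<lambda>i\<in>K. X (\<tau> i) \<omega>) \<partial>M \<partial>count_space (inj_tuples K))
    = ennreal (exp (- (r * measure lborel W)) * r ^ card K) * (\<integral>\<^sup>+v. h v \<partial>(\<Pi>\<^sub>M i\<in>K. window_measure W))"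
proof -
  interpret prob_space M by (rule M)
  let ?T = "inj_tuples K" and ?P = "\<Pi>\<^sub>M i\<in>K. (borel :: 'a measure)"
    and ?L = "\<Pi>\<^sub>M i\<in>K. window_measure W"
  let ?c = "ennreal (exp (- (r * measure lborel W)) * r ^ card K)"
  let ?D = "\<lambda>\<tau>. {\<omega>. card {j. X j \<omega> \<in> W} = card K \<and> (\<forall>i\<in>K. X (\<tau> i) \<omega> \<in> W)}"
  let ?x = "\<lambda>\<tau> \<omega>. \<lambda>i\<in>K. X (\<tau> i) \<omega>"
  interpret L: product_sigma_finite "\<lambda>_. window_measure W"
    by (rule product_sigma_finite_window_measure[OF W])
  have [measurable]: "X j \<in> borel_measurable M" for j
    using X by (simp add: poisson_points_def)
  note [measurable] = W(2) h
  have T: "countable ?T" by (rule countable_inj_tuples[OF K])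
  have x_meas: "?x \<tau> \<in> M \<rightarrow>\<^sub>M ?P" for \<tau>
    by (intro measurable_restrict) simp
  have D_sets: "?D \<tau> \<inter> space M \<in> sets M" for \<tau>
  proof -
    have "{\<omega> \<in> space M. card {j. X j \<omega> \<in> W} = card K \<and> (\<forall>i\<in>K. X (\<tau> i) \<omega> \<in> W)} \<in> sets M"
      using K by measurable
    then show ?thesis by (simp add: Int_def conj_commute)
  qed
  have ind: "(\<lambda>\<omega>. indicator (?D \<tau>) \<omega> :: ennreal) \<in> borel_measurable M" for \<tau>
    using D_sets by (simp add: borel_measurable_indicator_iff)
  define \<mu> where "\<mu> = distr (density (count_space ?T \<Otimes>\<^sub>M M) (\<lambda>(\<tau>, \<omega>). indicator (?D \<tau>) \<omega>)) ?P (\<lambda>(\<tau>, \<omega>). ?x \<tau> \<omega>)"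
  have sets_\<mu>: "sets \<mu> = sets ?P" by (simp add: \<mu>_def)
  have integral: "(\<integral>\<^sup>+v. g v \<partial>\<mu>) = (\<integral>\<^sup>+\<tau>. \<integral>\<^sup>+\<omega>. indicator (?D \<tau>) \<omega> * g (?x \<tau> \<omega>) \<partial>M \<partial>count_space ?T)"
    if g: "g \<in> borel_measurable ?P" for g
  proof -
    let ?N = "count_space ?T \<Otimes>\<^sub>M M"
    let ?X = "\<lambda>(\<tau>, \<omega>). ?x \<tau> \<omega>" and ?i = "\<lambda>(\<tau>, \<omega>). indicator (?D \<tau>) \<omega> :: ennreal"
    have 1: "?X \<in> ?N \<rightarrow>\<^sub>M ?P"
      by (rule measurable_pair_measure_countable1[OF T]) (simp only: prod.case x_meas)
    have 2: "?i \<in> borel_measurable ?N"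
      by (rule measurable_pair_measure_countable1[OF T]) (simp only: prod.case ind)
    have 3: "(\<lambda>q. g (?X q)) \<in> borel_measurable ?N"
      by (rule measurable_compose[OF 1 g])
    have "(\<integral>\<^sup>+v. g v \<partial>\<mu>) = (\<integral>\<^sup>+q. g (?X q) \<partial>density ?N ?i)"
      unfolding \<mu>_def by (rule nn_integral_distr) (use 1 g in simp_all)
    also have "\<dots> = (\<integral>\<^sup>+q. ?i q * g (?X q) \<partial>?N)"
      by (rule nn_integral_density[OF 2 3])
    also have "\<dots> = (\<integral>\<^sup>+\<tau>. \<integral>\<^sup>+\<omega>. ?i (\<tau>, \<omega>) * g (?X (\<tau>, \<omega>)) \<partial>M \<partial>count_space ?T)"
      by (rule nn_integral_fst[symmetric]) (rule borel_measurable_times_ennreal[OF 2 3])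
    finally show ?thesis by (simp only: prod.case)
  qed
  let ?\<nu> = "density ?L (\<lambda>_. ?c)"
  have sets_\<nu>: "sets ?\<nu> = sets ?P" using sets_PiM_window_measure by simp
  have boxes: "emeasure \<mu> (Pi\<^sub>E K B) = ?c * (\<Prod>i\<in>K. emeasure lborel (W \<inter> B i))"
    if B: "\<And>i. i \<in> K \<Longrightarrow> B i \<in> sets borel" "disjoint_family_on B K" for B
  proof -
    have box: "Pi\<^sub>E K B \<in> sets ?P" using K B by (intro sets_PiM_I_finite) auto
    let ?Q = "\<lambda>\<tau> \<omega>. card {j. X j \<omega> \<in> W} = card K \<and> (\<forall>i\<in>K. X (\<tau> i) \<omega> \<in> W \<inter> B i)"
    let ?E = "{\<omega> \<in> space M. (\<forall>i\<in>K. card {j. X j \<omega> \<in> W \<inter> B i} = 1) \<and> card {j. X j \<omega> \<in> W - \<Union>((\<lambda>i. W \<inter> B i) ` K)} = 0}"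
    have "emeasure \<mu> (Pi\<^sub>E K B) = (\<integral>\<^sup>+v. indicator (Pi\<^sub>E K B) v \<partial>\<mu>)"
      using box sets_\<mu> by simp
    also have "\<dots> = (\<integral>\<^sup>+\<tau>. \<integral>\<^sup>+\<omega>. indicator (?D \<tau>) \<omega> * indicator (Pi\<^sub>E K B) (?x \<tau> \<omega>) \<partial>M \<partial>count_space ?T)"
      using box by (intro integral) simp
    also have "\<dots> = (\<integral>\<^sup>+\<tau>. \<integral>\<^sup>+\<omega>. indicator {\<omega>. ?Q \<tau> \<omega>} \<omega> \<partial>M \<partial>count_space ?T)"
      by (intro nn_integral_cong) (auto simp: indicator_def PiE_iff)
    also have "\<dots> = (\<integral>\<^sup>+\<omega>. \<integral>\<^sup>+\<tau>. indicator {\<omega>. ?Q \<tau> \<omega>} \<omega> \<partial>count_space ?T \<partial>M)"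
    proof (rule nn_integral_count_space_nn_integral[OF T, symmetric])
      fix \<tau>
      have "(\<lambda>\<omega>. indicator (?D \<tau>) \<omega> * indicator (Pi\<^sub>E K B) (?x \<tau> \<omega>) :: ennreal) \<in> borel_measurable M"
        by (rule borel_measurable_times_ennreal[OF ind measurable_compose[OF x_meas borel_measurable_indicator[OF box]]])
      then show "(\<lambda>\<omega>. indicator {\<omega>. ?Q \<tau> \<omega>} \<omega> :: ennreal) \<in> borel_measurable M"
        by (rule iffD1[OF measurable_cong, rotated]) (auto simp: indicator_def PiE_iff)
    qed
    also have "\<dots> = (\<integral>\<^sup>+\<omega>. indicator ?E \<omega> \<partial>M)"
    proof (rule nn_integral_cong)
      fix \<omega> assume \<omega>: "\<omega> \<in> space M"
      have "(\<integral>\<^sup>+\<tau>. indicator {\<omega>. ?Q \<tau> \<omega>} \<omega> \<partial>count_space ?T) = (\<integral>\<^sup>+\<tau>. indicator {\<tau> \<in> ?T. ?Q \<tau> \<omega>} \<tau> \<partial>count_space ?T)"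
        by (intro nn_integral_cong) (auto simp: indicator_def)
      also have "\<dots> = emeasure (count_space ?T) {\<tau> \<in> ?T. ?Q \<tau> \<omega>}"
        by (intro nn_integral_indicator) auto
      also have "\<dots> = indicator ?E \<omega>"
        using B(2) \<omega> X W(1) K
        by (subst count_tuples_in_disjoint_sets)
           (auto simp: poisson_points_def disjoint_family_on_def indicator_def)
      finally show "(\<integral>\<^sup>+\<tau>. indicator {\<omega>. ?Q \<tau> \<omega>} \<omega> \<partial>count_space ?T) = indicator ?E \<omega>" .
    qed
    also have "\<dots> = emeasure M ?E"
    proof (rule nn_integral_indicator)
      have n [measurable]: "(\<lambda>\<omega>. card {j. X j \<omega> \<in> A}) \<in> M \<rightarrow>\<^sub>M count_space UNIV" if "A \<in> sets borel" for A
        using that by measurable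
      have "?E = (space M - (\<Union>i\<in>K. {\<omega> \<in> space M. card {j. X j \<omega> \<in> W \<inter> B i} \<noteq> 1})) \<inter>
          {\<omega> \<in> space M. card {j. X j \<omega> \<in> W - \<Union>((\<lambda>i. W \<inter> B i) ` K)} = 0}"
        by auto
      also have "\<dots> \<in> sets M"
      proof (intro sets.Int sets.Diff sets.top sets.finite_UN K)
        show "{\<omega> \<in> space M. card {j. X j \<omega> \<in> W \<inter> B i} \<noteq> 1} \<in> sets M" if "i \<in> K" for i
          using measurable_sets[OF n[of "W \<inter> B i"], of "- {1}"] W(2) B(1)[OF that]
          by (simp add: vimage_def Int_def conj_commute)
        have "W - \<Union>((\<lambda>i. W \<inter> B i) ` K) \<in> sets borel" using W(2) B(1) K by auto
        from measurable_sets[OF n[OF this], of "{0}"]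
        show "{\<omega> \<in> space M. card {j. X j \<omega> \<in> W - \<Union>((\<lambda>i. W \<inter> B i) ` K)} = 0} \<in> sets M"
          by (simp add: vimage_def Int_def conj_commute)
      qed
      finally show "?E \<in> sets M" .
    qed
    also have "\<dots> = ?c * (\<Prod>i\<in>K. emeasure lborel (W \<inter> B i))"
      using B W by (intro emeasure_one_point_per_set[OF M X r W K]) (auto simp: disjoint_family_on_def)
    finally show ?thesis .
  qed
  have "\<mu> = ?\<nu>"
  proof (rule measure_eqI_disjoint_boxes[OF K sets_\<mu> sets_\<nu>])
    let ?N = "{x \<in> space ?P. \<not> inj_on x K}"
    have "?N = space ?P - {x \<in> space ?P. inj_on x K}" by auto
    then have N: "?N \<in> sets ?P" using inj_on_sets_PiM[OF K] sets.compl_sets[of _ ?P] by (simp only:)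
    have inj: "AE \<omega> in M. inj (\<lambda>j. X j \<omega>)" using X by (simp add: poisson_points_def)
    have zero: "(\<integral>\<^sup>+\<omega>. indicator (?D \<tau>) \<omega> * indicator ?N (?x \<tau> \<omega>) \<partial>M) = (0 :: ennreal)" if "\<tau> \<in> ?T" for \<tau>
    proof -
      have "inj_on (?x \<tau> \<omega>) K" if "inj (\<lambda>j. X j \<omega>)" for \<omega>
        using that \<open>\<tau> \<in> ?T\<close> by (auto simp: inj_tuples_def inj_on_def)
      then have "AE \<omega> in M. indicator (?D \<tau>) \<omega> * indicator ?N (?x \<tau> \<omega>) = (0 :: ennreal)"
        using inj by (elim eventually_mono) (simp add: indicator_def)
      then have "(\<integral>\<^sup>+\<omega>. indicator (?D \<tau>) \<omega> * indicator ?N (?x \<tau> \<omega>) \<partial>M) = (\<integral>\<^sup>+\<omega>. (0 :: ennreal) \<partial>M)"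
        by (rule nn_integral_cong_AE)
      then show ?thesis by simp
    qed
    have "(\<integral>\<^sup>+v. indicator ?N v \<partial>\<mu>) = (\<integral>\<^sup>+\<tau>. \<integral>\<^sup>+\<omega>. indicator (?D \<tau>) \<omega> * indicator ?N (?x \<tau> \<omega>) \<partial>M \<partial>count_space ?T)"
      using N by (intro integral) simp
    also have "\<dots> = (\<integral>\<^sup>+\<tau>. 0 \<partial>count_space ?T)"
      by (intro nn_integral_cong zero) simp
    finally have "(\<integral>\<^sup>+v. indicator ?N v \<partial>\<mu>) = 0" by simp
    then have "emeasure \<mu> ?N = 0" using N sets_\<mu> by simp
    then show "AE x in \<mu>. inj_on x K"
      using N sets_\<mu> sets_eq_imp_space_eq[OF sets_\<mu>] by (subst AE_iff_null) auto
    show "AE x in ?\<nu>. inj_on x K"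
      using AE_inj_on_PiM_window_measure[OF W K] by (subst AE_density) (auto elim!: eventually_mono)
    fix B :: "nat \<Rightarrow> 'a set"
    assume B: "\<And>i. i \<in> K \<Longrightarrow> B i \<in> sets borel" "disjoint_family_on B K"
    have "emeasure ?\<nu> (Pi\<^sub>E K B) = ?c * emeasure ?L (Pi\<^sub>E K B)"
      using K B by (intro emeasure_density_const) (auto intro!: sets_PiM_I_finite)
    also have "emeasure ?L (Pi\<^sub>E K B) = (\<Prod>i\<in>K. emeasure lborel (W \<inter> B i))"
      using B W(2) by (subst L.emeasure_PiM[OF K]) (auto simp: emeasure_window_measure intro!: prod.cong)
    finally show "emeasure \<mu> (Pi\<^sub>E K B) = emeasure ?\<nu> (Pi\<^sub>E K B)"
      using boxes[OF B] by simp
    show "emeasure \<mu> (Pi\<^sub>E K B) < \<infinity>"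
    proof -
      have "emeasure lborel (W \<inter> B i) < \<infinity>" for i
        by (intro emeasure_lborel_bounded_finite bounded_Int disjI1 W(1))
      then have "(\<Prod>i\<in>K. emeasure lborel (W \<inter> B i)) = ennreal (\<Prod>i\<in>K. measure lborel (W \<inter> B i))"
        by (subst prod_ennreal[symmetric]) (simp_all add: emeasure_eq_ennreal_measure less_top)
      then show ?thesis by (simp add: boxes[OF B] ennreal_mult_less_top)
    qed
  qed
  then have "(\<integral>\<^sup>+v. h v \<partial>\<mu>) = (\<integral>\<^sup>+v. h v \<partial>?\<nu>)" by simp
  moreover have "(\<integral>\<^sup>+v. h v \<partial>?\<nu>) = ?c * (\<integral>\<^sup>+v. h v \<partial>?L)"
  proof -
    have h': "h \<in> borel_measurable ?L"
      using h by (simp only: measurable_cong_sets[OF sets_PiM_window_measure refl])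
    then have "(\<integral>\<^sup>+v. h v \<partial>?\<nu>) = (\<integral>\<^sup>+v. ?c * h v \<partial>?L)"
      by (intro nn_integral_density) simp_all
    also have "\<dots> = ?c * (\<integral>\<^sup>+v. h v \<partial>?L)"
      using h' by (rule nn_integral_cmult)
    finally show ?thesis .
  qed
  ultimately show ?thesis using integral[OF h] by simp
qed

section \<open>The edge process given the number of points in the window\<close>

text \<open>The points in the indexing of \<^const>\<open>added_points\<close>: the roots \<open>0\<close> and \<open>x\<close> have the indices \<open>0\<close> and
  \<open>1\<close>, and \<open>z i\<close> has the index \<open>i + 1\<close>.\<close>

definition rooted :: "'a::zero \<Rightarrow> (nat \<Rightarrow> 'a) \<Rightarrow> nat \<Rightarrow> 'a"
  where "rooted x z k = (if k = 0 then 0 else if k = 1 then x else z (k - 1))"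

abbreviation rooted_indices :: "nat set \<Rightarrow> nat set"
  where "rooted_indices K \<equiv> {0, 1} \<union> Suc ` K"

lemma dom_added_points: "dom (added_points x z K) = rooted_indices K"
  by (auto simp: added_points_def dom_def split: if_splits)

lemma the_added_points:
  assumes "0 \<notin> K" "k \<in> rooted_indices K"
  shows "the (added_points x z K k) = rooted x z k"
  using assms by (auto simp: added_points_def rooted_def map_add_def)

text \<open>The expectation of the functional when there are no points of the process: only the marks remain
  to be averaged.\<close>

definition rooted_mean ::
  "(((real ^ 'd::{finite,linorder}) set \<times> real) measure \<Rightarrow> ennreal) \<Rightarrow> real ^ 'd::{finite,linorder} \<Rightarrow> nat set \<Rightarrow>
   (nat \<Rightarrow> real ^ 'd::{finite,linorder}) \<Rightarrow> ennreal"
  where "rooted_mean \<phi> x K z = mean_over_marks \<phi> (rooted x z) (rooted_indices K)"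

lemma rooted_mean_cong:
  assumes "\<And>i. i \<in> K \<Longrightarrow> z i = z' i" "0 \<notin> K"
  shows "rooted_mean \<phi> x K z = rooted_mean \<phi> x K z'"
  unfolding rooted_mean_def using assms by (intro mean_over_marks_cong) (auto simp: rooted_def)

lemma rooted_measurable:
  assumes "\<And>i. i \<in> K \<Longrightarrow> z i \<in> borel_measurable N" "0 \<notin> K" "k \<in> rooted_indices K"
  shows "(\<lambda>\<omega>. rooted x (\<lambda>i. z i \<omega>) k) \<in> borel_measurable N"
  using assms by (auto simp: rooted_def)

lemma rooted_mean_measurable:
  assumes \<phi>: "\<phi> \<in> borel_measurable (point_measure_space marked_edge_metric)"
    and K: "finite K" "0 \<notin> K" and z: "\<And>i. i \<in> K \<Longrightarrow> z i \<in> borel_measurable N"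
  shows "(\<lambda>\<omega>. rooted_mean \<phi> x K (\<lambda>i. z i \<omega>)) \<in> borel_measurable N"
  unfolding rooted_mean_def using K z
  by (intro mean_over_marks_measurable[OF \<phi>] rooted_measurable) auto

lemma edge_process_added_points:
  assumes "0 \<notin> J"
  shows "edge_process r X U (added_points x z J) \<omega> =
    marked_edges (case_sum (rooted x z) (\<lambda>j. X j \<omega>))
      (Inl ` rooted_indices J \<union> (if r > 0 then range Inr else {})) (\<lambda>p. U p \<omega>)"
  unfolding edge_process_eq_marked_edges dom_added_points using assms
  by (intro marked_edges_cong) (auto simp: the_added_points split: if_splits)

lemma edge_process_measurable:
  fixes x :: "real ^ 'd::{finite,linorder}" and X :: "nat \<Rightarrow> 'n \<Rightarrow> real ^ 'd::{finite,linorder}"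
  assumes f: "f \<in> point_measure_space marked_edge_metric \<rightarrow>\<^sub>M K"
    and J: "finite J" "0 \<notin> J" and z: "\<And>i. i \<in> J \<Longrightarrow> z i \<in> borel_measurable N"
    and X: "\<And>j. r > 0 \<Longrightarrow> X j \<in> borel_measurable N"
      "\<And>C \<omega>. r > 0 \<Longrightarrow> bounded C \<Longrightarrow> \<omega> \<in> space N \<Longrightarrow> finite {j. X j \<omega> \<in> C}"
    and U: "\<And>p. U p \<in> borel_measurable N" "\<And>p \<omega>. \<omega> \<in> space N \<Longrightarrow> U p \<omega> \<in> {0..1}"
  shows "(\<lambda>\<omega>. f (edge_process r X U (added_points x (\<lambda>i. z i \<omega>) J) \<omega>)) \<in> N \<rightarrow>\<^sub>M K"
proof -
  let ?I = "Inl ` rooted_indices J \<union> (if r > 0 then range Inr else {}) :: point_index set"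
  let ?Z = "\<lambda>i \<omega>. case_sum (rooted x (\<lambda>i. z i \<omega>)) (\<lambda>j. X j \<omega>) i"
  have "(\<lambda>\<omega>. marked_edges (\<lambda>i. ?Z i \<omega>) ?I (\<lambda>p. U p \<omega>)) \<in> N \<rightarrow>\<^sub>M point_measure_space marked_edge_metric"
  proof (rule marked_edges_measurable)
    fix i assume i: "i \<in> ?I"
    show "?Z i \<in> borel_measurable N"
    proof (cases i)
      case (Inl k)
      then have "k \<in> rooted_indices J" using i by (auto split: if_splits)
      then show ?thesis using Inl rooted_measurable[of J z N k x] z J by simp
    next
      case (Inr j)
      then have "r > 0" using i by (auto split: if_splits)
      then show ?thesis using Inr X(1) by simp
    qed
  next
    fix C :: "(real ^ 'd::{finite,linorder}) set" and \<omega> assume C: "bounded C" "\<omega> \<in> space N"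
    have "finite (Inr ` {j. X j \<omega> \<in> C} :: point_index set)" if "r > 0"
      using X(2)[OF that C] by simp
    then have "finite (Inl ` rooted_indices J \<union> (if r > 0 then Inr ` {j. X j \<omega> \<in> C} else {}) :: point_index set)"
      using J by simp
    then show "finite {i \<in> ?I. ?Z i \<omega> \<in> C}"
      by (rule finite_subset[rotated]) (auto split: if_splits)
  qed (use U in auto)
  from measurable_compose[OF this f] show ?thesis
    by (simp add: edge_process_added_points[OF J(2)])
qed

text \<open>When the window contains exactly \<open>card K\<close> points, every enumeration \<open>\<tau>\<close> of them by \<open>K\<close>
  turns the edge process in the window into the marked edges of the roots, of the added points and
  of the enumerated points. Summing over all enumerations counts every outcome \<open>fact (card K)\<close>
  times and makes the intensity of the tuples available; for each single enumeration the marks are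
  independent of the points and can be averaged out.\<close>

lemma nn_integral_given_number_of_points:
  fixes X :: "nat \<Rightarrow> 'w \<Rightarrow> real ^ 'd::{finite,linorder}"
  assumes M: "prob_space M" and XU: "marked_poisson M r X U" and r: "r > 0"
    and W: "compact W" "{0, x} \<subseteq> W"
    and \<phi>: "\<phi> \<in> borel_measurable (point_measure_space marked_edge_metric)"
    and det: "\<And>\<mu>. \<mu> \<in> point_measures marked_edge_metric \<Longrightarrow> \<phi> \<mu> = \<phi> (restrict_edges W \<mu>)"
    and J: "finite J" "0 \<notin> J" "\<And>i. i \<in> J \<Longrightarrow> z i \<in> W"
    and K: "finite K" "0 \<notin> K" "J \<inter> K = {}"
  shows "fact (card K) * (\<integral>\<^sup>+\<omega>. indicator {\<omega>. card {j. X j \<omega> \<in> W} = card K} \<omega>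
        * \<phi> (edge_process r X U (added_points x z J) \<omega>) \<partial>M) =
    ennreal (exp (- (r * measure lborel W)) * r ^ card K) *
      (\<integral>\<^sup>+v. rooted_mean \<phi> x (J \<union> K) (merge J K (z, v)) \<partial>(\<Pi>\<^sub>M i\<in>K. window_measure W))"
proof -
  interpret prob_space M by (rule M)
  have poisson: "poisson_points M r X" using XU r by (simp add: marked_poisson_def)
  have X_meas: "X j \<in> borel_measurable M" for j using poisson by (simp add: poisson_points_def)
  have bounded: "bounded W" and closed: "closed W" and W_borel: "W \<in> sets borel"
    using W(1) by (simp_all add: compact_imp_bounded compact_imp_closed)
  have U01: "U p \<omega> \<in> {0..1}" if "\<omega> \<in> space M" for p \<omega>
    using XU that unfolding marked_poisson_def by blast
  let ?T = "inj_tuples K" and ?PX = "\<Pi>\<^sub>M j\<in>(UNIV :: nat set). (borel :: (real ^ 'd::{finite,linorder}) measure)"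
  have T: "countable ?T" by (rule countable_inj_tuples[OF K(1)])
  let ?A = "rooted_indices (J \<union> K)"
  have A: "finite ?A" using J K by simp
  \<comment> \<open>The points with indices from \<open>K\<close> are the enumerated points of the process, all others are
    roots or added points.\<close>
  define g where "g \<tau> k = (if k \<in> Suc ` K then Inr (\<tau> (k - 1)) else Inl k :: point_index)" for \<tau> k
  have g_inj: "inj_on (g \<tau>) ?A" if "\<tau> \<in> ?T" for \<tau>
    using that by (auto simp: inj_on_def g_def inj_tuples_def)
  have g_image: "g \<tau> ` ?A = Inl ` rooted_indices J \<union> Inr ` \<tau> ` K" for \<tau>
  proof -
    have "g \<tau> ` ?A = g \<tau> ` rooted_indices J \<union> g \<tau> ` Suc ` K" by auto
    also have "g \<tau> ` rooted_indices J = Inl ` rooted_indices J"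
      using J K by (intro image_cong) (auto simp: g_def)
    also have "g \<tau> ` Suc ` K = Inr ` \<tau> ` K"
      unfolding image_image by (intro image_cong) (auto simp: g_def)
    finally show ?thesis .
  qed
  let ?Z = "\<lambda>\<xi>. case_sum (rooted x z) \<xi>"
  define D where "D \<tau> = {\<xi> :: nat \<Rightarrow> real ^ 'd::{finite,linorder}. card {j. \<xi> j \<in> W} = card K \<and> (\<forall>i\<in>K. \<xi> (\<tau> i) \<in> W)}" for \<tau>
  define \<Psi> where "\<Psi> \<tau> = (\<lambda>(\<xi>, u). indicator (D \<tau>) \<xi> * \<phi> (marked_edges (?Z \<xi>) (g \<tau> ` ?A) u))" for \<tau>
  have D_sets: "D \<tau> \<in> sets ?PX" for \<tau>
  proof -
    have "{\<xi> \<in> space ?PX. card {j. \<xi> j \<in> W} = card K \<and> (\<forall>i\<in>K. \<xi> (\<tau> i) \<in> W)} \<in> sets ?PX"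
      using K(1) W_borel by measurable
    then show ?thesis by (simp add: D_def space_PiM)
  qed
  have \<Psi>_meas: "\<Psi> \<tau> \<in> borel_measurable (?PX \<Otimes>\<^sub>M marks_law)" for \<tau>
  proof -
    have 1: "(\<lambda>(\<xi>, u). \<phi> (marked_edges (\<lambda>i. ?Z \<xi> i) (g \<tau> ` ?A) u)) \<in> borel_measurable (?PX \<Otimes>\<^sub>M marks_law)"
    proof (rule functional_of_marked_edges_measurable[OF \<phi>])
      show "(\<lambda>\<xi>. ?Z \<xi> i) \<in> borel_measurable ?PX" for i
        by (cases i) simp_all
    qed (use A in auto)
    have 2: "(\<lambda>q. indicator (D \<tau>) (fst q) :: ennreal) \<in> borel_measurable (?PX \<Otimes>\<^sub>M (marks_law :: (point_index \<times> point_index \<Rightarrow> real) measure))"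
      by (rule measurable_compose[OF measurable_fst borel_measurable_indicator[OF D_sets]])
    show ?thesis
      using borel_measurable_times_ennreal[OF 2 1] by (simp add: \<Psi>_def case_prod_unfold)
  qed
  \<comment> \<open>Every enumeration of the points in the window yields the same value of the functional, and there
    are \<open>fact (card K)\<close> of them.\<close>
  have enum: "(\<integral>\<^sup>+\<tau>. \<Psi> \<tau> (\<lambda>j. X j \<omega>, \<lambda>p. U p \<omega>) \<partial>count_space ?T) =
      fact (card K) * (indicator {\<omega>. card {j. X j \<omega> \<in> W} = card K} \<omega> * \<phi> (edge_process r X U (added_points x z J) \<omega>))"
    if \<omega>: "\<omega> \<in> space M" for \<omega>
  proof (cases "card {j. X j \<omega> \<in> W} = card K")
    case False
    then show ?thesis by (simp add: \<Psi>_def D_def)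
  next
    case True
    let ?S = "{j. X j \<omega> \<in> W}" and ?F = "\<phi> (edge_process r X U (added_points x z J) \<omega>)"
    have S: "finite ?S" using poisson bounded \<omega> by (simp add: poisson_points_def)
    have u: "\<And>p. U p \<omega> \<in> {0..1}" using U01 \<omega> by blast
    have \<Psi>_eq: "\<Psi> \<tau> (\<lambda>j. X j \<omega>, \<lambda>p. U p \<omega>) = indicator {\<tau> \<in> K \<rightarrow>\<^sub>E ?S. inj_on \<tau> K} \<tau> * ?F" if \<tau>: "\<tau> \<in> ?T" for \<tau>
    proof (cases "\<forall>i\<in>K. X (\<tau> i) \<omega> \<in> W")
      case False
      then show ?thesis by (auto simp: \<Psi>_def D_def indicator_def)
    next
      case in_W: True
      have "\<tau> ` K = ?S"
        using \<tau> in_W True S by (intro card_subset_eq) (auto simp: inj_tuples_def card_image)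
      let ?I = "Inl ` rooted_indices J \<union> range Inr" and ?Y = "?Z (\<lambda>j. X j \<omega>)"
      have "?F = \<phi> (marked_edges ?Y ?I (\<lambda>p. U p \<omega>))"
        using r by (simp add: edge_process_added_points[OF J(2)])
      also have "\<dots> = \<phi> (restrict_edges W (marked_edges ?Y ?I (\<lambda>p. U p \<omega>)))"
      proof (rule det, rule marked_edges_in_point_measures)
        fix C :: "(real ^ 'd::{finite,linorder}) set" assume "bounded C"
        then have "finite {j. X j \<omega> \<in> C}" using poisson \<omega> by (simp add: poisson_points_def)
        then have "finite (Inl ` rooted_indices J \<union> Inr ` {j. X j \<omega> \<in> C})" using J by simp
        then show "finite {i \<in> ?I. ?Y i \<in> C}"
          by (rule finite_subset[rotated]) auto
      qed (rule u)
      also have "restrict_edges W (marked_edges ?Y ?I (\<lambda>p. U p \<omega>)) = marked_edges ?Y {i \<in> ?I. ?Y i \<in> W} (\<lambda>p. U p \<omega>)"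
        by (rule restrict_edges_marked_edges[OF closed u])
      also have "{i \<in> ?I. ?Y i \<in> W} = Inl ` rooted_indices J \<union> Inr ` ?S"
        using J W(2) by (auto simp: rooted_def)
      also have "\<dots> = g \<tau> ` ?A"
        unfolding g_image \<open>\<tau> ` K = ?S\<close> ..
      finally have "?F = \<phi> (marked_edges ?Y (g \<tau> ` ?A) (\<lambda>p. U p \<omega>))" .
      moreover have "\<tau> \<in> K \<rightarrow>\<^sub>E ?S" "inj_on \<tau> K" using \<tau> in_W by (auto simp: inj_tuples_def)
      ultimately show ?thesis
        using True in_W by (simp add: \<Psi>_def D_def)
    qed
    have sub: "{\<tau> \<in> K \<rightarrow>\<^sub>E ?S. inj_on \<tau> K} \<subseteq> ?T" by (auto simp: inj_tuples_def)
    have "(\<integral>\<^sup>+\<tau>. \<Psi> \<tau> (\<lambda>j. X j \<omega>, \<lambda>p. U p \<omega>) \<partial>count_space ?T) = (\<integral>\<^sup>+\<tau>. indicator {\<tau> \<in> K \<rightarrow>\<^sub>E ?S. inj_on \<tau> K} \<tau> * ?F \<partial>count_space ?T)"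
      by (intro nn_integral_cong \<Psi>_eq) simp
    also have "\<dots> = emeasure (count_space ?T) {\<tau> \<in> K \<rightarrow>\<^sub>E ?S. inj_on \<tau> K} * ?F"
      using sub by (subst nn_integral_multc) auto
    also have "emeasure (count_space ?T) {\<tau> \<in> K \<rightarrow>\<^sub>E ?S. inj_on \<tau> K} = of_nat (card {\<tau> \<in> K \<rightarrow>\<^sub>E ?S. inj_on \<tau> K})"
      using sub S K(1) by (intro emeasure_count_space_finite) (auto intro: finite_subset[OF _ finite_PiE[of K "\<lambda>_. ?S"]])
    also have "card {\<tau> \<in> K \<rightarrow>\<^sub>E ?S. inj_on \<tau> K} = fact (card K)"
      using card_inj_on_subset_funcset[OF K(1) S, of K] True by (simp add: fact_prod_rev)
    finally show ?thesis using True by simp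
  qed
  have "fact (card K) * (\<integral>\<^sup>+\<omega>. indicator {\<omega>. card {j. X j \<omega> \<in> W} = card K} \<omega>
        * \<phi> (edge_process r X U (added_points x z J) \<omega>) \<partial>M)
      = (\<integral>\<^sup>+\<omega>. fact (card K) * (indicator {\<omega>. card {j. X j \<omega> \<in> W} = card K} \<omega>
        * \<phi> (edge_process r X U (added_points x z J) \<omega>)) \<partial>M)"
  proof (rule nn_integral_cmult[symmetric])
    have "(\<lambda>\<omega>. \<phi> (edge_process r X U (added_points x z J) \<omega>)) \<in> borel_measurable M"
      using poisson XU U01 by (intro edge_process_measurable[OF \<phi> J(1,2), where z = "\<lambda>i _. z i"])
        (auto simp: poisson_points_def marked_poisson_def)
    moreover have "(\<lambda>\<omega>. indicator {\<xi>. card {j. \<xi> j \<in> W} = card K} (\<lambda>j. X j \<omega>) :: ennreal) \<in> borel_measurable M"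
    proof (rule measurable_compose[OF _ borel_measurable_indicator])
      show "(\<lambda>\<omega> j. X j \<omega>) \<in> M \<rightarrow>\<^sub>M ?PX"
        using X_meas by (intro measurable_PiM_single') auto
      have "{\<xi> \<in> space ?PX. card {j. \<xi> j \<in> W} = card K} \<in> sets ?PX"
        using W_borel by measurable
      then show "{\<xi>. card {j. \<xi> j \<in> W} = card K} \<in> sets ?PX" by (simp add: space_PiM)
    qed
    ultimately show "(\<lambda>\<omega>. indicator {\<omega>. card {j. X j \<omega> \<in> W} = card K} \<omega>
        * \<phi> (edge_process r X U (added_points x z J) \<omega>)) \<in> borel_measurable M"
      by (intro borel_measurable_times_ennreal) (simp_all add: indicator_def)
  qed
  also have "\<dots> = (\<integral>\<^sup>+\<omega>. \<integral>\<^sup>+\<tau>. \<Psi> \<tau> (\<lambda>j. X j \<omega>, \<lambda>p. U p \<omega>) \<partial>count_space ?T \<partial>M)"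
    by (intro nn_integral_cong enum[symmetric])
  also have "\<dots> = (\<integral>\<^sup>+\<tau>. \<integral>\<^sup>+\<omega>. \<Psi> \<tau> (\<lambda>j. X j \<omega>, \<lambda>p. U p \<omega>) \<partial>M \<partial>count_space ?T)"
  proof (rule nn_integral_count_space_nn_integral[OF T])
    have "(\<lambda>\<omega>. (\<lambda>j. X j \<omega>, \<lambda>p. U p \<omega>)) \<in> M \<rightarrow>\<^sub>M ?PX \<Otimes>\<^sub>M marks_law"
      using X_meas distr_marks(1)[OF M XU] by (intro measurable_Pair measurable_PiM_single') auto
    then show "(\<lambda>\<omega>. \<Psi> \<tau> (\<lambda>j. X j \<omega>, \<lambda>p. U p \<omega>)) \<in> borel_measurable M" for \<tau>
      using \<Psi>_meas by (rule measurable_compose)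
  qed
  also have "\<dots> = (\<integral>\<^sup>+\<tau>. \<integral>\<^sup>+\<omega>. indicator {\<omega>. card {j. X j \<omega> \<in> W} = card K \<and> (\<forall>i\<in>K. X (\<tau> i) \<omega> \<in> W)} \<omega>
        * rooted_mean \<phi> x (J \<union> K) (merge J K (z, \<lambda>i\<in>K. X (\<tau> i) \<omega>)) \<partial>M \<partial>count_space ?T)"
  proof (rule nn_integral_cong)
    fix \<tau> assume "\<tau> \<in> space (count_space ?T)"
    then have \<tau>: "\<tau> \<in> ?T" by simp
    have "(\<integral>\<^sup>+\<omega>. \<Psi> \<tau> (\<lambda>j. X j \<omega>, \<lambda>p. U p \<omega>) \<partial>M) = (\<integral>\<^sup>+\<omega>. \<integral>\<^sup>+u. \<Psi> \<tau> (\<lambda>j. X j \<omega>, u) \<partial>marks_law \<partial>M)"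
      by (rule nn_integral_points_marks[OF M XU r \<Psi>_meas])
    also have "\<dots> = (\<integral>\<^sup>+\<omega>. indicator (D \<tau>) (\<lambda>j. X j \<omega>) * mean_over_marks \<phi> (?Z (\<lambda>j. X j \<omega>)) (g \<tau> ` ?A) \<partial>M)"
    proof (rule nn_integral_cong)
      fix \<omega> assume "\<omega> \<in> space M"
      have "(\<lambda>u. \<phi> (marked_edges (?Z (\<lambda>j. X j \<omega>)) (g \<tau> ` ?A) u)) \<in> borel_measurable marks_law"
      proof -
        have "(\<lambda>(\<omega>', u). \<phi> (marked_edges (\<lambda>i. ?Z (\<lambda>j. X j \<omega>) i) (g \<tau> ` ?A) u)) \<in> borel_measurable (count_space {()} \<Otimes>\<^sub>M marks_law)"
          using A by (intro functional_of_marked_edges_measurable[OF \<phi>]) auto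
        from measurable_Pair2[OF this, of "()"] show ?thesis by simp
      qed
      then show "(\<integral>\<^sup>+u. \<Psi> \<tau> (\<lambda>j. X j \<omega>, u) \<partial>marks_law) =
          indicator (D \<tau>) (\<lambda>j. X j \<omega>) * mean_over_marks \<phi> (?Z (\<lambda>j. X j \<omega>)) (g \<tau> ` ?A)"
        unfolding \<Psi>_def mean_over_marks_def prod.case by (rule nn_integral_cmult)
    qed
    also have "\<dots> = (\<integral>\<^sup>+\<omega>. indicator {\<omega>. card {j. X j \<omega> \<in> W} = card K \<and> (\<forall>i\<in>K. X (\<tau> i) \<omega> \<in> W)} \<omega>
        * rooted_mean \<phi> x (J \<union> K) (merge J K (z, \<lambda>i\<in>K. X (\<tau> i) \<omega>)) \<partial>M)"
    proof (rule nn_integral_cong)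
      fix \<omega> assume "\<omega> \<in> space M"
      have "mean_over_marks \<phi> (?Z (\<lambda>j. X j \<omega>)) (g \<tau> ` ?A) = mean_over_marks \<phi> (?Z (\<lambda>j. X j \<omega>) \<circ> g \<tau>) ?A"
        by (rule mean_over_marks_reindex[OF g_inj[OF \<tau>] A \<phi>])
      also have "\<dots> = rooted_mean \<phi> x (J \<union> K) (merge J K (z, \<lambda>i\<in>K. X (\<tau> i) \<omega>))"
        unfolding rooted_mean_def
      proof (rule mean_over_marks_cong)
        fix k assume "k \<in> ?A"
        then show "(?Z (\<lambda>j. X j \<omega>) \<circ> g \<tau>) k = rooted x (merge J K (z, \<lambda>i\<in>K. X (\<tau> i) \<omega>)) k"
          using J(2) K(2,3) by (auto simp: g_def rooted_def)
      qed
      finally show "indicator (D \<tau>) (\<lambda>j. X j \<omega>) * mean_over_marks \<phi> (?Z (\<lambda>j. X j \<omega>)) (g \<tau> ` ?A) =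
          indicator {\<omega>. card {j. X j \<omega> \<in> W} = card K \<and> (\<forall>i\<in>K. X (\<tau> i) \<omega> \<in> W)} \<omega>
        * rooted_mean \<phi> x (J \<union> K) (merge J K (z, \<lambda>i\<in>K. X (\<tau> i) \<omega>))"
        by (simp add: D_def indicator_def)
    qed
    finally show "(\<integral>\<^sup>+\<omega>. \<Psi> \<tau> (\<lambda>j. X j \<omega>, \<lambda>p. U p \<omega>) \<partial>M) = \<dots>" .
  qed
  also have "\<dots> = ennreal (exp (- (r * measure lborel W)) * r ^ card K) *
      (\<integral>\<^sup>+v. rooted_mean \<phi> x (J \<union> K) (merge J K (z, v)) \<partial>(\<Pi>\<^sub>M i\<in>K. window_measure W))"
  proof (rule poisson_tuples_intensity[OF M poisson less_imp_le[OF r] bounded W_borel K(1)])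
    show "(\<lambda>v. rooted_mean \<phi> x (J \<union> K) (merge J K (z, v))) \<in> borel_measurable (\<Pi>\<^sub>M i\<in>K. borel)"
      using J K by (intro rooted_mean_measurable[OF \<phi>]) (auto simp: merge_def)
  qed
  finally show ?thesis .
qed

section \<open>Integration over the added points\<close>

lemma PiM_window_measure:
  fixes W :: "'a::euclidean_space set"
  assumes W: "bounded W" "W \<in> sets borel" and I: "finite I"
  shows "(\<Pi>\<^sub>M i\<in>I. window_measure W) = density (\<Pi>\<^sub>M i\<in>I. lborel) (indicator (\<Pi>\<^sub>E i\<in>I. W))"
proof -
  interpret L: product_sigma_finite "\<lambda>_. window_measure W"
    by (rule product_sigma_finite_window_measure[OF W])
  interpret B: product_sigma_finite "\<lambda>_. lborel :: 'a measure"
    by (simp add: product_sigma_finite_def lborel.sigma_finite_measure_axioms)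
  let ?P = "\<Pi>\<^sub>M i\<in>I. (lborel :: 'a measure)"
  let ?D = "density ?P (indicator (\<Pi>\<^sub>E i\<in>I. W))"
  have sets_P: "sets ?P = sets (\<Pi>\<^sub>M i\<in>I. window_measure W)"
    by (intro sets_PiM_cong) simp_all
  have box: "Pi\<^sub>E I A \<in> sets ?P" if "\<And>i. i \<in> I \<Longrightarrow> A i \<in> sets borel" for A
    using I that by (intro sets_PiM_I_finite) auto
  have "?D = (\<Pi>\<^sub>M i\<in>I. window_measure W)"
  proof (rule L.PiM_eqI[OF I])
    show "sets ?D = sets (\<Pi>\<^sub>M i\<in>I. window_measure W)" using sets_P by simp
    fix A assume "\<And>i. i \<in> I \<Longrightarrow> A i \<in> sets (window_measure W)"
    then have A: "\<And>i. i \<in> I \<Longrightarrow> A i \<in> sets borel" by simp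
    have "emeasure ?D (Pi\<^sub>E I A) = (\<integral>\<^sup>+v. indicator (\<Pi>\<^sub>E i\<in>I. W) v * indicator (Pi\<^sub>E I A) v \<partial>?P)"
      using box[of A] box[of "\<lambda>_. W"] A W(2) by (intro emeasure_density) auto
    also have "\<dots> = (\<integral>\<^sup>+v. indicator (\<Pi>\<^sub>E i\<in>I. W \<inter> A i) v \<partial>?P)"
      by (intro nn_integral_cong) (auto simp: indicator_def PiE_iff)
    also have "\<dots> = emeasure ?P (\<Pi>\<^sub>E i\<in>I. W \<inter> A i)"
      using box[of "\<lambda>i. W \<inter> A i"] A W(2) by (intro nn_integral_indicator) auto
    also have "\<dots> = (\<Prod>i\<in>I. emeasure lborel (W \<inter> A i))"
      using I A W(2) by (intro B.emeasure_PiM) auto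
    also have "\<dots> = (\<Prod>i\<in>I. emeasure (window_measure W) (A i))"
      using A W(2) by (intro prod.cong) (auto simp: emeasure_window_measure)
    finally show "emeasure ?D (Pi\<^sub>E I A) = (\<Prod>i\<in>I. emeasure (window_measure W) (A i))" .
  qed
  then show ?thesis by simp
qed

lemma AE_in_window:
  fixes W :: "'a::euclidean_space set"
  assumes W: "bounded W" "W \<in> sets borel" and I: "finite I"
  shows "AE z in (\<Pi>\<^sub>M i\<in>I. window_measure W). \<forall>i\<in>I. z i \<in> W"
proof -
  have "(\<Pi>\<^sub>E i\<in>I. W) \<in> sets (\<Pi>\<^sub>M i\<in>I. (lborel :: 'a measure))"
    using I W(2) by (intro sets_PiM_I_finite) auto
  then show ?thesis
    unfolding PiM_window_measure[OF W I] 
    by (subst AE_density) (simp, rule AE_I2, simp add: indicator_def PiE_iff)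
qed

lemma PiM_window_measure_reindex:
  fixes W :: "'a::euclidean_space set"
  assumes W: "bounded W" "W \<in> sets borel" and I: "finite I" and g: "bij_betw g I K"
  shows "distr (\<Pi>\<^sub>M i\<in>K. window_measure W) (\<Pi>\<^sub>M i\<in>I. window_measure W) (\<lambda>z. \<lambda>i\<in>I. z (g i)) = (\<Pi>\<^sub>M i\<in>I. window_measure W)"
proof -
  interpret L: product_sigma_finite "\<lambda>_. window_measure W"
    by (rule product_sigma_finite_window_measure[OF W])
  have K: "finite K" using I g bij_betw_finite by blast
  have gK: "g i \<in> K" if "i \<in> I" for i using g that by (auto simp: bij_betw_def)
  have meas: "(\<lambda>z. \<lambda>i\<in>I. z (g i)) \<in> (\<Pi>\<^sub>M i\<in>K. window_measure W) \<rightarrow>\<^sub>M (\<Pi>\<^sub>M i\<in>I. window_measure W)"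
    using gK by (intro measurable_restrict measurable_component_singleton)
  show ?thesis
  proof (rule L.PiM_eqI[OF I])
    fix A assume A: "\<And>i. i \<in> I \<Longrightarrow> A i \<in> sets (window_measure W)"
    let ?h = "the_inv_into I g"
    have h: "?h k \<in> I" "g (?h k) = k" if "k \<in> K" for k
      using g that by (auto simp: bij_betw_def the_inv_into_into f_the_inv_into_f)
    have hg: "?h (g i) = i" if "i \<in> I" for i
      using g that by (auto simp: bij_betw_def the_inv_into_f_f)
    have "(\<lambda>z. \<lambda>i\<in>I. z (g i)) -` Pi\<^sub>E I A \<inter> space (\<Pi>\<^sub>M i\<in>K. window_measure W) = (\<Pi>\<^sub>E k\<in>K. A (?h k))"
    proof (intro set_eqI iffI)
      fix z assume z: "z \<in> (\<lambda>z. \<lambda>i\<in>I. z (g i)) -` Pi\<^sub>E I A \<inter> space (\<Pi>\<^sub>M i\<in>K. window_measure W)"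
      then have "z (g i) \<in> A i" if "i \<in> I" for i using that by (auto simp: PiE_iff)
      from this[OF h(1)] show "z \<in> (\<Pi>\<^sub>E k\<in>K. A (?h k))"
        using z h by (auto simp: space_PiM PiE_iff)
    next
      fix z assume z: "z \<in> (\<Pi>\<^sub>E k\<in>K. A (?h k))"
      have "z (g i) \<in> A i" if "i \<in> I" for i using z gK[OF that] hg[OF that] by (auto simp: PiE_iff)
      then show "z \<in> (\<lambda>z. \<lambda>i\<in>I. z (g i)) -` Pi\<^sub>E I A \<inter> space (\<Pi>\<^sub>M i\<in>K. window_measure W)"
        using z by (auto simp: space_PiM PiE_iff)
    qed
    then have "emeasure (distr (\<Pi>\<^sub>M i\<in>K. window_measure W) (\<Pi>\<^sub>M i\<in>I. window_measure W) (\<lambda>z. \<lambda>i\<in>I. z (g i))) (Pi\<^sub>E I A)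
        = emeasure (\<Pi>\<^sub>M i\<in>K. window_measure W) (\<Pi>\<^sub>E k\<in>K. A (?h k))"
      using A I by (subst emeasure_distr[OF meas]) (auto intro!: sets_PiM_I_finite)
    also have "\<dots> = (\<Prod>k\<in>K. emeasure (window_measure W) (A (?h k)))"
      using A h by (intro L.emeasure_PiM[OF K]) auto
    also have "\<dots> = (\<Prod>i\<in>I. emeasure (window_measure W) (A (?h (g i))))"
      by (rule prod.reindex_bij_betw[OF g, symmetric])
    also have "\<dots> = (\<Prod>i\<in>I. emeasure (window_measure W) (A i))"
      by (intro prod.cong) (simp_all add: hg)
    finally show "emeasure (distr (\<Pi>\<^sub>M i\<in>K. window_measure W) (\<Pi>\<^sub>M i\<in>I. window_measure W) (\<lambda>z. \<lambda>i\<in>I. z (g i))) (Pi\<^sub>E I A)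
        = (\<Prod>i\<in>I. emeasure (window_measure W) (A i))" .
  qed simp
qed

text \<open>All expectations below are series in these numbers, with weights that depend only on the intensity
  and on the volume of the window.\<close>

definition window_integral ::
  "(((real ^ 'd::{finite,linorder}) set \<times> real) measure \<Rightarrow> ennreal) \<Rightarrow> real ^ 'd::{finite,linorder} \<Rightarrow>
   (real ^ 'd::{finite,linorder}) set \<Rightarrow> nat \<Rightarrow> ennreal"
  where "window_integral \<phi> x W m = (\<integral>\<^sup>+z. rooted_mean \<phi> x {1..m} z \<partial>(\<Pi>\<^sub>M i\<in>{1..m}. window_measure W))"

lemma rooted_mean_measurable_PiM:
  assumes "\<phi> \<in> borel_measurable (point_measure_space marked_edge_metric)" "finite K" "0 \<notin> K"
  shows "rooted_mean \<phi> x K \<in> borel_measurable (\<Pi>\<^sub>M i\<in>K. window_measure W)"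
proof -
  have "(\<lambda>z. rooted_mean \<phi> x K (\<lambda>i. z i)) \<in> borel_measurable (\<Pi>\<^sub>M i\<in>K. borel)"
    using assms by (intro rooted_mean_measurable) auto
  then show ?thesis
    unfolding measurable_cong_sets[OF sets_PiM_window_measure refl] .
qed

text \<open>Renaming the coordinates changes neither the product measure nor, by
  exchangeability of the marks, the mean functional.\<close>

lemma window_integral_reindex:
  assumes W: "bounded W" "W \<in> sets borel"
    and \<phi>: "\<phi> \<in> borel_measurable (point_measure_space marked_edge_metric)"
    and K: "finite K" "0 \<notin> K"
  shows "(\<integral>\<^sup>+z. rooted_mean \<phi> x K z \<partial>(\<Pi>\<^sub>M i\<in>K. window_measure W)) = window_integral \<phi> x W (card K)"
proof -
  let ?I = "{1..card K}"
  have "card ?I = card K" by simp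
  then obtain g where g: "bij_betw g ?I K"
    using finite_same_card_bij[OF finite_atLeastAtMost K(1)] by blast
  let ?r = "\<lambda>z. \<lambda>i\<in>?I. z (g i)"
  have gK: "g i \<in> K" if "i \<in> ?I" for i using g that by (auto simp: bij_betw_def)
  define h where "h k = (if k \<in> Suc ` ?I then Suc (g (k - 1)) else k)" for k
  have g_pos: "g i \<noteq> 0" if "i \<in> ?I" for i using gK[OF that] K(2) by metis
  have h_Suc: "h (Suc i) = Suc (g i)" if "i \<in> ?I" for i using that by (simp add: h_def)
  have h_root: "h k = k" if "k \<in> {0, 1}" for k using that by (auto simp: h_def)
  have h_inj: "inj_on h (rooted_indices ?I)"
  proof (rule inj_onI)
    fix k l assume kl: "k \<in> rooted_indices ?I" "l \<in> rooted_indices ?I" "h k = h l"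
    have root: "h m \<in> {0, 1} \<longleftrightarrow> m \<in> {0, 1}" if m: "m \<in> rooted_indices ?I" for m
    proof (cases "m \<in> {0, 1}")
      case True
      then show ?thesis using h_root by simp
    next
      case False
      then obtain i where i: "i \<in> ?I" "m = Suc i" using m by blast
      then show ?thesis using h_Suc[OF i(1)] g_pos[OF i(1)] by simp
    qed
    show "k = l"
    proof (cases "k \<in> {0, 1}")
      case True
      then have "l \<in> {0, 1}" using root kl by metis
      then show ?thesis using True h_root kl(3) by metis
    next
      case False
      then have "l \<notin> {0, 1}" using root kl by metis
      with False obtain i j where ij: "i \<in> ?I" "k = Suc i" "j \<in> ?I" "l = Suc j" using kl by blast
      then have "g i = g j" using h_Suc kl(3) by (metis Suc_inject)
      then show ?thesis using g ij unfolding bij_betw_def inj_on_def by metis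
    qed
  qed
  have h_image: "h ` rooted_indices ?I = rooted_indices K"
  proof -
    have "h ` Suc ` ?I = Suc ` g ` ?I"
      unfolding image_image by (intro image_cong) (auto simp: h_def)
    also have "\<dots> = Suc ` K" using g by (simp add: bij_betw_def)
    finally have "h ` Suc ` ?I = Suc ` K" .
    moreover have "h ` {0, 1} = {0, 1}" by (simp add: h_def)
    ultimately show ?thesis by (simp only: image_Un)
  qed
  have "window_integral \<phi> x W (card K) =
      (\<integral>\<^sup>+z. rooted_mean \<phi> x ?I z \<partial>distr (\<Pi>\<^sub>M i\<in>K. window_measure W) (\<Pi>\<^sub>M i\<in>?I. window_measure W) ?r)"
    unfolding window_integral_def PiM_window_measure_reindex[OF W finite_atLeastAtMost g] ..
  also have "\<dots> = (\<integral>\<^sup>+z. rooted_mean \<phi> x ?I (?r z) \<partial>(\<Pi>\<^sub>M i\<in>K. window_measure W))"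
    using gK rooted_mean_measurable_PiM[OF \<phi>, of ?I x W]
    by (intro nn_integral_distr measurable_restrict measurable_component_singleton) auto
  also have "\<dots> = (\<integral>\<^sup>+z. rooted_mean \<phi> x K z \<partial>(\<Pi>\<^sub>M i\<in>K. window_measure W))"
  proof (rule nn_integral_cong)
    fix z
    have "rooted_mean \<phi> x K z = mean_over_marks \<phi> (rooted x z \<circ> h) (rooted_indices ?I)"
      unfolding rooted_mean_def h_image[symmetric] by (rule mean_over_marks_reindex[OF h_inj _ \<phi>]) simp
    also have "\<dots> = rooted_mean \<phi> x ?I (?r z)"
      unfolding rooted_mean_def
    proof (rule mean_over_marks_cong)
      fix k assume "k \<in> rooted_indices ?I"
      then consider "k = 0" | "k = 1" | i where "i \<in> ?I" "k = Suc i" by blast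
      then show "(rooted x z \<circ> h) k = rooted x (?r z) k"
      proof cases
        case (3 i)
        then show ?thesis using g_pos[OF 3(1)] h_Suc[OF 3(1)] by (simp add: rooted_def)
      qed (simp_all add: h_def rooted_def)
    qed
    finally show "rooted_mean \<phi> x ?I (?r z) = rooted_mean \<phi> x K z" by simp
  qed
  finally show ?thesis by simp
qed

text \<open>Decomposition according to the number \<open>k\<close> of points of the process in the window, which enter as
  added points with \<open>k\<close> fresh indices \<open>K k\<close>. For \<open>r = 0\<close> there is no process and the term for \<open>k = 0\<close>
  is the only one that does not vanish.\<close>

lemma nn_integral_edge_process:
  fixes X :: "nat \<Rightarrow> 'w \<Rightarrow> real ^ 'd::{finite,linorder}"
  assumes M: "prob_space M" and XU: "marked_poisson M r X U" and r: "r \<ge> 0"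
    and W: "compact W" "{0, x} \<subseteq> W"
    and \<phi>: "\<phi> \<in> borel_measurable (point_measure_space marked_edge_metric)"
    and det: "\<And>\<mu>. \<mu> \<in> point_measures marked_edge_metric \<Longrightarrow> \<phi> \<mu> = \<phi> (restrict_edges W \<mu>)"
    and J: "finite J" "0 \<notin> J" "\<And>i. i \<in> J \<Longrightarrow> z i \<in> W"
    and K: "\<And>k. finite (K k)" "\<And>k. 0 \<notin> K k" "\<And>k. J \<inter> K k = {}" "\<And>k. card (K k) = k"
  shows "(\<integral>\<^sup>+\<omega>. \<phi> (edge_process r X U (added_points x z J) \<omega>) \<partial>M) =
    (\<Sum>k. ennreal (exp (- (r * measure lborel W)) * r ^ k / fact k) *
      (\<integral>\<^sup>+v. rooted_mean \<phi> x (J \<union> K k) (merge J (K k) (z, v)) \<partial>(\<Pi>\<^sub>M i\<in>K k. window_measure W)))"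
proof (cases "r = 0")
  case True
  have bounded: "bounded W" and W_borel: "W \<in> sets borel"
    using W(1) by (simp_all add: compact_imp_bounded compact_imp_closed)
  interpret L: product_sigma_finite "\<lambda>_. window_measure W"
    by (rule product_sigma_finite_window_measure[OF bounded W_borel])
  let ?R = "\<lambda>k. (\<integral>\<^sup>+v. rooted_mean \<phi> x (J \<union> K k) (merge J (K k) (z, v)) \<partial>(\<Pi>\<^sub>M i\<in>K k. window_measure W))"
  have K0: "K 0 = {}" using K(1,4)[of 0] by simp
  let ?Z = "case_sum (rooted x z) (\<lambda>_. 0) :: point_index \<Rightarrow> real ^ 'd::{finite,linorder}"
  have ep: "edge_process r X U (added_points x z J) \<omega> = marked_edges ?Z (Inl ` rooted_indices J) (\<lambda>p. U p \<omega>)" for \<omega>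
  proof -
    have "(Inl ` rooted_indices J \<union> (if r > 0 then range Inr else {}) :: point_index set) = Inl ` rooted_indices J"
      using True by simp
    then have "edge_process r X U (added_points x z J) \<omega> =
        marked_edges (case_sum (rooted x z) (\<lambda>j. X j \<omega>)) (Inl ` rooted_indices J) (\<lambda>p. U p \<omega>)"
      by (simp only: edge_process_added_points[OF J(2)])
    also have "\<dots> = marked_edges ?Z (Inl ` rooted_indices J) (\<lambda>p. U p \<omega>)"
      by (rule marked_edges_cong) auto
    finally show ?thesis .
  qed
  have meas: "(\<lambda>u. \<phi> (marked_edges ?Z (Inl ` rooted_indices J) u)) \<in> borel_measurable marks_law"
  proof -
    have "(\<lambda>(\<omega>', u). \<phi> (marked_edges (\<lambda>i. ?Z i) (Inl ` rooted_indices J) u)) \<in> borel_measurable (count_space {()} \<Otimes>\<^sub>M marks_law)"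
      using J(1) by (intro functional_of_marked_edges_measurable[OF \<phi>]) auto
    from measurable_Pair2[OF this, of "()"] show ?thesis by simp
  qed
  have "(\<integral>\<^sup>+\<omega>. \<phi> (edge_process r X U (added_points x z J) \<omega>) \<partial>M)
      = (\<integral>\<^sup>+u. \<phi> (marked_edges ?Z (Inl ` rooted_indices J) u) \<partial>distr M marks_law (\<lambda>\<omega> p. U p \<omega>))"
    unfolding ep using meas distr_marks(1)[OF M XU] by (intro nn_integral_distr[symmetric]) simp_all
  also have "\<dots> = mean_over_marks \<phi> ?Z (Inl ` rooted_indices J)"
    by (simp only: distr_marks(2)[OF M XU] mean_over_marks_def)
  also have "\<dots> = mean_over_marks \<phi> (?Z \<circ> Inl) (rooted_indices J)"
    using J(1) by (intro mean_over_marks_reindex[OF _ _ \<phi>]) auto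
  also have "\<dots> = rooted_mean \<phi> x J z"
    by (simp add: rooted_mean_def comp_def)
  also have "\<dots> = rooted_mean \<phi> x (J \<union> K 0) (merge J (K 0) (z, \<lambda>_. undefined))"
    unfolding K0 Un_empty_right by (rule rooted_mean_cong) (simp_all add: J(2))
  also have "\<dots> = (\<integral>\<^sup>+v. rooted_mean \<phi> x (J \<union> K 0) (merge J (K 0) (z, v)) \<partial>(\<Pi>\<^sub>M i\<in>K 0. window_measure W))"
    unfolding K0 by (rule L.nn_integral_empty[symmetric]) simp
  also have "\<dots> = (\<Sum>k. ennreal (exp (- (r * measure lborel W)) * r ^ k / fact k) *
      (\<integral>\<^sup>+v. rooted_mean \<phi> x (J \<union> K k) (merge J (K k) (z, v)) \<partial>(\<Pi>\<^sub>M i\<in>K k. window_measure W)))"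
  proof -
    have "(\<Sum>k. ennreal (exp (- (r * measure lborel W)) * r ^ k / fact k) * ?R k)
        = (\<Sum>k\<in>{0}. ennreal (exp (- (r * measure lborel W)) * r ^ k / fact k) * ?R k)"
      by (rule suminf_finite) (simp_all add: True power_0_left)
    then show ?thesis by (simp add: True)
  qed
  finally show ?thesis .
next
  case False
  then have r: "r > 0" using r by simp
  interpret prob_space M by (rule M)
  have poisson: "poisson_points M r X" using XU r by (simp add: marked_poisson_def)
  have X_meas [measurable]: "X j \<in> borel_measurable M" for j using poisson by (simp add: poisson_points_def)
  have W_borel [measurable]: "W \<in> sets borel" using W(1) by (simp add: compact_imp_closed)
  let ?F = "\<lambda>\<omega>. \<phi> (edge_process r X U (added_points x z J) \<omega>)"
  let ?i = "\<lambda>k. indicator {\<omega>. card {j. X j \<omega> \<in> W} = k} :: 'w \<Rightarrow> ennreal"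
  let ?R = "\<lambda>k. (\<integral>\<^sup>+v. rooted_mean \<phi> x (J \<union> K k) (merge J (K k) (z, v)) \<partial>(\<Pi>\<^sub>M i\<in>K k. window_measure W))"
  have U01: "U p \<omega> \<in> {0..1}" if "\<omega> \<in> space M" for p \<omega>
    using XU that unfolding marked_poisson_def by blast
  have F: "?F \<in> borel_measurable M"
    using poisson XU U01 by (intro edge_process_measurable[OF \<phi> J(1,2), where z = "\<lambda>i _. z i"])
      (auto simp: poisson_points_def marked_poisson_def)
  have i: "?i k \<in> borel_measurable M" for k
  proof -
    have "(\<lambda>\<omega>. card {j. X j \<omega> \<in> W}) \<in> M \<rightarrow>\<^sub>M count_space UNIV" by measurable
    then have "{\<omega>. card {j. X j \<omega> \<in> W} = k} \<inter> space M \<in> sets M"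
      using measurable_sets[of _ M "count_space UNIV" "{k}"] by (simp add: vimage_def)
    then show ?thesis by (simp add: borel_measurable_indicator_iff)
  qed
  have "(\<integral>\<^sup>+\<omega>. ?F \<omega> \<partial>M) = (\<integral>\<^sup>+\<omega>. (\<Sum>k. ?i k \<omega> * ?F \<omega>) \<partial>M)"
  proof (rule nn_integral_cong)
    fix \<omega>
    show "?F \<omega> = (\<Sum>k. ?i k \<omega> * ?F \<omega>)"
      by (subst suminf_finite[of "{card {j. X j \<omega> \<in> W}}"]) (auto simp: indicator_def)
  qed
  also have "\<dots> = (\<Sum>k. \<integral>\<^sup>+\<omega>. ?i k \<omega> * ?F \<omega> \<partial>M)"
    using i F by (intro nn_integral_suminf borel_measurable_times_ennreal)
  also have "\<dots> = (\<Sum>k. ennreal (exp (- (r * measure lborel W)) * r ^ k / fact k) * ?R k)"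
  proof (intro suminf_cong)
    fix k
    let ?a = "\<integral>\<^sup>+\<omega>. ?i k \<omega> * ?F \<omega> \<partial>M" and ?c = "exp (- (r * measure lborel W)) * r ^ k"
    have inv: "ennreal (inverse (fact k)) * fact k = 1"
    proof -
      have "(fact k :: ennreal) = of_nat (fact k)" by (rule of_nat_fact[symmetric])
      also have "\<dots> = ennreal (fact k)" by (simp only: ennreal_of_nat_eq_real_of_nat of_nat_fact)
      finally show ?thesis by (simp only:) (simp flip: ennreal_mult)
    qed
    have "fact k * ?a = ennreal ?c * ?R k"
      using nn_integral_given_number_of_points[OF M XU r W \<phi> det J K(1-3)[of k]] by (simp only: K(4))
    then have "ennreal (inverse (fact k)) * fact k * ?a = ennreal (inverse (fact k)) * ennreal ?c * ?R k"
      by (simp only: mult.assoc)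
    also have "ennreal (inverse (fact k)) * ennreal ?c = ennreal (?c / fact k)"
      using r by (subst ennreal_mult[symmetric]) (simp_all add: divide_inverse)
    finally show "?a = ennreal (?c / fact k) * ?R k"
      by (simp only: inv mult_1_left)
  qed
  finally show ?thesis .
qed

text \<open>After integration over their positions, the added points cannot be told from the points of the
  process in the window, so that \<open>card J\<close> added and \<open>k\<close> random points together contribute
  \<open>window_integral \<phi> x W (card J + k)\<close>. Each coordinate outside of \<open>J\<close> contributes the volume of the
  window as a factor.\<close>

lemma nn_integral_added_points_edge_process:
  fixes X :: "nat \<Rightarrow> 'w \<Rightarrow> real ^ 'd::{finite,linorder}"
  assumes M: "prob_space M" and XU: "marked_poisson M r X U" and r: "r \<ge> 0"
    and W: "compact W" "{0, x} \<subseteq> W"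
    and \<phi>: "\<phi> \<in> borel_measurable (point_measure_space marked_edge_metric)"
    and det: "\<And>\<mu>. \<mu> \<in> point_measures marked_edge_metric \<Longrightarrow> \<phi> \<mu> = \<phi> (restrict_edges W \<mu>)"
    and J: "J \<subseteq> {1..n}"
  shows "(\<integral>\<^sup>+z. \<integral>\<^sup>+\<omega>. \<phi> (edge_process r X U (added_points x z J) \<omega>) \<partial>M \<partial>(\<Pi>\<^sub>M i\<in>{1..n}. window_measure W)) =
    ennreal (measure lborel W ^ (n - card J)) *
      (\<Sum>k. ennreal (exp (- (r * measure lborel W)) * r ^ k / fact k) * window_integral \<phi> x W (card J + k))"
proof -
  have bounded: "bounded W" and W_borel: "W \<in> sets borel"
    using W(1) by (simp_all add: compact_imp_bounded compact_imp_closed)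
  interpret L: product_sigma_finite "\<lambda>_. window_measure W"
    by (rule product_sigma_finite_window_measure[OF bounded W_borel])
  let ?L = "\<lambda>I. \<Pi>\<^sub>M i\<in>I. window_measure W"
  let ?w = "measure lborel W"
  \<comment> \<open>Fresh indices, away from those of the \<open>n\<close> integrated coordinates.\<close>
  define K where "K k = {n + 1..n + k}" for k
  have K: "finite (K k)" "0 \<notin> K k" "J \<inter> K k = {}" "card (K k) = k" for k
    using J by (auto simp: K_def)
  have fJ: "finite J" "0 \<notin> J" using J by (auto intro: finite_subset)
  let ?J' = "{1..n} - J"
  have JJ': "J \<union> ?J' = {1..n}" "J \<inter> ?J' = {}" "finite ?J'" using J by auto
  let ?c = "\<lambda>k. ennreal (exp (- (r * ?w)) * r ^ k / fact k)"
  define R where "R k z = (\<integral>\<^sup>+v. rooted_mean \<phi> x (J \<union> K k) (merge J (K k) (z, v)) \<partial>?L (K k))" for k z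
  have R_cong: "R k z = R k z'" if "\<And>i. i \<in> J \<Longrightarrow> z i = z' i" for k z z'
    unfolding R_def using that fJ K by (intro nn_integral_cong rooted_mean_cong) (auto simp: merge_def)
  have RJ: "(\<integral>\<^sup>+z. R k z \<partial>?L J) = window_integral \<phi> x W (card J + k)" for k
  proof -
    have "rooted_mean \<phi> x (J \<union> K k) \<in> borel_measurable (?L (J \<union> K k))"
      using fJ K by (intro rooted_mean_measurable_PiM[OF \<phi>]) auto
    from L.product_nn_integral_fold[OF K(3) fJ(1) K(1) this]
    have "(\<integral>\<^sup>+z. R k z \<partial>?L J) = (\<integral>\<^sup>+z. rooted_mean \<phi> x (J \<union> K k) z \<partial>?L (J \<union> K k))"
      by (simp add: R_def)
    also have "\<dots> = window_integral \<phi> x W (card (J \<union> K k))"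
      using fJ K by (intro window_integral_reindex[OF bounded W_borel \<phi>]) auto
    finally show ?thesis using fJ K by (simp add: card_Un_disjoint)
  qed
  have R_meas: "R k \<in> borel_measurable (?L {1..n})" for k
  proof -
    interpret K: sigma_finite_measure "?L (K k)" by (rule L.sigma_finite[OF K(1)])
    have "(\<lambda>q. rooted_mean \<phi> x (J \<union> K k) (\<lambda>i. merge J (K k) q i)) \<in> borel_measurable (?L {1..n} \<Otimes>\<^sub>M ?L (K k))"
    proof (rule rooted_mean_measurable[OF \<phi>])
      show "(\<lambda>q. merge J (K k) q i) \<in> borel_measurable (?L {1..n} \<Otimes>\<^sub>M ?L (K k))" if i: "i \<in> J \<union> K k" for i
      proof (cases "i \<in> J")
        case True
        then have "(\<lambda>z. z i) \<in> ?L {1..n} \<rightarrow>\<^sub>M window_measure W"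
          using J by (intro measurable_component_singleton) auto
        then have coord: "(\<lambda>q. fst q i) \<in> ?L {1..n} \<Otimes>\<^sub>M ?L (K k) \<rightarrow>\<^sub>M window_measure W"
          by (rule measurable_compose[OF measurable_fst])
        have eq: "(\<lambda>q. merge J (K k) q i) = (\<lambda>q. fst q i)"
          using True by (auto simp: merge_def)
        show ?thesis
          unfolding eq using coord by (simp only: measurable_cong_sets[OF refl sets_window_measure])
      next
        case False
        then have iK: "i \<in> K k" using i by simp
        then have "(\<lambda>z. z i) \<in> ?L (K k) \<rightarrow>\<^sub>M window_measure W"
          by (intro measurable_component_singleton)
        then have coord: "(\<lambda>q. snd q i) \<in> ?L {1..n} \<Otimes>\<^sub>M ?L (K k) \<rightarrow>\<^sub>M window_measure W"
          by (rule measurable_compose[OF measurable_snd])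
        have eq: "(\<lambda>q. merge J (K k) q i) = (\<lambda>q. snd q i)"
          using False iK by (auto simp: merge_def)
        show ?thesis
          unfolding eq using coord by (simp only: measurable_cong_sets[OF refl sets_window_measure])
      qed
    qed (use fJ K in auto)
    then show ?thesis
      unfolding R_def by (intro K.borel_measurable_nn_integral) (simp add: case_prod_unfold)
  qed
  have Rn: "(\<integral>\<^sup>+z. R k z \<partial>?L {1..n}) = ennreal (?w ^ (n - card J)) * window_integral \<phi> x W (card J + k)" for k
  proof -
    have "(\<integral>\<^sup>+z. R k z \<partial>?L {1..n}) = (\<integral>\<^sup>+z. \<integral>\<^sup>+y. R k (merge J ?J' (z, y)) \<partial>?L ?J' \<partial>?L J)"
      using L.product_nn_integral_fold[OF JJ'(2) fJ(1) JJ'(3), of "R k"] R_meas[of k] by (simp only: JJ'(1))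
    also have "\<dots> = (\<integral>\<^sup>+z. \<integral>\<^sup>+y. R k z \<partial>?L ?J' \<partial>?L J)"
      by (intro nn_integral_cong R_cong) (simp add: merge_def)
    also have "\<dots> = (\<integral>\<^sup>+z. emeasure (?L ?J') (space (?L ?J')) * R k z \<partial>?L J)"
      by (simp add: mult.commute)
    also have "emeasure (?L ?J') (space (?L ?J')) = emeasure lborel W ^ card ?J'"
      unfolding space_PiM using W_borel
      by (subst L.emeasure_PiM[OF JJ'(3)]) (auto simp: emeasure_window_measure)
    also have "emeasure lborel W = ennreal ?w"
      using emeasure_lborel_bounded_finite[OF bounded] by (intro emeasure_eq_ennreal_measure) simp
    also have "ennreal ?w ^ card ?J' = ennreal (?w ^ (n - card J))"
      using J fJ by (simp add: ennreal_power card_Diff_subset)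
    also have "(\<integral>\<^sup>+z. ennreal (?w ^ (n - card J)) * R k z \<partial>?L J) = ennreal (?w ^ (n - card J)) * (\<integral>\<^sup>+z. R k z \<partial>?L J)"
    proof (rule nn_integral_cmult)
      have "(\<lambda>_\<in>?J'. 0) \<in> space (?L ?J')" by (simp add: space_PiM)
      then have "(\<lambda>z. merge J ?J' (z, \<lambda>_\<in>?J'. 0)) \<in> ?L J \<rightarrow>\<^sub>M ?L (J \<union> ?J')"
        by (rule measurable_compose[OF measurable_Pair2' measurable_merge])
      then have "(\<lambda>z. R k (merge J ?J' (z, \<lambda>_\<in>?J'. 0))) \<in> borel_measurable (?L J)"
        using R_meas unfolding JJ'(1) by (rule measurable_compose)
      moreover have "(\<lambda>z. R k (merge J ?J' (z, \<lambda>_\<in>?J'. 0))) = R k"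
        by (intro ext R_cong) (simp add: merge_def)
      ultimately show "R k \<in> borel_measurable (?L J)" by simp
    qed
    finally show ?thesis by (simp only: RJ)
  qed
  have "(\<integral>\<^sup>+z. \<integral>\<^sup>+\<omega>. \<phi> (edge_process r X U (added_points x z J) \<omega>) \<partial>M \<partial>?L {1..n})
      = (\<integral>\<^sup>+z. (\<Sum>k. ?c k * R k z) \<partial>?L {1..n})"
  proof (rule nn_integral_cong_AE)
    show "AE z in ?L {1..n}. (\<integral>\<^sup>+\<omega>. \<phi> (edge_process r X U (added_points x z J) \<omega>) \<partial>M) = (\<Sum>k. ?c k * R k z)"
      using AE_in_window[OF bounded W_borel, of "{1..n}", OF finite_atLeastAtMost]
    proof (elim eventually_mono)
      fix z :: "nat \<Rightarrow> real ^ 'd::{finite,linorder}" assume z: "\<forall>i\<in>{1..n}. z i \<in> W"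
      show "(\<integral>\<^sup>+\<omega>. \<phi> (edge_process r X U (added_points x z J) \<omega>) \<partial>M) = (\<Sum>k. ?c k * R k z)"
        unfolding R_def using z J K
        by (intro nn_integral_edge_process[OF M XU r W \<phi> det fJ]) auto
    qed
  qed
  also have "\<dots> = (\<Sum>k. \<integral>\<^sup>+z. ?c k * R k z \<partial>?L {1..n})"
    using R_meas by (intro nn_integral_suminf) auto
  also have "\<dots> = (\<Sum>k. ennreal (?w ^ (n - card J)) * (?c k * window_integral \<phi> x W (card J + k)))"
  proof (intro suminf_cong)
    fix k
    have "(\<integral>\<^sup>+z. ?c k * R k z \<partial>?L {1..n}) = ?c k * (\<integral>\<^sup>+z. R k z \<partial>?L {1..n})"
      using R_meas by (rule nn_integral_cmult)
    then show "(\<integral>\<^sup>+z. ?c k * R k z \<partial>?L {1..n}) = ennreal (?w ^ (n - card J)) * (?c k * window_integral \<phi> x W (card J + k))"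
      by (simp only: Rn mult.left_commute)
  qed
  also have "\<dots> = ennreal (?w ^ (n - card J)) * (\<Sum>k. ?c k * window_integral \<phi> x W (card J + k))"
    by (rule ennreal_suminf_cmult)
  finally show ?thesis .
qed

section \<open>Taylor expansion of exponential series\<close>

lemma exponential_binomial:
  fixes a b :: real
  shows "(\<Sum>j\<le>l. a ^ j / fact j * (b ^ (l - j) / fact (l - j))) = (a + b) ^ l / fact l"
proof -
  have "(a + b) ^ l / fact l = (\<Sum>j\<le>l. of_nat (l choose j) * a ^ j * b ^ (l - j)) / fact l"
    by (simp only: binomial_ring)
  also have "\<dots> = (\<Sum>j\<le>l. of_nat (l choose j) * a ^ j * b ^ (l - j) / fact l)"
    by (rule sum_divide_distrib)
  also have "\<dots> = (\<Sum>j\<le>l. a ^ j / fact j * (b ^ (l - j) / fact (l - j)))"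
  proof (rule sum.cong[OF refl])
    fix j assume "j \<in> {..l}"
    then have "(of_nat (l choose j) :: real) = fact l / (fact j * fact (l - j))"
      by (intro binomial_fact) simp
    then show "of_nat (l choose j) * a ^ j * b ^ (l - j) / fact l = a ^ j / fact j * (b ^ (l - j) / fact (l - j))"
      by simp
  qed
  finally show ?thesis by simp
qed

text \<open>For \<open>A u = (\<Sum>l. u ^ l / fact l * \<alpha> l)\<close>, the number \<open>\<beta> j\<close> is the \<open>j\<close>-th derivative of \<open>A\<close> at \<open>s\<close>, and
  the claim is the Taylor expansion of \<open>A (s + t)\<close> around \<open>s\<close>. Absolute convergence at \<open>s + \<bar>t\<bar>\<close> allows
  summing the double series \<open>p\<close> both by rows and, in the form \<open>F\<close>, by antidiagonals.\<close>

lemma taylor_shift: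
  fixes \<alpha> :: "nat \<Rightarrow> real" and s t :: real
  defines "\<beta> \<equiv> \<lambda>j. \<Sum>k. s ^ k / fact k * \<alpha> (j + k)"
  assumes s: "s \<ge> 0" and t: "t \<noteq> 0"
    and summ: "summable (\<lambda>l. (s + \<bar>t\<bar>) ^ l / fact l * \<bar>\<alpha> l\<bar>)"
  shows "summable (\<lambda>k. \<bar>s ^ k / fact k * \<alpha> (j + k)\<bar>)"
    and "summable (\<lambda>j. \<bar>t ^ j / fact j * \<beta> j\<bar>)"
    and "(\<lambda>j. t ^ j / fact j * \<beta> j) sums (\<Sum>l. (s + t) ^ l / fact l * \<alpha> l)"
proof -
  let ?A = "SIGMA l:(UNIV :: nat set). {..l}"
  define F where "F = (\<lambda>(l, j). t ^ j / fact j * (s ^ (l - j) / fact (l - j)) * \<alpha> l)"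
  define p where "p = (\<lambda>(j, k). t ^ j / fact j * (s ^ k / fact k * \<alpha> (j + k)))"
  have F_row: "(\<Sum>j\<le>l. F (l, j)) = (s + t) ^ l / fact l * \<alpha> l" for l
    by (simp only: F_def prod.case sum_distrib_right[symmetric] exponential_binomial add.commute[of s t])
  have F_norm_row: "(\<Sum>j\<le>l. norm (F (l, j))) = (s + \<bar>t\<bar>) ^ l / fact l * \<bar>\<alpha> l\<bar>" for l
  proof -
    have "(\<Sum>j\<le>l. norm (F (l, j))) = (\<Sum>j\<le>l. \<bar>t\<bar> ^ j / fact j * (s ^ (l - j) / fact (l - j))) * \<bar>\<alpha> l\<bar>"
      using s by (simp add: F_def abs_mult power_abs sum_distrib_right)
    then show ?thesis by (simp only: exponential_binomial add.commute[of s])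
  qed
  have "(\<lambda>l. (s + \<bar>t\<bar>) ^ l / fact l * \<bar>\<alpha> l\<bar>) summable_on UNIV"
    using s summ by (intro norm_summable_imp_summable_on) (simp add: abs_mult)
  moreover have "norm (infsum (\<lambda>j. norm (F (l, j))) {..l}) = (s + \<bar>t\<bar>) ^ l / fact l * \<bar>\<alpha> l\<bar>" for l
    using s by (simp only: infsum_finite finite_atMost F_norm_row) (simp add: abs_mult)
  ultimately have F_abs: "(\<lambda>q. norm (F q)) summable_on ?A"
    by (simp only: Infinite_Sum.abs_summable_on_Sigma_iff summable_on_finite finite_atMost) simp
  then have F_sum: "F summable_on ?A" by (rule abs_summable_summable)
  have bij: "bij_betw (\<lambda>(j, k). (j + k, j)) (UNIV \<times> UNIV) ?A"
    by (rule bij_betwI[where g = "\<lambda>(l, j). (j, l - j)"]) auto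
  have Fp: "F (case q of (j, k) \<Rightarrow> (j + k, j)) = p q" for q
    by (simp add: F_def p_def case_prod_unfold)
  have p_abs: "(\<lambda>q. norm (p q)) summable_on (UNIV \<times> UNIV)"
    using summable_on_reindex_bij_betw[OF bij, of "\<lambda>q. norm (F q)"] F_abs by (simp only: Fp)
  then have p_sum: "p summable_on (UNIV \<times> UNIV)" by (rule abs_summable_summable)
  have rows: "(\<lambda>k. norm (p (j, k))) summable_on UNIV" for j
    using p_abs unfolding Infinite_Sum.abs_summable_on_Sigma_iff by blast
  have row_sums: "(\<lambda>j. norm (infsum (\<lambda>k. norm (p (j, k))) UNIV)) summable_on UNIV"
    using p_abs unfolding Infinite_Sum.abs_summable_on_Sigma_iff by blast
  have row_summable: "summable (\<lambda>k. \<bar>s ^ k / fact k * \<alpha> (j + k)\<bar>)" for j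
  proof -
    have "summable (\<lambda>k. \<bar>t ^ j / fact j\<bar> * \<bar>s ^ k / fact k * \<alpha> (j + k)\<bar>)"
      using summable_on_imp_summable[OF rows[of j]] by (simp add: p_def abs_mult)
    then show ?thesis using t by (subst (asm) summable_cmult_iff) simp
  qed
  then show "summable (\<lambda>k. \<bar>s ^ k / fact k * \<alpha> (j + k)\<bar>)" .
  have p_row: "infsum (\<lambda>k. p (j, k)) UNIV = t ^ j / fact j * \<beta> j" for j
  proof -
    have "(\<lambda>k. s ^ k / fact k * \<alpha> (j + k)) sums \<beta> j"
      unfolding \<beta>_def by (rule summable_sums[OF summable_rabs_cancel[OF row_summable]])
    then have "(\<lambda>k. p (j, k)) sums (t ^ j / fact j * \<beta> j)"
      unfolding p_def prod.case by (rule sums_mult)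
    moreover have "summable (\<lambda>k. norm (p (j, k)))" by (rule summable_on_imp_summable[OF rows])
    ultimately show ?thesis by (intro infsumI norm_summable_imp_has_sum)
  qed
  have "summable (\<lambda>j. infsum (\<lambda>k. norm (p (j, k))) UNIV)"
    using summable_on_imp_summable[OF row_sums] by (simp add: infsum_nonneg)
  then have \<beta>_abs: "summable (\<lambda>j. \<bar>t ^ j / fact j * \<beta> j\<bar>)"
  proof (rule summable_comparison_test[rotated], intro exI allI impI)
    fix j
    have "norm (infsum (\<lambda>k. p (j, k)) UNIV) \<le> infsum (\<lambda>k. norm (p (j, k))) UNIV"
      by (rule norm_infsum_bound[OF rows])
    then show "norm \<bar>t ^ j / fact j * \<beta> j\<bar> \<le> infsum (\<lambda>k. norm (p (j, k))) UNIV"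
      by (simp add: p_row)
  qed
  then show "summable (\<lambda>j. \<bar>t ^ j / fact j * \<beta> j\<bar>)" .
  have "(\<lambda>j. t ^ j / fact j * \<beta> j) summable_on UNIV"
    by (rule norm_summable_imp_summable_on) (simp only: real_norm_def \<beta>_abs)
  then have "(\<lambda>j. t ^ j / fact j * \<beta> j) sums infsum (\<lambda>j. t ^ j / fact j * \<beta> j) UNIV"
    by (intro has_sum_imp_sums has_sum_infsum)
  also have "infsum (\<lambda>j. t ^ j / fact j * \<beta> j) UNIV = infsum p (UNIV \<times> UNIV)"
    using infsum_Sigma_banach[OF p_sum] by (simp only: p_row)
  also have "\<dots> = infsum F ?A"
    using infsum_reindex_bij_betw[OF bij, of F] by (simp only: Fp)
  also have "\<dots> = infsum (\<lambda>l. infsum (\<lambda>j. F (l, j)) {..l}) UNIV"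
    by (rule infsum_Sigma_banach[OF F_sum, symmetric])
  also have "\<dots> = infsum (\<lambda>l. (s + t) ^ l / fact l * \<alpha> l) UNIV"
    by (simp only: infsum_finite finite_atMost F_row)
  also have "\<dots> = (\<Sum>l. (s + t) ^ l / fact l * \<alpha> l)"
  proof -
    have "summable (\<lambda>l. norm ((s + t) ^ l / fact l * \<alpha> l))"
    proof (rule summable_comparison_test[OF _ summ], intro exI allI impI)
      fix l
      have "\<bar>s + t\<bar> ^ l \<le> (s + \<bar>t\<bar>) ^ l" using s by (intro power_mono) auto
      then show "norm (norm ((s + t) ^ l / fact l * \<alpha> l)) \<le> (s + \<bar>t\<bar>) ^ l / fact l * \<bar>\<alpha> l\<bar>"
        by (simp add: abs_mult power_abs divide_right_mono mult_right_mono)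
    qed
    from norm_summable_imp_has_sum[OF this summable_sums[OF summable_norm_cancel[OF this]]]
    show ?thesis by (rule infsumI)
  qed
  finally show "(\<lambda>j. t ^ j / fact j * \<beta> j) sums (\<Sum>l. (s + t) ^ l / fact l * \<alpha> l)" .
qed

text \<open>The Leibniz rule for \<open>exp (- w * u) * A u\<close> in terms of power series: the alternating sum over the subsets of \<open>{1..n}\<close> is a convolution with the exponential series
  of \<open>- t * w\<close>, which turns the factor \<open>exp (- s * w)\<close> into \<open>exp (- (s + t) * w)\<close>.\<close>

lemma alternating_expansion:
  fixes \<alpha> :: "nat \<Rightarrow> real" and s t w :: real
  defines "\<beta> \<equiv> \<lambda>j. \<Sum>k. s ^ k / fact k * \<alpha> (j + k)"
  assumes s: "s \<ge> 0" and t: "t \<noteq> 0"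
    and summ: "summable (\<lambda>l. (s + \<bar>t\<bar>) ^ l / fact l * \<bar>\<alpha> l\<bar>)"
  shows "(\<lambda>n. t ^ n / fact n * (\<Sum>J\<in>Pow {1..n}. (- 1) ^ (n - card J) * (exp (- (s * w)) * w ^ (n - card J) * \<beta> (card J))))
    sums (exp (- ((s + t) * w)) * (\<Sum>l. (s + t) ^ l / fact l * \<alpha> l))"
proof -
  have \<beta>: "\<beta> j = (\<Sum>k. s ^ k / fact k * \<alpha> (j + k))" for j
    by (simp only: \<beta>_def)
  note shift = taylor_shift[OF s t summ, folded \<beta>]
  have e_abs: "summable (\<lambda>m. norm ((- (t * w)) ^ m / fact m))"
    using summable_norm_exp[of "- (t * w)"] by (simp add: divide_inverse mult.commute abs_mult)
  have e_sum: "(\<Sum>m. (- (t * w)) ^ m / fact m) = exp (- (t * w))"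
    by (simp add: exp_def divide_inverse mult.commute)
  have conv: "(\<Sum>j\<le>n. t ^ j / fact j * \<beta> j * ((- (t * w)) ^ (n - j) / fact (n - j)))
      = t ^ n / fact n * (\<Sum>J\<in>Pow {1..n}. (- w) ^ (n - card J) * \<beta> (card J))" for n
  proof -
    have "(\<Sum>J\<in>Pow {1..n}. (- w) ^ (n - card J) * \<beta> (card J))
        = (\<Sum>j\<le>n. \<Sum>J | J \<in> Pow {1..n} \<and> card J = j. (- w) ^ (n - card J) * \<beta> (card J))"
      using card_mono[of "{1..n}"] by (intro sum.group[symmetric]) auto
    also have "\<dots> = (\<Sum>j\<le>n. of_nat (n choose j) * ((- w) ^ (n - j) * \<beta> j))"
      using n_subsets[of "{1..n}"] by (intro sum.cong) auto
    finally have "t ^ n / fact n * (\<Sum>J\<in>Pow {1..n}. (- w) ^ (n - card J) * \<beta> (card J))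
        = (\<Sum>j\<le>n. t ^ n / fact n * (of_nat (n choose j) * ((- w) ^ (n - j) * \<beta> j)))"
      by (simp add: sum_distrib_left)
    also have "\<dots> = (\<Sum>j\<le>n. t ^ j / fact j * \<beta> j * ((- (t * w)) ^ (n - j) / fact (n - j)))"
    proof (rule sum.cong[OF refl])
      fix j assume j: "j \<in> {..n}"
      then have c: "(of_nat (n choose j) :: real) = fact n / (fact j * fact (n - j))"
        by (intro binomial_fact) simp
      have "t ^ n = t ^ j * t ^ (n - j)" using j by (simp flip: power_add)
      moreover have "(- (t * w)) ^ (n - j) = t ^ (n - j) * (- w) ^ (n - j)"
        by (simp flip: power_mult_distrib)
      ultimately show "t ^ n / fact n * (of_nat (n choose j) * ((- w) ^ (n - j) * \<beta> j))
          = t ^ j / fact j * \<beta> j * ((- (t * w)) ^ (n - j) / fact (n - j))"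
        by (simp add: c)
    qed
    finally show ?thesis by simp
  qed
  have term_eq: "t ^ n / fact n * (\<Sum>J\<in>Pow {1..n}. (- 1) ^ (n - card J) * (exp (- (s * w)) * w ^ (n - card J) * \<beta> (card J)))
      = exp (- (s * w)) * (t ^ n / fact n * (\<Sum>J\<in>Pow {1..n}. (- w) ^ (n - card J) * \<beta> (card J)))" for n
  proof -
    have "(- 1) ^ m * (exp (- (s * w)) * w ^ m * b) = exp (- (s * w)) * ((- w) ^ m * b)" for m and b :: real
      by (subst power_minus[of w]) simp
    then show ?thesis
      by (simp only: sum_distrib_left[symmetric] mult.left_commute[of "t ^ n / fact n"])
  qed
  have "(\<lambda>n. \<Sum>j\<le>n. t ^ j / fact j * \<beta> j * ((- (t * w)) ^ (n - j) / fact (n - j)))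
      sums ((\<Sum>j. t ^ j / fact j * \<beta> j) * (\<Sum>m. (- (t * w)) ^ m / fact m))"
    using shift(2) e_abs by (intro Cauchy_product_sums) (simp_all only: real_norm_def)
  then have "(\<lambda>n. t ^ n / fact n * (\<Sum>J\<in>Pow {1..n}. (- w) ^ (n - card J) * \<beta> (card J)))
      sums ((\<Sum>l. (s + t) ^ l / fact l * \<alpha> l) * exp (- (t * w)))"
    unfolding conv e_sum sums_unique[OF shift(3), symmetric] .
  then have "(\<lambda>n. exp (- (s * w)) * (t ^ n / fact n * (\<Sum>J\<in>Pow {1..n}. (- w) ^ (n - card J) * \<beta> (card J))))
      sums (exp (- (s * w)) * ((\<Sum>l. (s + t) ^ l / fact l * \<alpha> l) * exp (- (t * w))))"
    by (rule sums_mult)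
  moreover have "exp (- (s * w)) * ((\<Sum>l. (s + t) ^ l / fact l * \<alpha> l) * exp (- (t * w)))
      = exp (- ((s + t) * w)) * (\<Sum>l. (s + t) ^ l / fact l * \<alpha> l)"
    by (simp add: exp_add[symmetric] algebra_simps)
  ultimately show ?thesis by (simp only: term_eq)
qed

section \<open>Expectations at varying intensity\<close>

lemma suminf_weights_enn2real:
  fixes a A :: "nat \<Rightarrow> ennreal" and c :: "nat \<Rightarrow> real"
  assumes c: "\<And>k. c k \<ge> 0" and a: "\<And>k. a k \<le> A k" and A: "\<And>k. A k < \<infinity>"
    and summ: "summable (\<lambda>k. c k * enn2real (A k))"
  shows "summable (\<lambda>k. c k * enn2real (a k))"
    and "(\<Sum>k. ennreal (c k) * a k) = ennreal (\<Sum>k. c k * enn2real (a k))"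
proof -
  have fin: "a k < \<infinity>" for k using a A le_less_trans by blast
  show summ_a: "summable (\<lambda>k. c k * enn2real (a k))"
  proof (rule summable_comparison_test[OF _ summ], intro exI allI impI)
    fix k
    have "enn2real (a k) \<le> enn2real (A k)" using a A by (intro enn2real_mono) auto
    then show "norm (c k * enn2real (a k)) \<le> c k * enn2real (A k)"
      using c by (simp add: mult_left_mono)
  qed
  have "ennreal (c k) * a k = ennreal (c k * enn2real (a k))" for k
    using c fin[of k] by (simp add: ennreal_mult less_top)
  then show "(\<Sum>k. ennreal (c k) * a k) = ennreal (\<Sum>k. c k * enn2real (a k))"
    using c summ_a by (simp only:) (intro suminf_ennreal2, simp_all)
qed

lemma window_integral_mono:
  assumes "\<And>\<mu>. \<phi> \<mu> \<le> \<psi> \<mu>"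
  shows "window_integral \<phi> x W m \<le> window_integral \<psi> x W m"
  unfolding window_integral_def rooted_mean_def mean_over_marks_def
  by (intro nn_integral_mono assms)

text \<open>The counterpart of \<^const>\<open>window_integral\<close> for a functional that takes values of both signs.\<close>

definition signed_window_integral ::
  "(((real ^ 'd::{finite,linorder}) set \<times> real) measure \<Rightarrow> real) \<Rightarrow> real ^ 'd::{finite,linorder} \<Rightarrow>
   (real ^ 'd::{finite,linorder}) set \<Rightarrow> nat \<Rightarrow> real"
  where "signed_window_integral f x W m =
    enn2real (window_integral (\<lambda>\<mu>. ennreal (f \<mu>)) x W m) - enn2real (window_integral (\<lambda>\<mu>. ennreal (- f \<mu>)) x W m)"

lemma abs_signed_window_integral_le:
  assumes fin: "window_integral (\<lambda>\<mu>. ennreal \<bar>f \<mu>\<bar>) x W m < \<infinity>"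
  shows "\<bar>signed_window_integral f x W m\<bar> \<le> enn2real (window_integral (\<lambda>\<mu>. ennreal \<bar>f \<mu>\<bar>) x W m)"
proof -
  have "enn2real (window_integral (\<lambda>\<mu>. ennreal (f \<mu>)) x W m) \<le> enn2real (window_integral (\<lambda>\<mu>. ennreal \<bar>f \<mu>\<bar>) x W m)"
    using fin by (intro enn2real_mono window_integral_mono ennreal_leI) auto
  moreover have "enn2real (window_integral (\<lambda>\<mu>. ennreal (- f \<mu>)) x W m) \<le> enn2real (window_integral (\<lambda>\<mu>. ennreal \<bar>f \<mu>\<bar>) x W m)"
    using fin by (intro enn2real_mono window_integral_mono ennreal_leI) auto
  ultimately show ?thesis
    unfolding signed_window_integral_def
    using enn2real_nonneg[of "window_integral (\<lambda>\<mu>. ennreal (f \<mu>)) x W m"]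
      enn2real_nonneg[of "window_integral (\<lambda>\<mu>. ennreal (- f \<mu>)) x W m"] by linarith
qed

text \<open>The formula for nonnegative functionals is applied to the absolute value, which gives
  integrability, and to the positive and the negative part. Working with the product of the window
  and the probability space leaves the exchange of the integrals to Fubini's theorem.\<close>

lemma integral_added_points_edge_process:
  fixes X :: "nat \<Rightarrow> 'w \<Rightarrow> real ^ 'd::{finite,linorder}"
  assumes M: "prob_space M" and XU: "marked_poisson M r X U" and r: "r \<ge> 0"
    and W: "compact W" "{0, x} \<subseteq> W"
    and f: "f \<in> borel_measurable (point_measure_space marked_edge_metric)"
    and det: "determined_by f W"
    and J: "J \<subseteq> {1..n}"
    and fin: "\<And>m. window_integral (\<lambda>\<mu>. ennreal \<bar>f \<mu>\<bar>) x W m < \<infinity>"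
    and summ: "summable (\<lambda>k. r ^ k / fact k * enn2real (window_integral (\<lambda>\<mu>. ennreal \<bar>f \<mu>\<bar>) x W (card J + k)))"
  defines "G \<equiv> \<lambda>q. f (edge_process r X U (added_points x (fst q) J) (snd q))"
  shows "integrable ((\<Pi>\<^sub>M i\<in>{1..n}. window_measure W) \<Otimes>\<^sub>M M) G"
    and "(\<integral>q. G q \<partial>((\<Pi>\<^sub>M i\<in>{1..n}. window_measure W) \<Otimes>\<^sub>M M)) =
      exp (- (r * measure lborel W)) * measure lborel W ^ (n - card J) *
        (\<Sum>k. r ^ k / fact k * signed_window_integral f x W (card J + k))"
proof -
  interpret prob_space M by (rule M)
  let ?L = "\<Pi>\<^sub>M i\<in>{1..n}. window_measure W"
  let ?w = "measure lborel W"
  let ?e = "exp (- (r * ?w))"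
  let ?c = "\<lambda>k. ?e * r ^ k / fact k"
  let ?A = "window_integral (\<lambda>\<mu>. ennreal \<bar>f \<mu>\<bar>) x W"
  have c: "?c k \<ge> 0" for k using r by simp
  have summ': "summable (\<lambda>k. ?c k * enn2real (?A (card J + k)))"
    using summable_mult[OF summ, of ?e] by (simp add: mult.assoc)
  have "G = (\<lambda>q. f (edge_process r (\<lambda>j q. X j (snd q)) (\<lambda>p q. U p (snd q)) (added_points x (\<lambda>i. fst q i) J) q))"
    by (simp add: G_def edge_process_def)
  also have "\<dots> \<in> borel_measurable (?L \<Otimes>\<^sub>M M)"
  proof (rule edge_process_measurable[OF f])
    show "(\<lambda>q. fst q i) \<in> borel_measurable (?L \<Otimes>\<^sub>M M)" if "i \<in> J" for i
    proof -
      have "(\<lambda>z. z i) \<in> ?L \<rightarrow>\<^sub>M window_measure W"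
        using that J by (intro measurable_component_singleton) auto
      then have "(\<lambda>q. fst q i) \<in> ?L \<Otimes>\<^sub>M M \<rightarrow>\<^sub>M window_measure W"
        by (rule measurable_compose[OF measurable_fst])
      then show ?thesis by (simp only: measurable_cong_sets[OF refl sets_window_measure])
    qed
    show "(\<lambda>q. X j (snd q)) \<in> borel_measurable (?L \<Otimes>\<^sub>M M)" if "r > 0" for j
      using XU that by (intro measurable_compose[OF measurable_snd]) (simp add: marked_poisson_def poisson_points_def)
    show "finite {j. X j (snd q) \<in> C}" if "r > 0" "bounded C" "q \<in> space (?L \<Otimes>\<^sub>M M)" for C q
      using XU that by (simp add: marked_poisson_def poisson_points_def space_pair_measure mem_Times_iff)
    show "(\<lambda>q. U p (snd q)) \<in> borel_measurable (?L \<Otimes>\<^sub>M M)" for p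
      using XU unfolding marked_poisson_def by (intro measurable_compose[OF measurable_snd]) blast
    show "U p (snd q) \<in> {0..1}" if "q \<in> space (?L \<Otimes>\<^sub>M M)" for p q
    proof -
      have "snd q \<in> space M" using that by (simp only: space_pair_measure mem_Times_iff)
      then show ?thesis using XU unfolding marked_poisson_def by blast
    qed
  qed (use J finite_subset in auto)
  finally have G_meas: "G \<in> borel_measurable (?L \<Otimes>\<^sub>M M)" .
  have part: "(\<integral>\<^sup>+q. ennreal (g (G q)) \<partial>(?L \<Otimes>\<^sub>M M)) =
      ennreal (?w ^ (n - card J) * (\<Sum>k. ?c k * enn2real (window_integral (\<lambda>\<mu>. ennreal (g (f \<mu>))) x W (card J + k))))"
      and part_summable: "summable (\<lambda>k. ?c k * enn2real (window_integral (\<lambda>\<mu>. ennreal (g (f \<mu>))) x W (card J + k)))"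
    if g: "g \<in> borel_measurable borel" "\<And>v. g v \<le> \<bar>v\<bar>" for g :: "real \<Rightarrow> real"
  proof -
    let ?\<phi> = "\<lambda>\<mu>. ennreal (g (f \<mu>))"
    have \<phi>: "?\<phi> \<in> borel_measurable (point_measure_space marked_edge_metric)"
      by (rule measurable_compose[OF measurable_compose[OF f g(1)] measurable_ennreal])
    have "(\<integral>\<^sup>+q. ennreal (g (G q)) \<partial>(?L \<Otimes>\<^sub>M M)) = (\<integral>\<^sup>+z. \<integral>\<^sup>+\<omega>. ennreal (g (G (z, \<omega>))) \<partial>M \<partial>?L)"
      by (rule nn_integral_fst[symmetric]) (rule measurable_compose[OF measurable_compose[OF G_meas g(1)] measurable_ennreal])
    also have "\<dots> = ennreal (?w ^ (n - card J)) * (\<Sum>k. ennreal (?c k) * window_integral ?\<phi> x W (card J + k))"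
      unfolding G_def fst_conv snd_conv
    proof (rule nn_integral_added_points_edge_process[OF M XU r W \<phi> _ J])
      show "?\<phi> \<mu> = ?\<phi> (restrict_edges W \<mu>)" if "\<mu> \<in> point_measures marked_edge_metric" for \<mu>
        using det that unfolding determined_by_def by (metis (no_types))
    qed
    also have "(\<Sum>k. ennreal (?c k) * window_integral ?\<phi> x W (card J + k)) =
        ennreal (\<Sum>k. ?c k * enn2real (window_integral ?\<phi> x W (card J + k)))"
      by (rule suminf_weights_enn2real(2)[OF c window_integral_mono fin summ']) (intro ennreal_leI g(2))
    also have "ennreal (?w ^ (n - card J)) * \<dots> = ennreal (?w ^ (n - card J) * (\<Sum>k. ?c k * enn2real (window_integral ?\<phi> x W (card J + k))))"
      by (rule ennreal_mult'[symmetric]) simp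
    finally show "(\<integral>\<^sup>+q. ennreal (g (G q)) \<partial>(?L \<Otimes>\<^sub>M M)) =
      ennreal (?w ^ (n - card J) * (\<Sum>k. ?c k * enn2real (window_integral (\<lambda>\<mu>. ennreal (g (f \<mu>))) x W (card J + k))))" .
    show "summable (\<lambda>k. ?c k * enn2real (window_integral ?\<phi> x W (card J + k)))"
      by (rule suminf_weights_enn2real(1)[OF c window_integral_mono fin summ']) (intro ennreal_leI g(2))
  qed
  have pos: "0 \<le> ?w ^ (n - card J) * (\<Sum>k. ?c k * enn2real (window_integral \<phi> x W (card J + k)))"
    if "summable (\<lambda>k. ?c k * enn2real (window_integral \<phi> x W (card J + k)))" for \<phi>
    using that c by (intro mult_nonneg_nonneg suminf_nonneg) simp_all
  have "(\<integral>\<^sup>+q. ennreal \<bar>G q\<bar> \<partial>(?L \<Otimes>\<^sub>M M)) < \<infinity>"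
    by (subst part[of abs]) simp_all
  then show int: "integrable (?L \<Otimes>\<^sub>M M) G"
    using G_meas by (intro integrableI_bounded) simp_all
  note plus = part[of "\<lambda>v. v"] part_summable[of "\<lambda>v. v"] and minus = part[of uminus] part_summable[of uminus]
  let ?p = "\<lambda>k. enn2real (window_integral (\<lambda>\<mu>. ennreal (f \<mu>)) x W (card J + k))"
  let ?m = "\<lambda>k. enn2real (window_integral (\<lambda>\<mu>. ennreal (- f \<mu>)) x W (card J + k))"
  have sp: "summable (\<lambda>k. ?c k * ?p k)" by (rule plus(2)) simp_all
  have sm: "summable (\<lambda>k. ?c k * ?m k)" by (rule minus(2)) simp_all
  have "(\<integral>\<^sup>+q. ennreal (G q) \<partial>(?L \<Otimes>\<^sub>M M)) = ennreal (?w ^ (n - card J) * (\<Sum>k. ?c k * ?p k))"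
    by (rule plus(1)) simp_all
  moreover have "(\<integral>\<^sup>+q. ennreal (- G q) \<partial>(?L \<Otimes>\<^sub>M M)) = ennreal (?w ^ (n - card J) * (\<Sum>k. ?c k * ?m k))"
    by (rule minus(1)) simp_all
  ultimately have "(\<integral>q. G q \<partial>(?L \<Otimes>\<^sub>M M)) = ?w ^ (n - card J) * (\<Sum>k. ?c k * ?p k) - ?w ^ (n - card J) * (\<Sum>k. ?c k * ?m k)"
    using pos[OF sp] pos[OF sm] by (simp only: real_lebesgue_integral_def[OF int] enn2real_ennreal)
  also have "\<dots> = ?w ^ (n - card J) * (\<Sum>k. ?c k * ?p k - ?c k * ?m k)"
    by (simp only: right_diff_distrib[symmetric] suminf_diff[OF sp sm])
  also have "(\<lambda>k. ?c k * ?p k - ?c k * ?m k) = (\<lambda>k. ?e * (r ^ k / fact k * signed_window_integral f x W (card J + k)))"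
    by (intro ext) (simp add: signed_window_integral_def algebra_simps diff_divide_distrib)
  also have "(\<Sum>k. ?e * (r ^ k / fact k * signed_window_integral f x W (card J + k))) =
      ?e * (\<Sum>k. r ^ k / fact k * signed_window_integral f x W (card J + k))"
  proof (rule suminf_mult)
    show "summable (\<lambda>k. r ^ k / fact k * signed_window_integral f x W (card J + k))"
    proof (rule summable_comparison_test[OF _ summ], intro exI allI impI)
      fix k
      show "norm (r ^ k / fact k * signed_window_integral f x W (card J + k)) \<le> r ^ k / fact k * enn2real (?A (card J + k))"
        using r abs_signed_window_integral_le[OF fin, of "card J + k"]
        by (simp add: abs_mult mult_left_mono divide_right_mono)
    qed
  qed
  finally show "(\<integral>q. G q \<partial>(?L \<Otimes>\<^sub>M M)) =
      ?e * ?w ^ (n - card J) * (\<Sum>k. r ^ k / fact k * signed_window_integral f x W (card J + k))"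
    by (simp only: mult_ac)
qed

lemma rooted_functional_eq:
  "rooted_functional f x r X U \<omega> = f (edge_process r X U (added_points x z {}) \<omega>)"
proof -
  have "added_points x z {} = [0 \<mapsto> 0, 1 \<mapsto> x]" by (auto simp: added_points_def map_add_def)
  then show ?thesis by (simp add: rooted_functional_def)
qed

lemma integral_rooted_functional:
  fixes X :: "nat \<Rightarrow> 'w \<Rightarrow> real ^ 'd::{finite,linorder}"
  assumes M: "prob_space M" and XU: "marked_poisson M r X U" and r: "r \<ge> 0"
    and W: "compact W" "{0, x} \<subseteq> W"
    and f: "f \<in> borel_measurable (point_measure_space marked_edge_metric)"
    and det: "determined_by f W"
    and fin: "\<And>m. window_integral (\<lambda>\<mu>. ennreal \<bar>f \<mu>\<bar>) x W m < \<infinity>"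
    and summ: "summable (\<lambda>k. r ^ k / fact k * enn2real (window_integral (\<lambda>\<mu>. ennreal \<bar>f \<mu>\<bar>) x W k))"
  shows "integrable M (rooted_functional f x r X U)"
    and "(\<integral>\<omega>. rooted_functional f x r X U \<omega> \<partial>M) =
      exp (- (r * measure lborel W)) * (\<Sum>k. r ^ k / fact k * signed_window_integral f x W k)"
proof -
  interpret prob_space M by (rule M)
  let ?L = "\<Pi>\<^sub>M i\<in>{1..0::nat}. window_measure W" and ?z = "\<lambda>_ :: nat. undefined :: real ^ 'd::{finite,linorder}"
  let ?G = "\<lambda>q. f (edge_process r X U (added_points x (fst q) {}) (snd q))"
  have L_eq: "?L = count_space {?z}" by (simp add: PiM_empty)
  interpret L: sigma_finite_measure ?L
    unfolding L_eq by (rule sigma_finite_measure_count_space_finite) simp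
  interpret pair_sigma_finite ?L M ..
  have J: "{} \<subseteq> {1..0::nat}" by simp
  have summ': "summable (\<lambda>k. r ^ k / fact k * enn2real (window_integral (\<lambda>\<mu>. ennreal \<bar>f \<mu>\<bar>) x W (card ({} :: nat set) + k)))"
    using summ by simp
  note G = integral_added_points_edge_process[OF M XU r W f det J fin summ']
  have F: "(\<lambda>\<omega>. ?G (z, \<omega>)) = rooted_functional f x r X U" for z
    by (intro ext) (simp add: rooted_functional_eq[of f x r X U _ z])
  have "AE z in ?L. integrable M (\<lambda>\<omega>. ?G (z, \<omega>))"
    by (rule AE_integrable_fst'[OF G(1)])
  then show "integrable M (rooted_functional f x r X U)"
    unfolding F L_eq AE_count_space by simp
  have "(\<integral>z. \<integral>\<omega>. ?G (z, \<omega>) \<partial>M \<partial>?L) = (\<integral>q. ?G q \<partial>(?L \<Otimes>\<^sub>M M))"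
    by (rule integral_fst'[OF G(1)])
  moreover have "(\<integral>z. \<integral>\<omega>. ?G (z, \<omega>) \<partial>M \<partial>?L) = (\<integral>\<omega>. rooted_functional f x r X U \<omega> \<partial>M)"
    unfolding F L_eq by (simp add: lebesgue_integral_count_space_finite)
  ultimately show "(\<integral>\<omega>. rooted_functional f x r X U \<omega> \<partial>M) =
      exp (- (r * measure lborel W)) * (\<Sum>k. r ^ k / fact k * signed_window_integral f x W k)"
    using G(2) by simp
qed

text \<open>At a positive intensity every weight in the expansion of the expected absolute value is positive,
  so that a single finite expectation bounds all terms.\<close>

lemma window_integrals_summable:
  fixes X :: "nat \<Rightarrow> 'w \<Rightarrow> real ^ 'd::{finite,linorder}"
  assumes M: "prob_space M" and XU: "marked_poisson M r X U" and r: "r > 0"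
    and W: "compact W" "{0, x} \<subseteq> W"
    and f: "f \<in> borel_measurable (point_measure_space marked_edge_metric)"
    and det: "determined_by f W"
    and int: "integrable M (rooted_functional f x r X U)"
  shows "window_integral (\<lambda>\<mu>. ennreal \<bar>f \<mu>\<bar>) x W m < \<infinity>"
    and "summable (\<lambda>k. r ^ k / fact k * enn2real (window_integral (\<lambda>\<mu>. ennreal \<bar>f \<mu>\<bar>) x W k))"
proof -
  have bounded: "bounded W" and W_borel: "W \<in> sets borel"
    using W(1) by (simp_all add: compact_imp_bounded compact_imp_closed)
  interpret L: product_sigma_finite "\<lambda>_. window_measure W"
    by (rule product_sigma_finite_window_measure[OF bounded W_borel])
  let ?\<phi> = "\<lambda>\<mu>. ennreal \<bar>f \<mu>\<bar>"
  let ?A = "window_integral ?\<phi> x W" and ?e = "exp (- (r * measure lborel W))"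
  let ?c = "\<lambda>k. ?e * r ^ k / fact k"
  have c: "?c k > 0" for k using r by simp
  have \<phi>: "?\<phi> \<in> borel_measurable (point_measure_space marked_edge_metric)"
    using f by simp
  have det': "?\<phi> \<mu> = ?\<phi> (restrict_edges W \<mu>)" if "\<mu> \<in> point_measures marked_edge_metric" for \<mu>
    using det that unfolding determined_by_def by (metis (no_types))
  have "(\<Sum>k. ennreal (?c k) * ?A k) = (\<integral>\<^sup>+z. \<integral>\<^sup>+\<omega>. ?\<phi> (edge_process r X U (added_points x z {}) \<omega>) \<partial>M \<partial>(\<Pi>\<^sub>M i\<in>{1..0::nat}. window_measure W))"
    using nn_integral_added_points_edge_process[OF M XU less_imp_le[OF r] W \<phi> det', of "{}" 0] by simp
  also have "\<dots> = (\<integral>\<^sup>+\<omega>. ennreal (norm (rooted_functional f x r X U \<omega>)) \<partial>M)"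
    by (simp add: L.nn_integral_empty rooted_functional_eq[of f x r X U _ "\<lambda>_. undefined"])
  also have "\<dots> < \<infinity>" using int by (simp add: integrable_iff_bounded)
  finally have total: "(\<Sum>k. ennreal (?c k) * ?A k) < \<infinity>" .
  have fin: "?A k < \<infinity>" for k
  proof -
    have "ennreal (?c k) * ?A k \<le> (\<Sum>k. ennreal (?c k) * ?A k)"
      using sum_le_suminf[of "\<lambda>k. ennreal (?c k) * ?A k" "{k}"] by simp
    then have "ennreal (?c k) * ?A k < \<infinity>" using total by (rule le_less_trans)
    then show ?thesis using c[of k] r by (auto simp: ennreal_mult_less_top)
  qed
  then show "?A m < \<infinity>" .
  have "ennreal (?c k) * ?A k = ennreal (?c k * enn2real (?A k))" for k
    using fin[of k] by (subst ennreal_mult[OF less_imp_le[OF c] enn2real_nonneg]) (simp add: less_top)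
  then have "(\<Sum>k. ennreal (?c k * enn2real (?A k))) \<noteq> \<top>"
    using total by (simp only: less_top infinity_ennreal_def)
  then have "summable (\<lambda>k. ?c k * enn2real (?A k))"
    by (rule summable_suminf_not_top[rotated]) (intro mult_nonneg_nonneg less_imp_le[OF c] enn2real_nonneg)
  then have "summable (\<lambda>k. ?e * (r ^ k / fact k * enn2real (?A k)))" by (simp add: mult.assoc)
  then show "summable (\<lambda>k. r ^ k / fact k * enn2real (?A k))"
    by (subst (asm) summable_cmult_iff) simp
qed

theorem theorem3p2:
  fixes M :: "'w measure"
    and X :: "real \<Rightarrow> nat \<Rightarrow> 'w \<Rightarrow> real ^ 'd::{finite,linorder}"
    and U :: "real \<Rightarrow> point_index \<times> point_index \<Rightarrow> 'w \<Rightarrow> real"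
    and f :: "((real ^ 'd::{finite,linorder}) set \<times> real) measure \<Rightarrow> real"
    and x :: "real ^ 'd::{finite,linorder}" and W :: "(real ^ 'd::{finite,linorder}) set" and s t :: real
    and F :: "real \<Rightarrow> 'w \<Rightarrow> real"
    and D :: "nat \<Rightarrow> (nat \<Rightarrow> real ^ 'd::{finite,linorder}) \<Rightarrow> 'w \<Rightarrow> real"
  assumes M: "prob_space M"
    and process: "\<And>r. r \<ge> 0 \<Longrightarrow> marked_poisson M r (X r) (U r)"
    and f: "f \<in> borel_measurable (point_measure_space marked_edge_metric)"
    and W: "compact W" "{0, x} \<subseteq> W"
    and det: "determined_by f W"
    and F: "\<And>r. r \<ge> 0 \<Longrightarrow> F r = rooted_functional f x r (X r) (U r)"
    and D: "\<And>n. D n = difference f x s (X s) (U s) n"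
    and s: "s \<ge> 0" and t: "t \<ge> - s"
    and int: "integrable M (F (s + \<bar>t\<bar>))"
  shows "integrable M (F (s + t)) \<and> integrable M (F s) \<and>
    (t \<noteq> 0 \<longrightarrow> (\<forall>n\<ge>1.
       (AE xs in \<Pi>\<^sub>M i\<in>{1..n}. lborel. xs \<in> {1..n} \<rightarrow>\<^sub>E W \<longrightarrow> integrable M (D n xs)) \<and>
       set_integrable (\<Pi>\<^sub>M i\<in>{1..n}. lborel) ({1..n} \<rightarrow>\<^sub>E W) (\<lambda>xs. LINT \<omega>|M. D n xs \<omega>))) \<and>
    summable (\<lambda>m. t ^ Suc m / fact (Suc m) *
       (LINT xs:({1..Suc m} \<rightarrow>\<^sub>E W)|(\<Pi>\<^sub>M i\<in>{1..Suc m}. lborel). LINT \<omega>|M. D (Suc m) xs \<omega>)) \<and>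
    (LINT \<omega>|M. F (s + t) \<omega>) = (LINT \<omega>|M. F s \<omega>) + (\<Sum>m. t ^ Suc m / fact (Suc m) *
       (LINT xs:({1..Suc m} \<rightarrow>\<^sub>E W)|(\<Pi>\<^sub>M i\<in>{1..Suc m}. lborel). LINT \<omega>|M. D (Suc m) xs \<omega>))"
proof -
  interpret prob_space M by (rule M)
  have bounded: "bounded W" and W_borel: "W \<in> sets borel"
    using W(1) by (simp_all add: compact_imp_bounded compact_imp_closed)
  let ?w = "measure lborel W" and ?\<alpha> = "signed_window_integral f x W"
  let ?A = "\<lambda>k. enn2real (window_integral (\<lambda>\<mu>. ennreal \<bar>f \<mu>\<bar>) x W k)"
  let ?B = "\<lambda>n. \<Pi>\<^sub>M i\<in>{1..n}. (lborel :: (real ^ 'd::{finite,linorder}) measure)"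
  \<comment> \<open>For \<open>t = 0\<close> all terms of the series vanish. Otherwise the intensity \<open>s + \<bar>t\<bar>\<close> is positive,
    so that integrability there controls the contribution of every number of points.\<close>
  show ?thesis
  proof (cases "t = 0")
    case True
    then show ?thesis using int by simp
  next
    case False
    define R where "R = s + \<bar>t\<bar>"
    have R: "R > 0" using False s by (simp add: R_def)
    have int_R: "integrable M (rooted_functional f x R (X R) (U R))"
      using int F[of R] R by (simp add: R_def)
    note fin = window_integrals_summable(1)[OF M process[OF less_imp_le[OF R]] R W f det int_R]
    note summ_R = window_integrals_summable(2)[OF M process[OF less_imp_le[OF R]] R W f det int_R]
    have le: "\<bar>?\<alpha> m\<bar> \<le> ?A m" for m by (rule abs_signed_window_integral_le[OF fin])
    have summ_abs: "summable (\<lambda>l. (s + \<bar>t\<bar>) ^ l / fact l * \<bar>?\<alpha> l\<bar>)"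
    proof (rule summable_comparison_test[OF _ summ_R], intro exI allI impI)
      fix k
      show "norm ((s + \<bar>t\<bar>) ^ k / fact k * \<bar>?\<alpha> k\<bar>) \<le> R ^ k / fact k * ?A k"
        using R le[of k] by (simp add: R_def abs_mult mult_left_mono divide_right_mono)
    qed
    have summ_le: "summable (\<lambda>k. r ^ k / fact k * ?A k)" if r: "0 \<le> r" "r \<le> R" for r
    proof (rule summable_comparison_test[OF _ summ_R], intro exI allI impI)
      fix k
      have "r ^ k \<le> R ^ k" using r by (intro power_mono)
      then show "norm (r ^ k / fact k * ?A k) \<le> R ^ k / fact k * ?A k"
        using r by (simp add: mult_right_mono divide_right_mono)
    qed
    have mean: "integrable M (F r)"
        "(LINT \<omega>|M. F r \<omega>) = exp (- (r * ?w)) * (\<Sum>k. r ^ k / fact k * ?\<alpha> k)"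
      if r: "0 \<le> r" "r \<le> R" for r
      using integral_rooted_functional[OF M process[OF r(1)] r(1) W f det fin summ_le[OF r]]
      by (simp_all add: F[OF r(1)])
    have st: "0 \<le> s + t" "s + t \<le> R" and sR: "s \<le> R" using t by (auto simp: R_def)
    define \<beta> where "\<beta> j = (\<Sum>k. s ^ k / fact k * ?\<alpha> (j + k))" for j
    have summ_shift: "summable (\<lambda>k. s ^ k / fact k * ?A (j + k))" for j
    proof -
      have "summable (\<lambda>l. (s + \<bar>t\<bar>) ^ l / fact l * \<bar>?A l\<bar>)"
        using summ_R by (simp add: R_def)
      from taylor_shift(1)[OF s False this, of j]
      show ?thesis using s by (simp add: abs_mult)
    qed
    \<comment> \<open>The integral of the expected \<open>n\<close>-th difference over \<open>W ^ n\<close>.\<close>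
    define T where "T n = (\<Sum>J\<in>Pow {1..n}. (- 1) ^ (n - card J) * (exp (- (s * ?w)) * ?w ^ (n - card J) * \<beta> (card J)))" for n
    have expansion: "(\<lambda>n. t ^ n / fact n * T n) sums (LINT \<omega>|M. F (s + t) \<omega>)"
      using alternating_expansion[OF s False summ_abs, of ?w] mean(2)[OF st]
      by (simp only: T_def \<beta>_def)
    have D_props: "AE xs in ?B n. xs \<in> {1..n} \<rightarrow>\<^sub>E W \<longrightarrow> integrable M (D n xs)"
        "set_integrable (?B n) ({1..n} \<rightarrow>\<^sub>E W) (\<lambda>xs. LINT \<omega>|M. D n xs \<omega>)"
        "(LINT xs:({1..n} \<rightarrow>\<^sub>E W)|?B n. LINT \<omega>|M. D n xs \<omega>) = T n" for n
    proof -
      let ?L = "\<Pi>\<^sub>M i\<in>{1..n}. window_measure W" and ?E = "{1..n} \<rightarrow>\<^sub>E W"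
      interpret L: product_sigma_finite "\<lambda>_. window_measure W"
        by (rule product_sigma_finite_window_measure[OF bounded W_borel])
      interpret Ln: sigma_finite_measure ?L by (rule L.sigma_finite) simp
      interpret pair_sigma_finite ?L M ..
      define G where "G J = (\<lambda>q. f (edge_process s (X s) (U s) (added_points x (fst q) J) (snd q)))" for J
      have G: "integrable (?L \<Otimes>\<^sub>M M) (G J)"
          "(LINT q|(?L \<Otimes>\<^sub>M M). G J q) = exp (- (s * ?w)) * ?w ^ (n - card J) * \<beta> (card J)"
        if "J \<in> Pow {1..n}" for J
        using integral_added_points_edge_process[OF M process[OF s] s W f det PowD[OF that] fin summ_shift]
        by (simp_all only: G_def \<beta>_def)
      define H where "H q = (\<Sum>J\<in>Pow {1..n}. (- 1) ^ (n - card J) * G J q)" for q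
      have H_D: "(\<lambda>\<omega>. H (xs, \<omega>)) = D n xs" for xs
        by (intro ext) (simp add: H_def G_def D difference_def)
      have H: "integrable (?L \<Otimes>\<^sub>M M) H"
        unfolding H_def by (intro Bochner_Integration.integrable_sum integrable_mult_right G(1))
      have "(LINT q|(?L \<Otimes>\<^sub>M M). H q) = (\<Sum>J\<in>Pow {1..n}. LINT q|(?L \<Otimes>\<^sub>M M). (- 1) ^ (n - card J) * G J q)"
        unfolding H_def by (intro Bochner_Integration.integral_sum integrable_mult_right G(1))
      also have "\<dots> = T n"
        unfolding T_def using G(2) by (intro sum.cong refl) (simp only: integral_mult_right_zero)
      finally have int_H: "(LINT q|(?L \<Otimes>\<^sub>M M). H q) = T n" .
      have E: "?E \<in> sets (?B n)" using W_borel by (intro sets_PiM_I_finite) auto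
      have L_density: "?L = density (?B n) (\<lambda>xs. ennreal (indicator ?E xs))"
        using PiM_window_measure[OF bounded W_borel, of "{1..n}"] by (simp add: ennreal_indicator)
      have E_meas: "(\<lambda>xs. ennreal (indicator ?E xs)) \<in> borel_measurable (?B n)"
        using E by measurable
      have "AE xs in ?L. integrable M (\<lambda>\<omega>. H (xs, \<omega>))" by (rule AE_integrable_fst'[OF H])
      then have "AE xs in ?B n. 0 < ennreal (indicator ?E xs) \<longrightarrow> integrable M (D n xs)"
        unfolding H_D L_density AE_density[OF E_meas] .
      then show "AE xs in ?B n. xs \<in> ?E \<longrightarrow> integrable M (D n xs)"
        by (elim eventually_mono) (auto simp: indicator_def split: if_splits)
      have int_D: "integrable ?L (\<lambda>xs. LINT \<omega>|M. D n xs \<omega>)"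
        using integrable_fst'[OF H] by (simp only: H_D)
      have D_meas: "(\<lambda>xs. LINT \<omega>|M. D n xs \<omega>) \<in> borel_measurable (?B n)"
        using borel_measurable_integrable[OF int_D] unfolding L_density by simp
      have ind: "indicator ?E \<in> borel_measurable (?B n)" "AE xs in ?B n. 0 \<le> (indicator ?E xs :: real)"
        using E by simp_all
      show "set_integrable (?B n) ?E (\<lambda>xs. LINT \<omega>|M. D n xs \<omega>)"
        using int_D unfolding set_integrable_def L_density integrable_density[OF D_meas ind] .
      have "(LINT xs:?E|?B n. LINT \<omega>|M. D n xs \<omega>) = (LINT xs|?L. LINT \<omega>|M. D n xs \<omega>)"
        unfolding set_lebesgue_integral_def L_density integral_density[OF D_meas ind] ..
      also have "\<dots> = (LINT q|(?L \<Otimes>\<^sub>M M). H q)"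
        using integral_fst'[OF H] by (simp only: H_D)
      finally show "(LINT xs:?E|?B n. LINT \<omega>|M. D n xs \<omega>) = T n" by (simp only: int_H)
    qed
    \<comment> \<open>The difference of order \<open>0\<close> is the functional itself.\<close>
    have zero: "t ^ 0 / fact 0 * T 0 = (LINT \<omega>|M. F s \<omega>)"
      using mean(2)[OF s sR] by (simp add: T_def \<beta>_def)
    have tail: "(\<lambda>m. t ^ Suc m / fact (Suc m) * T (Suc m)) sums ((LINT \<omega>|M. F (s + t) \<omega>) - (LINT \<omega>|M. F s \<omega>))"
      using expansion unfolding zero[symmetric] by (subst sums_Suc_iff) simp
    have eq: "(\<lambda>m. t ^ Suc m / fact (Suc m) * T (Suc m)) =
        (\<lambda>m. t ^ Suc m / fact (Suc m) * (LINT xs:({1..Suc m} \<rightarrow>\<^sub>E W)|?B (Suc m). LINT \<omega>|M. D (Suc m) xs \<omega>))"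
      by (simp only: D_props(3))
    have "(LINT \<omega>|M. F (s + t) \<omega>) = (LINT \<omega>|M. F s \<omega>) + (\<Sum>m. t ^ Suc m / fact (Suc m) * T (Suc m))"
      using sums_unique[OF tail] by simp
    then show ?thesis
      using mean(1)[OF st] mean(1)[OF s sR] D_props(1,2) sums_summable[OF tail] unfolding eq by blast
  qed
qed

end
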